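(* The exponential generating functions of the dimensions of the components of the operads $\mathcal{L}ie_2$ and $\mathcal{P}_2$ are $$f_{\mathcal{L}ie_2}(x)=\sum_{n\ge1}\frac{n^{n-1}x^n}{n!},\qquad f_{\mathcal{P}_2}(x)=\sum_{n\ge1}\frac{(n+1)^{n-1}x^n}{n!}.$$ Furthermore, the exponential generating functions of their $SL_2$-characters are $$f_{\mathcal{L}ie_2}(x,q)=\sum_{n\ge1}\frac{\prod_{k=1}^{n-1}\left(kq+(n-k)q^{-1}\right)x^n}{n!},\qquad f_{\mathcal{P}_2}(x,q)=\sum_{n\ge1}\frac{\prod_{k=1}^{n-1}\left(kq+1+(n-k)q^{-1}\right)x^n}{n!}.$$
   Context: The ground field $\mathbf{k}$ has characteristic zero. The operad $\mathcal{L}ie_2$ (two compatible brackets) is generated by two skew-symmetric binary operations $\{\cdot,\cdot\}_1,\{\cdot,\cdot\}_2$ subject to the relations saying that every linear combination of them satisfies the Jacobi identity; equivalently, each bracket satisfies the Jacobi identity and $$\{a,\{b,c\}_1\}_2+\{b,\{c,a\}_1\}_2+\{c,\{a,b\}_1\}_2+\{a,\{b,c\}_2\}_1+\{b,\{c,a\}_2\}_1+\{c,\{a,b\}_2\}_1=0.$$ The bihamiltonian operad $\mathcal{P}_2$ is generated by two skew-symmetric operations $\{\cdot,\cdot\}_1,\{\cdot,\cdot\}_2$ satisfying the relations of $\mathcal{L}ie_2$ and a symmetric operation $\star$ which is associative, such that each bracket is a derivation of $\star$: $\{a,b\star c\}_i=\{a,b\}_i\star c+b\star\{a,c\}_i$,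 $i=1,2$. The component $\mathcal{Q}(n)$ of such an operad is the multilinear part (span of monomials containing each generator exactly once) of the free algebra over the operad on $n$ generators. The group $SL_2$ acts on $\mathcal{Q}(n)$ through its action on generating operations: the span of the two brackets is the standard two-dimensional representation, and $\star$ is invariant. The $SL_2$-character of a module $M$ is $\sum_j\dim(M_j)\,q^j$, where $M_j$ is the subspace of weight $j$. Notation: $f_{\mathcal{Q}}(x)=\sum_{n\ge1}\frac{\dim\mathcal{Q}(n)}{n!}x^n$, and $f_{\mathcal{Q}}(x,q)=\sum_{n\ge1}\frac{\chi_n(q)}{n!}x^n$, where $\chi_n(q)$ is the $SL_2$-character of $\mathcal{Q}(n)$. Empty products are $1$. *)

theory Defs
  imports "HOL-Analysis.Analysis" "HOL-Computational_Algebra.Computational_Algebra"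
begin

section \<open>Free algebras presented by bilinear operations and identities\<close>

text \<open>
  Free algebras are built as in universal algebra: expressions in the linear structure, the
  generators and the bilinear operations (with symbols in \<^typ>\<open>'o\<close>), modulo the least congruence
  containing the vector space axioms, bilinearity and the prescribed identities.
\<close>

datatype ('o, 'k) expr =
    Zero
  | Gen nat
  | Add "('o, 'k) expr" "('o, 'k) expr"
  | Scale 'k "('o, 'k) expr"
  | Op 'o "('o, 'k) expr" "('o, 'k) expr"

inductive alg_cong ::
    "(('o, 'k::field) expr \<Rightarrow> ('o, 'k) expr \<Rightarrow> bool) \<Rightarrow> ('o, 'k) expr \<Rightarrow> ('o, 'k) expr \<Rightarrow> bool"
  for law where
  refl: "alg_cong law a a"
| sym: "alg_cong law a b \<Longrightarrow> alg_cong law b a"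
| trans: "alg_cong law a b \<Longrightarrow> alg_cong law b c \<Longrightarrow> alg_cong law a c"
| cong_Add: "alg_cong law a a' \<Longrightarrow> alg_cong law b b' \<Longrightarrow> alg_cong law (Add a b) (Add a' b')"
| cong_Scale: "alg_cong law a a' \<Longrightarrow> alg_cong law (Scale c a) (Scale c a')"
| cong_Op: "alg_cong law a a' \<Longrightarrow> alg_cong law b b' \<Longrightarrow> alg_cong law (Op f a b) (Op f a' b')"
| add_assoc: "alg_cong law (Add (Add a b) c) (Add a (Add b c))"
| add_commute: "alg_cong law (Add a b) (Add b a)"
| add_0: "alg_cong law (Add Zero a) a"
| add_inverse: "alg_cong law (Add (Scale (-1) a) a) Zero"
| scale_add: "alg_cong law (Scale c (Add a b)) (Add (Scale c a) (Scale c b))"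
| add_scale: "alg_cong law (Scale (c + d) a) (Add (Scale c a) (Scale d a))"
| scale_scale: "alg_cong law (Scale c (Scale d a)) (Scale (c * d) a)"
| scale_1: "alg_cong law (Scale 1 a) a"
| Op_add_left: "alg_cong law (Op f (Add a b) c) (Add (Op f a c) (Op f b c))"
| Op_add_right: "alg_cong law (Op f a (Add b c)) (Add (Op f a b) (Op f a c))"
| Op_scale_left: "alg_cong law (Op f (Scale c a) b) (Scale c (Op f a b))"
| Op_scale_right: "alg_cong law (Op f a (Scale c b)) (Scale c (Op f a b))"
| law: "law a b \<Longrightarrow> alg_cong law a b"

lemma equivp_alg_cong: "equivp (alg_cong law)"
  by (intro equivpI reflpI sympI transpI) (auto intro: alg_cong.intros)

primrec eval ::
    "(nat \<Rightarrow> 'v::ab_group_add) \<Rightarrow> ('k \<Rightarrow> 'v \<Rightarrow> 'v) \<Rightarrow> ('o \<Rightarrow> 'v \<Rightarrow> 'v \<Rightarrow> 'v) \<Rightarrow> ('o, 'k) expr \<Rightarrow> 'v"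
  where
  "eval gen scl oper Zero = 0"
| "eval gen scl oper (Gen i) = gen i"
| "eval gen scl oper (Add a b) = eval gen scl oper a + eval gen scl oper b"
| "eval gen scl oper (Scale c a) = scl c (eval gen scl oper a)"
| "eval gen scl oper (Op f a b) = oper f (eval gen scl oper a) (eval gen scl oper b)"

definition bilinear_op :: "('k \<Rightarrow> 'v \<Rightarrow> 'v) \<Rightarrow> ('v \<Rightarrow> 'v \<Rightarrow> 'v::ab_group_add) \<Rightarrow> bool" where
  "bilinear_op scl m \<longleftrightarrow>
     (\<forall>u v w. m (u + v) w = m u w + m v w) \<and> (\<forall>u v w. m u (v + w) = m u v + m u w) \<and>
     (\<forall>c u v. m (scl c u) v = scl c (m u v)) \<and> (\<forall>c u v. m u (scl c v) = scl c (m u v))"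

lemma eval_cong:
  assumes "alg_cong law a b" "vector_space scl" "\<And>f. bilinear_op scl (oper f)"
    and "\<And>a b. law a b \<Longrightarrow> eval gen scl oper a = eval gen scl oper b"
  shows "eval gen scl oper a = eval gen scl oper b"
proof -
  interpret vector_space scl by fact
  note bil = assms(3)[unfolded bilinear_op_def]
  show ?thesis
    using assms(1)
    by induction (auto simp: bil assms(4) scale_right_distrib scale_left_distrib algebra_simps)
qed


section \<open>Two compatible Lie brackets\<close>

text \<open>The two brackets are indexed by the two-element type, whose elements are \<open>1\<close> and \<open>2\<close>.\<close>

definition pencil ::
    "(2 \<Rightarrow> ('o, 'k) expr \<Rightarrow> ('o, 'k) expr \<Rightarrow> ('o, 'k) expr) \<Rightarrow> 'k \<Rightarrow> 'k \<Rightarrow>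
     ('o, 'k) expr \<Rightarrow> ('o, 'k) expr \<Rightarrow> ('o, 'k) expr" where
  "pencil br c d x y = Add (Scale c (br 1 x y)) (Scale d (br 2 x y))"

inductive compatible_lie_law ::
    "(2 \<Rightarrow> ('o, 'k::field) expr \<Rightarrow> ('o, 'k) expr \<Rightarrow> ('o, 'k) expr) \<Rightarrow>
     ('o, 'k) expr \<Rightarrow> ('o, 'k) expr \<Rightarrow> bool"
  for br where
  skew: "compatible_lie_law br (br i x y) (Scale (-1) (br i y x))"
| jacobi: "compatible_lie_law br
    (Add (pencil br c d x (pencil br c d y z))
      (Add (pencil br c d y (pencil br c d z x)) (pencil br c d z (pencil br c d x y)))) Zero"

abbreviation lie2_law :: "(2, 'k::field) expr \<Rightarrow> (2, 'k) expr \<Rightarrow> bool" where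
  "lie2_law \<equiv> compatible_lie_law Op"

datatype p2_op = Bracket 2 | Star

inductive p2_law :: "(p2_op, 'k::field) expr \<Rightarrow> (p2_op, 'k) expr \<Rightarrow> bool" where
  lie2: "compatible_lie_law (\<lambda>i. Op (Bracket i)) x y \<Longrightarrow> p2_law x y"
| star_commute: "p2_law (Op Star x y) (Op Star y x)"
| star_assoc: "p2_law (Op Star (Op Star x y) z) (Op Star x (Op Star y z))"
| leibniz: "p2_law (Op (Bracket i) x (Op Star y z))
    (Add (Op Star (Op (Bracket i) x y) z) (Op Star y (Op (Bracket i) x z)))"


section \<open>The free algebras\<close>

text \<open>
  The free algebras over the two operads on generators \<open>x\<^sub>0, x\<^sub>1, x\<^sub>2, \<dots>\<close>. The free algebra on
  the \<open>n\<close> generators \<open>x\<^sub>1, \<dots>, x\<^sub>n\<close> is the subalgebra they generate, so its multilinear part can be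
  formed here.
\<close>

quotient_type (overloaded) 'k lie2 = "(2, 'k::field_char_0) expr" / "alg_cong lie2_law"
  by (rule equivp_alg_cong)

quotient_type (overloaded) 'k p2 = "(p2_op, 'k::field_char_0) expr" / "alg_cong p2_law"
  by (rule equivp_alg_cong)

instantiation lie2 :: (field_char_0) ab_group_add
begin

lift_definition zero_lie2 :: "'a lie2" is Zero .
lift_definition plus_lie2 :: "'a lie2 \<Rightarrow> 'a lie2 \<Rightarrow> 'a lie2" is Add
  by (rule alg_cong.cong_Add)
lift_definition uminus_lie2 :: "'a lie2 \<Rightarrow> 'a lie2" is "Scale (-1)"
  by (rule alg_cong.cong_Scale)
lift_definition minus_lie2 :: "'a lie2 \<Rightarrow> 'a lie2 \<Rightarrow> 'a lie2" is "\<lambda>a b. Add a (Scale (-1) b)"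
  by (intro alg_cong.cong_Add alg_cong.cong_Scale)

instance
  by standard (transfer; blast intro: alg_cong.intros)+

end

instantiation p2 :: (field_char_0) ab_group_add
begin

lift_definition zero_p2 :: "'a p2" is Zero .
lift_definition plus_p2 :: "'a p2 \<Rightarrow> 'a p2 \<Rightarrow> 'a p2" is Add
  by (rule alg_cong.cong_Add)
lift_definition uminus_p2 :: "'a p2 \<Rightarrow> 'a p2" is "Scale (-1)"
  by (rule alg_cong.cong_Scale)
lift_definition minus_p2 :: "'a p2 \<Rightarrow> 'a p2 \<Rightarrow> 'a p2" is "\<lambda>a b. Add a (Scale (-1) b)"
  by (intro alg_cong.cong_Add alg_cong.cong_Scale)

instance
  by standard (transfer; blast intro: alg_cong.intros)+

end

lift_definition lie2_gen :: "nat \<Rightarrow> 'k::field_char_0 lie2" is Gen .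
lift_definition lie2_scale :: "'k::field_char_0 \<Rightarrow> 'k lie2 \<Rightarrow> 'k lie2" is Scale
  by (rule alg_cong.cong_Scale)
lift_definition lie2_bracket :: "2 \<Rightarrow> 'k::field_char_0 lie2 \<Rightarrow> 'k lie2 \<Rightarrow> 'k lie2" is Op
  by (rule alg_cong.cong_Op)

lift_definition p2_gen :: "nat \<Rightarrow> 'k::field_char_0 p2" is Gen .
lift_definition p2_scale :: "'k::field_char_0 \<Rightarrow> 'k p2 \<Rightarrow> 'k p2" is Scale
  by (rule alg_cong.cong_Scale)
lift_definition p2_oper :: "p2_op \<Rightarrow> 'k::field_char_0 p2 \<Rightarrow> 'k p2 \<Rightarrow> 'k p2" is Op
  by (rule alg_cong.cong_Op)

abbreviation p2_bracket :: "2 \<Rightarrow> 'k::field_char_0 p2 \<Rightarrow> 'k p2 \<Rightarrow> 'k p2" where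
  "p2_bracket i \<equiv> p2_oper (Bracket i)"

abbreviation p2_star :: "'k::field_char_0 p2 \<Rightarrow> 'k p2 \<Rightarrow> 'k p2" where
  "p2_star \<equiv> p2_oper Star"

global_interpretation lie2: vector_space "lie2_scale :: 'k::field_char_0 \<Rightarrow> 'k lie2 \<Rightarrow> 'k lie2"
  defines lie2_span = lie2.span and lie2_dim = lie2.dim
  by standard (transfer; blast intro: alg_cong.intros)+

global_interpretation p2: vector_space "p2_scale :: 'k::field_char_0 \<Rightarrow> 'k p2 \<Rightarrow> 'k p2"
  defines p2_span = p2.span and p2_dim = p2.dim
  by standard (transfer; blast intro: alg_cong.intros)+

lemma bilinear_lie2_bracket: "bilinear_op lie2_scale (lie2_bracket i)"
  unfolding bilinear_op_def by (intro conjI allI; transfer; blast intro: alg_cong.intros)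

lemma bilinear_p2_oper: "bilinear_op p2_scale (p2_oper f)"
  unfolding bilinear_op_def by (intro conjI allI; transfer; blast intro: alg_cong.intros)

lemma lie2_skew: "lie2_bracket i u v = - lie2_bracket i v u"
  by transfer (rule alg_cong.law, rule compatible_lie_law.skew)

lemma lie2_jacobi:
  fixes c d :: "'k::field_char_0"
  defines "b \<equiv> \<lambda>u v. lie2_scale c (lie2_bracket 1 u v) + lie2_scale d (lie2_bracket 2 u v)"
  shows "b u (b v w) + (b v (b w u) + b w (b u v)) = 0"
  unfolding b_def
  by transfer (rule alg_cong.law, rule compatible_lie_law.jacobi[unfolded pencil_def])

lemma p2_skew: "p2_bracket i u v = - p2_bracket i v u"
  by transfer (rule alg_cong.law, rule p2_law.lie2, rule compatible_lie_law.skew)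

lemma p2_jacobi:
  fixes c d :: "'k::field_char_0"
  defines "b \<equiv> \<lambda>u v. p2_scale c (p2_bracket 1 u v) + p2_scale d (p2_bracket 2 u v)"
  shows "b u (b v w) + (b v (b w u) + b w (b u v)) = 0"
  unfolding b_def
  by transfer
    (rule alg_cong.law, rule p2_law.lie2, rule compatible_lie_law.jacobi[unfolded pencil_def])

lemma p2_star_commute: "p2_star u v = p2_star v u"
  by transfer (rule alg_cong.law, rule p2_law.star_commute)

lemma p2_star_assoc: "p2_star (p2_star u v) w = p2_star u (p2_star v w)"
  by transfer (rule alg_cong.law, rule p2_law.star_assoc)

lemma p2_leibniz:
  "p2_bracket i u (p2_star v w) = p2_star (p2_bracket i u v) w + p2_star v (p2_bracket i u w)"
  by transfer (rule alg_cong.law, rule p2_law.leibniz)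


section \<open>The action of \<open>SL\<^sub>2\<close>\<close>

text \<open>
  A matrix \<open>g\<close> sends the \<open>i\<close>-th bracket to \<open>g\<^sub>1\<^sub>i {\<cdot>,\<cdot>}\<^sub>1 + g\<^sub>2\<^sub>i {\<cdot>,\<cdot>}\<^sub>2\<close>, fixes \<open>\<star>\<close>, and is
  extended to the free algebra fixing the generators. This makes sense for all matrices; \<open>SL\<^sub>2\<close> acts by
  restriction.
\<close>

definition lie2_rotated :: "'k::field_char_0^2^2 \<Rightarrow> 2 \<Rightarrow> 'k lie2 \<Rightarrow> 'k lie2 \<Rightarrow> 'k lie2" where
  "lie2_rotated g i u v =
     lie2_scale (g $ 1 $ i) (lie2_bracket 1 u v) + lie2_scale (g $ 2 $ i) (lie2_bracket 2 u v)"

primrec p2_rotated :: "'k::field_char_0^2^2 \<Rightarrow> p2_op \<Rightarrow> 'k p2 \<Rightarrow> 'k p2 \<Rightarrow> 'k p2" where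
  "p2_rotated g (Bracket i) = (\<lambda>u v.
     p2_scale (g $ 1 $ i) (p2_bracket 1 u v) + p2_scale (g $ 2 $ i) (p2_bracket 2 u v))"
| "p2_rotated g Star = p2_star"

lemma bilinear_op_combination:
  assumes "vector_space scl" "bilinear_op scl m" "bilinear_op scl m'"
  shows "bilinear_op scl (\<lambda>u v. scl c (m u v) + scl d (m' u v))"
proof -
  interpret vector_space scl by fact
  show ?thesis
    using assms(2,3) unfolding bilinear_op_def
    by (auto simp: scale_right_distrib scale_left_commute algebra_simps)
qed

lemma bilinear_lie2_rotated: "bilinear_op lie2_scale (lie2_rotated g i)"
  unfolding lie2_rotated_def
  by (intro bilinear_op_combination bilinear_lie2_bracket lie2.vector_space_axioms)

lemma bilinear_p2_rotated: "bilinear_op p2_scale (p2_rotated g f)"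
  by (cases f) (auto intro!: bilinear_op_combination bilinear_p2_oper p2.vector_space_axioms)

lemma eval_compatible_lie_law:
  assumes "compatible_lie_law br a b" "vector_space scl"
    and br: "\<And>i x y. eval gen scl oper (br i x y) = m i (eval gen scl oper x) (eval gen scl oper y)"
    and skew: "\<And>i u v. m i u v = - m i v u"
    and jacobi: "\<And>c d u v w. let b = (\<lambda>u v. scl c (m 1 u v) + scl d (m 2 u v)) in
                   b u (b v w) + (b v (b w u) + b w (b u v)) = 0"
  shows "eval gen scl oper a = eval gen scl oper b"
proof -
  interpret vector_space scl by fact
  show ?thesis
    using assms(1)
  proof cases
    case (skew i x y)
    show ?thesis unfolding skew by (simp add: br assms(4)[of i "eval gen scl oper x"])
  next
    case (jacobi c d x y z)
    show ?thesis unfolding jacobi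
      using assms(5)[of c d "eval gen scl oper x" "eval gen scl oper y" "eval gen scl oper z"]
      by (simp add: br pencil_def Let_def)
  qed
qed

lemma lie2_rotated_pencil:
  "lie2_scale c (lie2_rotated g 1 u v) + lie2_scale d (lie2_rotated g 2 u v) =
   lie2_scale (c * g $ 1 $ 1 + d * g $ 1 $ 2) (lie2_bracket 1 u v) +
   lie2_scale (c * g $ 2 $ 1 + d * g $ 2 $ 2) (lie2_bracket 2 u v)"
  by (simp add: lie2_rotated_def lie2.scale_left_distrib lie2.scale_right_distrib algebra_simps)

lemma p2_rotated_pencil:
  "p2_scale c (p2_rotated g (Bracket 1) u v) + p2_scale d (p2_rotated g (Bracket 2) u v) =
   p2_scale (c * g $ 1 $ 1 + d * g $ 1 $ 2) (p2_bracket 1 u v) +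
   p2_scale (c * g $ 2 $ 1 + d * g $ 2 $ 2) (p2_bracket 2 u v)"
  by (simp add: p2.scale_left_distrib p2.scale_right_distrib algebra_simps)

lift_definition lie2_act :: "'k::field_char_0^2^2 \<Rightarrow> 'k lie2 \<Rightarrow> 'k lie2" is
  "\<lambda>g. eval lie2_gen lie2_scale (lie2_rotated g)"
proof -
  fix g :: "'k^2^2" and a b :: "(2, 'k) expr"
  have skew: "lie2_rotated g i u v = - lie2_rotated g i v u" for i u v
    unfolding lie2_rotated_def by (subst (1 2) lie2_skew) (simp add: lie2.scale_minus_right)
  assume "alg_cong lie2_law a b"
  then show "eval lie2_gen lie2_scale (lie2_rotated g) a = eval lie2_gen lie2_scale (lie2_rotated g) b"
  proof (rule eval_cong)
    fix a b :: "(2, 'k) expr"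
    assume "lie2_law a b"
    then show "eval lie2_gen lie2_scale (lie2_rotated g) a = eval lie2_gen lie2_scale (lie2_rotated g) b"
      by (rule eval_compatible_lie_law[where m = "lie2_rotated g"])
        (simp_all add: skew[symmetric] lie2_rotated_pencil lie2_jacobi lie2.vector_space_axioms)
  qed (rule lie2.vector_space_axioms bilinear_lie2_rotated)+
qed

lift_definition p2_act :: "'k::field_char_0^2^2 \<Rightarrow> 'k p2 \<Rightarrow> 'k p2" is
  "\<lambda>g. eval p2_gen p2_scale (p2_rotated g)"
proof -
  fix g :: "'k^2^2" and a b :: "(p2_op, 'k) expr"
  have skew: "p2_rotated g (Bracket i) u v = - p2_rotated g (Bracket i) v u" for i u v
    by (simp, subst (1 2) p2_skew) (simp add: p2.scale_minus_right)
  note star_add = bilinear_p2_oper[of Star, unfolded bilinear_op_def]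
  assume "alg_cong p2_law a b"
  then show "eval p2_gen p2_scale (p2_rotated g) a = eval p2_gen p2_scale (p2_rotated g) b"
  proof (rule eval_cong)
    fix a b :: "(p2_op, 'k) expr"
    assume "p2_law a b"
    then show "eval p2_gen p2_scale (p2_rotated g) a = eval p2_gen p2_scale (p2_rotated g) b"
    proof cases
      case lie2
      then show ?thesis
        by (rule eval_compatible_lie_law[where m = "\<lambda>i. p2_rotated g (Bracket i)"])
          (simp_all only: skew[symmetric] p2_rotated_pencil p2_jacobi p2.vector_space_axioms
            eval.simps Let_def)
    next
      case (leibniz i x y z)
      then show ?thesis
        by (simp add: p2_leibniz star_add p2.scale_right_distrib algebra_simps)
    qed (auto simp: p2_star_assoc intro: p2_star_commute)
  qed (rule p2.vector_space_axioms bilinear_p2_rotated)+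
qed

lemma lie2_act_simps:
  "lie2_act g 0 = 0"
  "lie2_act g (lie2_gen i) = lie2_gen i"
  "lie2_act g (u + v) = lie2_act g u + lie2_act g v"
  "lie2_act g (lie2_scale c u) = lie2_scale c (lie2_act g u)"
  "lie2_act g (lie2_bracket j u v) = lie2_rotated g j (lie2_act g u) (lie2_act g v)"
  by (transfer; simp)+

lemma p2_act_simps:
  "p2_act g 0 = 0"
  "p2_act g (p2_gen i) = p2_gen i"
  "p2_act g (u + v) = p2_act g u + p2_act g v"
  "p2_act g (p2_scale c u) = p2_scale c (p2_act g u)"
  "p2_act g (p2_oper f u v) = p2_rotated g f (p2_act g u) (p2_act g v)"
  by (transfer; simp)+

lemma lie2_induct [case_names zero gen add scale bracket]:
  assumes "P 0" "\<And>i. P (lie2_gen i)" "\<And>u v. P u \<Longrightarrow> P v \<Longrightarrow> P (u + v)"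
    "\<And>c u. P u \<Longrightarrow> P (lie2_scale c u)" "\<And>i u v. P u \<Longrightarrow> P v \<Longrightarrow> P (lie2_bracket i u v)"
  shows "P u"
proof (induction u rule: lie2.abs_induct)
  case (1 e)
  show ?case
    by (induction e)
      (use assms in \<open>auto simp: zero_lie2_def lie2_gen_def simp flip: plus_lie2.abs_eq
        lie2_scale.abs_eq lie2_bracket.abs_eq\<close>)
qed

lemma p2_induct [case_names zero gen add scale oper]:
  assumes "P 0" "\<And>i. P (p2_gen i)" "\<And>u v. P u \<Longrightarrow> P v \<Longrightarrow> P (u + v)"
    "\<And>c u. P u \<Longrightarrow> P (p2_scale c u)" "\<And>f u v. P u \<Longrightarrow> P v \<Longrightarrow> P (p2_oper f u v)"
  shows "P u"
proof (induction u rule: p2.abs_induct)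
  case (1 e)
  show ?case
    by (induction e)
      (use assms in \<open>auto simp: zero_p2_def p2_gen_def simp flip: plus_p2.abs_eq
        p2_scale.abs_eq p2_oper.abs_eq\<close>)
qed

lemma lie2_act_one: "lie2_act (mat 1) u = u"
proof (induction u rule: lie2_induct)
  case (bracket i u v)
  then show ?case using exhaust_2[of i] by (auto simp: lie2_act_simps lie2_rotated_def mat_def)
qed (auto simp: lie2_act_simps)

lemma lie2_act_mult: "lie2_act (g ** h) u = lie2_act g (lie2_act h u)"
proof (induction u rule: lie2_induct)
  case (bracket i u v)
  then show ?case
    by (simp add: lie2_act_simps lie2_rotated_def matrix_matrix_mult_def sum_2
      lie2.scale_left_distrib lie2.scale_right_distrib algebra_simps)
qed (auto simp: lie2_act_simps)

lemma p2_act_one: "p2_act (mat 1) u = u"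
proof (induction u rule: p2_induct)
  case (oper f u v)
  then show ?case
  proof (cases f)
    case (Bracket i)
    then show ?thesis using oper exhaust_2[of i] by (auto simp: p2_act_simps mat_def)
  qed (simp add: p2_act_simps)
qed (auto simp: p2_act_simps)

lemma p2_act_mult: "p2_act (g ** h) u = p2_act g (p2_act h u)"
proof (induction u rule: p2_induct)
  case (oper f u v)
  then show ?case
    by (cases f) (simp_all add: p2_act_simps matrix_matrix_mult_def sum_2
      p2.scale_left_distrib p2.scale_right_distrib algebra_simps)
qed (auto simp: p2_act_simps)


section \<open>Components of the operads\<close>

text \<open>A pair \<open>(A, u)\<close> is a monomial \<open>u\<close> containing each \<open>x\<^sub>i\<close> with \<open>i \<in> A\<close> exactly once, and no
  other generator.\<close>

inductive_set lie2_monomial :: "(nat set \<times> 'k::field_char_0 lie2) set" where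
  gen: "({i}, lie2_gen i) \<in> lie2_monomial"
| bracket: "(A, u) \<in> lie2_monomial \<Longrightarrow> (B, v) \<in> lie2_monomial \<Longrightarrow> A \<inter> B = {} \<Longrightarrow>
    (A \<union> B, lie2_bracket i u v) \<in> lie2_monomial"

inductive_set p2_monomial :: "(nat set \<times> 'k::field_char_0 p2) set" where
  gen: "({i}, p2_gen i) \<in> p2_monomial"
| oper: "(A, u) \<in> p2_monomial \<Longrightarrow> (B, v) \<in> p2_monomial \<Longrightarrow> A \<inter> B = {} \<Longrightarrow>
    (A \<union> B, p2_oper f u v) \<in> p2_monomial"

definition lie2_component :: "nat \<Rightarrow> 'k::field_char_0 lie2 set" where
  "lie2_component n = lie2_span {u. ({1..n}, u) \<in> lie2_monomial}"

definition p2_component :: "nat \<Rightarrow> 'k::field_char_0 p2 set" where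
  "p2_component n = p2_span {u. ({1..n}, u) \<in> p2_monomial}"


lemma (in vector_space) bilinear_op_span:
  assumes "bilinear_op scale m" "u \<in> span S" "v \<in> span T" "\<And>s t. s \<in> S \<Longrightarrow> t \<in> T \<Longrightarrow> m s t \<in> span R"
  shows "m u v \<in> span R"
proof -
  note bil = assms(1)[unfolded bilinear_op_def]
  have zero: "m 0 w = 0" "m w 0 = 0" for w
    using bil by (metis scale_zero_left)+
  have "m s v \<in> span R" if "s \<in> S" for s
    using assms(3)
    by (induction rule: span_induct_alt)
      (use that in \<open>auto simp: zero bil intro!: span_zero span_add span_scale assms(4)\<close>)
  with assms(2) show ?thesis
    by (induction u rule: span_induct_alt)
      (auto simp: zero bil intro!: span_zero span_add span_scale)
qed

lemma lie2_act_component: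
  assumes "u \<in> lie2_component n"
  shows "lie2_act g u \<in> lie2_component n"
proof -
  have mono: "lie2_act g u \<in> lie2_span {u. (A, u) \<in> lie2_monomial}"
    if "(A, u) \<in> lie2_monomial" for A u
    using that
  proof induction
    case (gen i)
    then show ?case
      by (auto simp: lie2_act_simps intro: lie2.span_base lie2_monomial.gen)
  next
    case (bracket A u B v i)
    have "lie2_bracket j s t \<in> lie2_span {u. (A \<union> B, u) \<in> lie2_monomial}"
      if "(A, s) \<in> lie2_monomial" "(B, t) \<in> lie2_monomial" for j s t
      using that bracket.hyps by (auto intro: lie2.span_base lie2_monomial.bracket)
    then show ?case
      unfolding lie2_act_simps
      by (intro lie2.bilinear_op_span[OF bilinear_lie2_rotated bracket.IH])
        (auto simp: lie2_rotated_def intro!: lie2.span_add lie2.span_scale)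
  qed
  show ?thesis
    using assms unfolding lie2_component_def
    by (induction rule: lie2.span_induct_alt)
      (auto simp: lie2_act_simps intro!: lie2.span_zero lie2.span_add lie2.span_scale mono)
qed

lemma p2_act_component:
  assumes "u \<in> p2_component n"
  shows "p2_act g u \<in> p2_component n"
proof -
  have mono: "p2_act g u \<in> p2_span {u. (A, u) \<in> p2_monomial}"
    if "(A, u) \<in> p2_monomial" for A u
    using that
  proof induction
    case (gen i)
    then show ?case
      by (auto simp: p2_act_simps intro: p2.span_base p2_monomial.gen)
  next
    case (oper A u B v f)
    have "p2_oper h s t \<in> p2_span {u. (A \<union> B, u) \<in> p2_monomial}"
      if "(A, s) \<in> p2_monomial" "(B, t) \<in> p2_monomial" for h s t
      using that oper.hyps by (auto intro: p2.span_base p2_monomial.oper)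
    then show ?case
      unfolding p2_act_simps
      by (intro p2.bilinear_op_span[OF bilinear_p2_rotated oper.IH], cases f)
        (auto intro!: p2.span_add p2.span_scale)
  qed
  show ?thesis
    using assms unfolding p2_component_def
    by (induction rule: p2.span_induct_alt)
      (auto simp: p2_act_simps intro!: p2.span_zero p2.span_add p2.span_scale mono)
qed


section \<open>Weights, characters and generating functions\<close>

definition torus :: "'k::field \<Rightarrow> 'k^2^2" where
  "torus t = vector [vector [t, 0], vector [0, inverse t]]"

definition lie2_weight_space :: "nat \<Rightarrow> int \<Rightarrow> 'k::field_char_0 lie2 set" where
  "lie2_weight_space n j =
     {u \<in> lie2_component n. \<forall>t. t \<noteq> 0 \<longrightarrow> lie2_act (torus t) u = lie2_scale (t powi j) u}"

definition p2_weight_space :: "nat \<Rightarrow> int \<Rightarrow> 'k::field_char_0 p2 set" where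
  "p2_weight_space n j =
     {u \<in> p2_component n. \<forall>t. t \<noteq> 0 \<longrightarrow> p2_act (torus t) u = p2_scale (t powi j) u}"

text \<open>Laurent polynomials in \<open>q\<close> are represented inside the field of formal Laurent series.\<close>

definition character :: "(int \<Rightarrow> nat) \<Rightarrow> rat fls" where
  "character d = (\<Sum>j | d j \<noteq> 0. of_nat (d j) * fls_X powi j)"

definition lie2_character :: "'k::field_char_0 itself \<Rightarrow> nat \<Rightarrow> rat fls" where
  "lie2_character _ n = character (\<lambda>j. lie2_dim (lie2_weight_space n j :: 'k lie2 set))"

definition p2_character :: "'k::field_char_0 itself \<Rightarrow> nat \<Rightarrow> rat fls" where
  "p2_character _ n = character (\<lambda>j. p2_dim (p2_weight_space n j :: 'k p2 set))"

definition egf :: "(nat \<Rightarrow> 'a::field) \<Rightarrow> 'a fps" where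
  "egf a = Abs_fps (\<lambda>n. if n = 0 then 0 else a n / of_nat (fact n))"

end

theory Submission
  imports Defs "HOL-Library.Function_Algebras"
begin

text \<open>
  Splitting off the largest generator \<open>x\<^sub>m\<close> yields a basis. By the Jacobi identity, the
  compatibility relation and induction, \<open>\<L>ie\<^sub>2\<close> is spanned by the nested second brackets \<open>P = {l\<^sub>1,
  {l\<^sub>2, \<dots> {l\<^sub>r, x\<^sub>m}\<^sub>2 \<dots>}\<^sub>2}\<^sub>2\<close>, and by the elements obtained from a basis element \<open>u\<close> in other
  generators by replacing one \<open>x\<^sub>v\<close> with \<open>{x\<^sub>v, P}\<^sub>1\<close>; here the \<open>l\<^sub>j\<close> are basis elements again,
  ordered by their largest generators. The Leibniz rule shows that \<open>\<P>\<^sub>2\<close> is spanned by products of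
  such elements.

  For linear independence, evaluate on exponentials of linear forms with two constant Poisson
  brackets: a multilinear Lie monomial becomes the product over its brackets \<open>i\<close> of the sums of the
  entries of a skew matrix \<open>M\<^sub>i\<close> between the two sets of generators bracketed. Letting suitable
  entries vanish makes the evaluations of the spanning set triangular.

  Let \<open>F\<close> be the generating function of the trees indexing this basis, with weights \<open>q\<close> and \<open>p\<close> for
  the two brackets, and let \<open>E\<^sub>a = exp (a F)\<close> be that of forests with weight \<open>a\<close> per tree. Then \<open>F'
  = E\<^sub>p (1 + q x F')\<close>, and comparing coefficients in \<open>E\<^sub>a'\<close> gives \<open>(a + p) e\<^sub>n\<^sub>+\<^sub>1(a) = a (a + p + n
  q) e\<^sub>n(a + p)\<close>, which produces the products of the theorem at \<open>a = 1\<close> and in the limit of single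
  trees.
\<close>

section \<open>Trees and their enumeration\<close>

text \<open>The brackets play different roles because the compatibility relation, solved for a first
  bracket with a second bracket on its left, leaves one term that is not nested: a second bracket
  with a first bracket on its left. So second brackets on the root must absorb arbitrary Lie
  elements, by a Poincare-Birkhoff-Witt straightening, whence the ordered forests. Grafting is a
  substitution, so bracketing with an element free of the substituted generator commutes with it and
  takes place in the smaller tree.

  Any two constant Poisson structures are compatible, since a linear combination of skew additive
  pairings is again one; this is why evaluation respects the relations. Independence is proved for
  the values as functions of the matrices: block matrices decouple disjoint sets of generators, and
  induction applies to each block.

  In the enumeration \<open>F\<close> is never solved for. Multiplication by \<open>E_p\<close>
  shifts \<open>a\<close> to \<open>a + p\<close>, and the recurrence between the two no longer
  mentions \<open>F\<close>; its price is a division by \<open>a + p\<close>, hence the nonvanishing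
  hypotheses of the product formulas.\<close>

text \<open>
  \<open>Node m f\<close> stands for the iterated second brackets of the trees in \<open>f\<close> with \<open>x\<^sub>m\<close>, and \<open>Graft u v
  m f\<close> for \<open>u\<close> with \<open>x\<^sub>v\<close> replaced by the first bracket of \<open>x\<^sub>v\<close> and \<open>Node m f\<close>. In valid trees \<open>m\<close>
  is the largest generator, and forests are listed by decreasing maxima, so that each set of trees
  occurs once.
\<close>

datatype tree = Node nat "tree list" | Graft tree nat nat "tree list"

primrec supp :: "tree \<Rightarrow> nat set" where
  "supp (Node m f) = insert m (\<Union>(set (map supp f)))"
| "supp (Graft u v m f) = insert m (supp u \<union> \<Union>(set (map supp f)))"

inductive tree_on :: "nat set \<Rightarrow> tree \<Rightarrow> bool" and forest_on :: "nat set \<Rightarrow> tree list \<Rightarrow> bool" where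
  Nil: "forest_on {} []"
| Cons: "tree_on S t \<Longrightarrow> forest_on D f \<Longrightarrow> S \<inter> D = {} \<Longrightarrow> (\<forall>d\<in>D. d < Max S) \<Longrightarrow> forest_on (S \<union> D) (t # f)"
| Node: "forest_on D f \<Longrightarrow> (\<forall>d\<in>D. d < m) \<Longrightarrow> tree_on (insert m D) (Node m f)"
| Graft: "tree_on S u \<Longrightarrow> v \<in> S \<Longrightarrow> forest_on D f \<Longrightarrow> S \<inter> D = {} \<Longrightarrow> (\<forall>d\<in>S \<union> D. d < m) \<Longrightarrow>
    tree_on (insert m (S \<union> D)) (Graft u v m f)"

abbreviation "trees A \<equiv> {t. tree_on A t}"
abbreviation "forests A \<equiv> {f. forest_on A f}"

lemma on_supp:
  "tree_on A t \<Longrightarrow> finite A \<and> A \<noteq> {} \<and> supp t = A"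
  "forest_on D f \<Longrightarrow> finite D \<and> \<Union>(set (map supp f)) = D"
  by (induction rule: tree_on_forest_on.inducts) auto

lemma forest_on_empty_iff: "forest_on {} f \<longleftrightarrow> f = []"
proof
  assume "forest_on {} f"
  then show "f = []" by cases (use on_supp(1) in fastforce)+
qed (simp add: tree_on_forest_on.Nil)

lemma forest_on_Nil_iff: "forest_on D [] \<longleftrightarrow> D = {}"
  by (auto simp: tree_on_forest_on.Nil elim: forest_on.cases)

lemma not_tree_on_empty [simp]: "\<not> tree_on {} t"
  using on_supp(1) by blast

lemma tree_on_unique: "tree_on A t \<Longrightarrow> tree_on B t \<Longrightarrow> A = B"
  using on_supp(1) by metis

lemma trees_empty [simp]: "trees {} = {}" and forests_empty [simp]: "forests {} = {[]}"
  by (auto simp: forest_on_empty_iff)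

text \<open>The condition on maxima in \<open>Cons\<close> amounts to the head tree carrying
  \<open>Max A\<close>. In this form forests on \<open>A\<close> are indexed by the support
  \<open>S\<close> of the head, as the recurrences require.\<close>

lemma forest_on_Cons_iff:
  "forest_on A (t # f) \<longleftrightarrow> finite A \<and> (\<exists>S\<subseteq>A. tree_on S t \<and> Max A \<in> S \<and> forest_on (A - S) f)"
proof
  assume "forest_on A (t # f)"
  then show "finite A \<and> (\<exists>S\<subseteq>A. tree_on S t \<and> Max A \<in> S \<and> forest_on (A - S) f)"
  proof cases
    case (Cons S D)
    have fin: "finite S" "finite D" "S \<noteq> {}" using on_supp Cons by blast+
    have "Max (S \<union> D) = Max S"
      by (rule Max_eqI) (use fin Cons in \<open>auto intro: less_imp_le\<close>)
    moreover have "S \<union> D - S = D" using Cons by auto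
    ultimately show ?thesis using fin Cons by (intro conjI exI[of _ S]) auto
  qed
next
  assume "finite A \<and> (\<exists>S\<subseteq>A. tree_on S t \<and> Max A \<in> S \<and> forest_on (A - S) f)"
  then obtain S where S: "finite A" "S \<subseteq> A" "tree_on S t" "Max A \<in> S" "forest_on (A - S) f" by auto
  have "Max S = Max A" by (rule Max_eqI) (use S in \<open>auto dest: finite_subset\<close>)
  then have "\<forall>d\<in>A - S. d < Max S"
    using S by (metis DiffE Max_ge le_neq_implies_less)
  from tree_on_forest_on.Cons[OF S(3,5) _ this] show "forest_on A (t # f)"
    using S by (simp add: Un_absorb1)
qed

lemma tree_on_Node_iff:
  "tree_on A (Node m f) \<longleftrightarrow> finite A \<and> A \<noteq> {} \<and> m = Max A \<and> forest_on (A - {m}) f"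
proof
  assume "tree_on A (Node m f)"
  then show "finite A \<and> A \<noteq> {} \<and> m = Max A \<and> forest_on (A - {m}) f"
  proof cases
    case (Node D)
    have fin: "finite D" using on_supp Node by blast
    have "Max (insert m D) = m"
      by (rule Max_eqI) (use fin Node in \<open>auto intro: less_imp_le\<close>)
    moreover have "insert m D - {m} = D" using Node by auto
    ultimately show ?thesis using fin Node by auto
  qed
next
  assume A: "finite A \<and> A \<noteq> {} \<and> m = Max A \<and> forest_on (A - {m}) f"
  then have "\<forall>d\<in>A - {m}. d < m" by (metis DiffE Max_ge insertCI le_neq_implies_less)
  with A show "tree_on A (Node m f)"
    using tree_on_forest_on.Node[of "A - {m}" f m] Max_in[of A] insert_Diff[of m A] by auto
qed

lemma tree_on_Graft_iff:
  "tree_on A (Graft u v m f) \<longleftrightarrow> finite A \<and> A \<noteq> {} \<and> m = Max A \<and>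
     (\<exists>S\<subseteq>A - {m}. tree_on S u \<and> v \<in> S \<and> forest_on (A - {m} - S) f)"
proof
  assume "tree_on A (Graft u v m f)"
  then show "finite A \<and> A \<noteq> {} \<and> m = Max A \<and>
     (\<exists>S\<subseteq>A - {m}. tree_on S u \<and> v \<in> S \<and> forest_on (A - {m} - S) f)"
  proof cases
    case (Graft S D)
    have fin: "finite D" "finite S" using on_supp Graft by blast+
    have "Max (insert m (S \<union> D)) = m"
      by (rule Max_eqI) (use fin Graft in \<open>auto intro: less_imp_le\<close>)
    moreover have "insert m (S \<union> D) - {m} - S = D" using Graft by auto
    ultimately show ?thesis using fin Graft by (intro conjI exI[of _ S]) auto
  qed
next
  assume A: "finite A \<and> A \<noteq> {} \<and> m = Max A \<and>
     (\<exists>S\<subseteq>A - {m}. tree_on S u \<and> v \<in> S \<and> forest_on (A - {m} - S) f)"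
  then obtain S where S: "S \<subseteq> A - {m}" "tree_on S u" "v \<in> S" "forest_on (A - {m} - S) f" by auto
  have *: "\<forall>d\<in>A - {m}. d < m" using A by (metis DiffE Max_ge insertCI le_neq_implies_less)
  have "insert m (S \<union> (A - {m} - S)) = A" using A S Max_in[of A] by blast
  moreover have "tree_on (insert m (S \<union> (A - {m} - S))) (Graft u v m f)"
    using S * by (intro tree_on_forest_on.Graft) auto
  ultimately show "tree_on A (Graft u v m f)" by simp
qed

lemma forests_eq:
  assumes "finite A" "A \<noteq> {}"
  shows "forests A = (\<Union>S\<in>{S. S \<subseteq> A \<and> Max A \<in> S}. (\<lambda>(t, f). t # f) ` (trees S \<times> forests (A - S)))"
proof (intro set_eqI)
  fix g show "g \<in> forests A \<longleftrightarrow>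
    g \<in> (\<Union>S\<in>{S. S \<subseteq> A \<and> Max A \<in> S}. (\<lambda>(t, f). t # f) ` (trees S \<times> forests (A - S)))"
    using assms by (cases g) (auto simp: forest_on_Cons_iff forest_on_Nil_iff)
qed

lemma trees_eq:
  assumes "finite A" "A \<noteq> {}"
  defines "m \<equiv> Max A"
  shows "trees A = Node m ` forests (A - {m}) \<union>
    (\<Union>S\<in>Pow (A - {m}). (\<lambda>(u, v, f). Graft u v m f) ` (trees S \<times> S \<times> forests (A - {m} - S)))"
proof (intro set_eqI)
  fix t show "t \<in> trees A \<longleftrightarrow> t \<in> Node m ` forests (A - {m}) \<union>
    (\<Union>S\<in>Pow (A - {m}). (\<lambda>(u, v, f). Graft u v m f) ` (trees S \<times> S \<times> forests (A - {m} - S)))"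
  proof (cases t)
    case (Graft u v k f)
    then show ?thesis using assms by (simp add: tree_on_Graft_iff image_iff) blast
  qed (use assms in \<open>auto simp: tree_on_Node_iff\<close>)
qed

lemma finite_trees_forests: "finite A \<Longrightarrow> finite (trees A) \<and> finite (forests A)"
proof (induction "card A" arbitrary: A rule: less_induct)
  case less
  show ?case
  proof (cases "A = {}")
    case True
    then show ?thesis by simp
  next
    case False
    define m where "m = Max A"
    have m: "m \<in> A" using less.prems False by (simp add: m_def)
    have sub: "finite (trees S) \<and> finite (forests S)" if "S \<subset> A" for S
      using less.hyps[OF psubset_card_mono[OF less.prems that]] less.prems that
      by (meson finite_subset psubset_imp_subset)
    \<comment> \<open>Trees come first: the head of a forest may occupy all of
      \<open>A\<close>.\<close>
    have t: "finite (trees A)"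
      unfolding trees_eq[OF less.prems False] m_def[symmetric]
    proof (intro finite_UnI finite_imageI finite_UN_I finite_cartesian_product)
      show "finite (forests (A - {m}))" using sub[of "A - {m}"] m by auto
      fix S assume "S \<in> Pow (A - {m})"
      then have "S \<subset> A" "A - {m} - S \<subset> A" using m by auto
      then show "finite (trees S)" "finite (forests (A - {m} - S))" "finite S"
        using sub less.prems by (auto dest: finite_subset)
    qed (use less.prems in auto)
    have f: "finite (forests A)"
      unfolding forests_eq[OF less.prems False] m_def[symmetric]
    proof (intro finite_imageI finite_UN_I finite_cartesian_product)
      fix S assume S: "S \<in> {S. S \<subseteq> A \<and> m \<in> S}"
      then have "A - S \<subset> A" using m by auto
      then show "finite (forests (A - S))" using sub by auto
      show "finite (trees S)" using t sub[of S] S by (cases "S = A") auto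
    qed (use less.prems in auto)
    show ?thesis using t f by simp
  qed
qed

text \<open>\<open>p\<close> counts second brackets and \<open>q\<close> first ones.\<close>

primrec tree_weight :: "'a::comm_ring_1 \<Rightarrow> 'a \<Rightarrow> tree \<Rightarrow> 'a" where
  "tree_weight p q (Node m f) = prod_list (map (\<lambda>x. p * x) (map (tree_weight p q) f))"
| "tree_weight p q (Graft u v m f) =
     q * tree_weight p q u * prod_list (map (\<lambda>x. p * x) (map (tree_weight p q) f))"

text \<open>The parameter \<open>a\<close> marks the trees: \<open>a = p\<close> for trees attached
  to a root by second brackets, \<open>a = 1\<close> for the factors of a product, general
  \<open>a\<close> for the functional equation.\<close>

definition forest_weight :: "'a::comm_ring_1 \<Rightarrow> 'a \<Rightarrow> 'a \<Rightarrow> tree list \<Rightarrow> 'a" where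
  "forest_weight p q a f = prod_list (map (\<lambda>x. a * x) (map (tree_weight p q) f))"

lemma forest_weight_simps [simp]:
  "forest_weight p q a [] = 1"
  "forest_weight p q a (t # f) = a * tree_weight p q t * forest_weight p q a f"
  by (simp_all add: forest_weight_def mult_ac)

lemma tree_weight_simps:
  "tree_weight p q (Node m f) = forest_weight p q p f"
  "tree_weight p q (Graft u v m f) = q * tree_weight p q u * forest_weight p q p f"
  by (simp_all add: forest_weight_def)

definition "tree_sum p q A = (\<Sum>t\<in>trees A. tree_weight p q t)"
definition "forest_sum p q a A = (\<Sum>f\<in>forests A. forest_weight p q a f)"

section \<open>Recurrences obtained by removing the largest generator\<close>

lemma sum_forests:
  fixes h :: "tree list \<Rightarrow> 'a::comm_monoid_add"
  assumes "finite A" "A \<noteq> {}"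
  shows "sum h (forests A) = (\<Sum>S | S \<subseteq> A \<and> Max A \<in> S. \<Sum>(t, f)\<in>trees S \<times> forests (A - S). h (t # f))"
proof -
  let ?I = "{S. S \<subseteq> A \<and> Max A \<in> S}"
  have fin: "finite (trees S)" "finite (forests S)" if "S \<subseteq> A" for S
    using finite_trees_forests assms(1) that finite_subset by blast+
  have "sum h (forests A) = (\<Sum>S\<in>?I. \<Sum>f\<in>(\<lambda>(t, f). t # f) ` (trees S \<times> forests (A - S)). h f)"
    unfolding forests_eq[OF assms]
  proof (rule sum.UNION_disjoint)
    show "\<forall>S\<in>?I. \<forall>T\<in>?I. S \<noteq> T \<longrightarrow> (\<lambda>(t, f). t # f) ` (trees S \<times> forests (A - S)) \<inter>
        (\<lambda>(t, f). t # f) ` (trees T \<times> forests (A - T)) = {}"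
      by (auto dest: tree_on_unique)
  qed (use assms fin in auto)
  also have "\<dots> = (\<Sum>S\<in>?I. \<Sum>(t, f)\<in>trees S \<times> forests (A - S). h (t # f))"
    by (intro sum.cong HOL.refl, subst sum.reindex) (auto simp: inj_on_def intro!: sum.cong)
  finally show ?thesis .
qed

lemma sum_trees:
  fixes h :: "tree \<Rightarrow> 'a::comm_monoid_add"
  assumes "finite A" "A \<noteq> {}"
  defines "m \<equiv> Max A"
  shows "sum h (trees A) = (\<Sum>f\<in>forests (A - {m}). h (Node m f)) +
    (\<Sum>S\<in>Pow (A - {m}). \<Sum>(u, v, f)\<in>trees S \<times> S \<times> forests (A - {m} - S). h (Graft u v m f))"
proof -
  define D where "D = A - {m}"
  let ?G = "\<lambda>S. (\<lambda>(u, v, f). Graft u v m f) ` (trees S \<times> S \<times> forests (D - S))"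
  have fin: "finite (trees S)" "finite (forests S)" "finite S" if "S \<subseteq> A" for S
    using finite_trees_forests assms(1) that finite_subset by blast+
  have "sum h (trees A) = (\<Sum>t\<in>Node m ` forests D. h t) + (\<Sum>t\<in>(\<Union>S\<in>Pow D. ?G S). h t)"
    unfolding trees_eq[OF assms(1,2)] m_def[symmetric] D_def[symmetric]
  proof (rule sum.union_disjoint)
    show "finite (\<Union>S\<in>Pow D. ?G S)"
      by (intro finite_UN_I finite_imageI finite_cartesian_product) (auto intro!: fin simp: D_def
          assms)
  qed (auto intro!: fin simp: D_def)
  also have "(\<Sum>t\<in>Node m ` forests D. h t) = (\<Sum>f\<in>forests D. h (Node m f))"
    by (subst sum.reindex) (auto simp: inj_on_def)
  also have "(\<Sum>t\<in>(\<Union>S\<in>Pow D. ?G S). h t) = (\<Sum>S\<in>Pow D. \<Sum>t\<in>?G S. h t)"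
  proof (rule sum.UNION_disjoint)
    show "\<forall>S\<in>Pow D. finite (?G S)"
      by (intro ballI finite_imageI finite_cartesian_product) (auto intro!: fin simp: D_def)
    show "\<forall>S\<in>Pow D. \<forall>T\<in>Pow D. S \<noteq> T \<longrightarrow> ?G S \<inter> ?G T = {}"
      by (auto dest: tree_on_unique)
  qed (simp add: D_def assms)
  also have "\<dots> = (\<Sum>S\<in>Pow D. \<Sum>(u, v, f)\<in>trees S \<times> S \<times> forests (D - S). h (Graft u v m f))"
    by (intro sum.cong HOL.refl, subst sum.reindex) (auto simp: inj_on_def intro!: sum.cong)
  finally show ?thesis unfolding D_def .
qed

text \<open>Coefficient form of \<open>E_a' = a F' E_a\<close>: distinguishing the largest generator
  is differentiation, and the head tree contains it.\<close>

lemma forest_sum_rec: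
  assumes "finite A" "A \<noteq> {}"
  shows "forest_sum p q a A =
    (\<Sum>S\<in>Pow (A - {Max A}). a * tree_sum p q (insert (Max A) S) * forest_sum p q a (A - {Max A} -
        S))"
proof -
  let ?I = "{S. S \<subseteq> A \<and> Max A \<in> S}"
  have "forest_sum p q a A = (\<Sum>S\<in>?I. a * tree_sum p q S * forest_sum p q a (A - S))"
    unfolding tree_sum_def forest_sum_def sum_forests[OF assms]
    by (intro sum.cong HOL.refl) (simp add: sum_distrib_left sum_distrib_right
        sum.cartesian_product mult_ac)
  also have "\<dots> = (\<Sum>S\<in>Pow (A - {Max A}). a * tree_sum p q (insert (Max A) S) * forest_sum p q a (A
      - {Max A} - S))"
  proof (rule sum.reindex_bij_witness[of _ "\<lambda>S. insert (Max A) S" "\<lambda>S. S - {Max A}"])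
    fix S assume "S \<in> ?I"
    then have "insert (Max A) (S - {Max A}) = S" "A - {Max A} - (S - {Max A}) = A - S" by auto
    then show "a * tree_sum p q (insert (Max A) (S - {Max A})) * forest_sum p q a (A - {Max A} -
        (S - {Max A}))
      = a * tree_sum p q S * forest_sum p q a (A - S)" by simp
  qed (use assms in auto)
  finally show ?thesis .
qed

text \<open>Coefficient form of \<open>F' = E_p (1 + q x F')\<close>. The factor
  \<open>card S\<close> counts the grafting points \<open>v\<close> of the inner tree.\<close>

lemma tree_sum_rec:
  assumes "finite A" "A \<noteq> {}"
  shows "tree_sum p q A = forest_sum p q p (A - {Max A}) +
    (\<Sum>S\<in>Pow (A - {Max A}). of_nat (card S) * q * tree_sum p q S * forest_sum p q p (A - {Max A} -
        S))"
  unfolding tree_sum_def forest_sum_def sum_trees[OF assms] tree_weight_simps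
  by (intro arg_cong2[of _ _ _ _ "(+)"] sum.cong HOL.refl)
    (simp add: sum.cartesian_product[symmetric] sum_distrib_left sum_distrib_right mult_ac)

lemma sum_Pow_card:
  fixes h :: "nat \<Rightarrow> 'a::comm_semiring_1"
  assumes "finite D"
  shows "(\<Sum>S\<in>Pow D. h (card S)) = (\<Sum>k\<le>card D. of_nat (card D choose k) * h k)"
proof -
  have "(\<Sum>S\<in>Pow D. h (card S)) = (\<Sum>k\<le>card D. \<Sum>S\<in>{S \<in> Pow D. card S = k}. h (card S))"
    using assms by (intro sum.group[symmetric]) (auto intro: card_mono)
  also have "\<dots> = (\<Sum>k\<le>card D. of_nat (card D choose k) * h k)"
  proof (intro sum.cong HOL.refl)
    fix k
    have "(\<Sum>S\<in>{S \<in> Pow D. card S = k}. h (card S)) = of_nat (card {S. S \<subseteq> D \<and> card S = k}) * h k"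
      by simp
    then show "(\<Sum>S\<in>{S \<in> Pow D. card S = k}. h (card S)) = of_nat (card D choose k) * h k"
      unfolding n_subsets[OF assms] .
  qed
  finally show ?thesis .
qed

definition "tree_num p q n = tree_sum p q {..<n}"
definition "forest_num p q a n = forest_sum p q a {..<n}"

text \<open>With smaller sets known to matter only through their size, the recurrences have
  right-hand sides depending on \<open>n\<close> alone. The forest half also assumes the claim for
  trees of size \<open>Suc n\<close>, because the head may occupy all of \<open>A\<close>.\<close>

lemma sums_card_step:
  fixes p q :: "'a::comm_ring_1"
  assumes IH: "\<And>S. finite S \<Longrightarrow> card S \<le> n \<Longrightarrow>
      tree_sum p q S = tree_num p q (card S) \<and> (\<forall>a. forest_sum p q a S = forest_num p q a (card S))"
    and A: "finite A" "card A = Suc n"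
  shows "tree_sum p q A = forest_num p q p n +
      (\<Sum>k\<le>n. of_nat (n choose k) * (of_nat k * q * tree_num p q k * forest_num p q p (n - k)))"
    and "(\<And>B. finite B \<Longrightarrow> card B = Suc n \<Longrightarrow> tree_sum p q B = tree_num p q (Suc n)) \<Longrightarrow>
      forest_sum p q a A =
      (\<Sum>k\<le>n. of_nat (n choose k) * (a * tree_num p q (Suc k) * forest_num p q a (n - k)))"
proof -
  have ne: "A \<noteq> {}" using A by auto
  define D where "D = A - {Max A}"
  have D: "finite D" "card D = n" "Max A \<notin> D" using A ne by (auto simp: D_def)
  have sub: "finite S" "card S \<le> n" "finite (D - S)" "card (D - S) = n - card S" "card (D - S) \<le> n"
    if "S \<in> Pow D" for S
    using that D finite_subset[of S D] card_mono[of D S] by (auto simp: card_Diff_subset)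
  show "tree_sum p q A = forest_num p q p n +
      (\<Sum>k\<le>n. of_nat (n choose k) * (of_nat k * q * tree_num p q k * forest_num p q p (n - k)))"
    unfolding tree_sum_rec[OF A(1) ne] D_def[symmetric]
    using sum_Pow_card[OF D(1), of "\<lambda>k. of_nat k * q * tree_num p q k * forest_num p q p (n - k)"]
        sub IH D
    by simp
  assume *: "\<And>B. finite B \<Longrightarrow> card B = Suc n \<Longrightarrow> tree_sum p q B = tree_num p q (Suc n)"
  have "tree_sum p q (insert (Max A) S) = tree_num p q (Suc (card S))" if "S \<in> Pow D" for S
  proof -
    have "card (insert (Max A) S) = Suc (card S)" using sub[OF that] D that by (subst
        card_insert_disjoint) auto
    then show ?thesis using *[of "insert (Max A) S"] IH[of "insert (Max A) S"] sub[OF that]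
      by (cases "card S = n") auto
  qed
  then show "forest_sum p q a A =
      (\<Sum>k\<le>n. of_nat (n choose k) * (a * tree_num p q (Suc k) * forest_num p q a (n - k)))"
    unfolding forest_sum_rec[OF A(1) ne] D_def[symmetric]
    using sum_Pow_card[OF D(1), of "\<lambda>k. a * tree_num p q (Suc k) * forest_num p q a (n - k)"] sub
        IH D
    by simp
qed

lemma sums_card:
  fixes p q :: "'a::comm_ring_1"
  assumes "finite A"
  shows "tree_sum p q A = tree_num p q (card A) \<and> (\<forall>a. forest_sum p q a A = forest_num p q a (card
      A))"
  using assms
proof (induction "card A" arbitrary: A rule: less_induct)
  case less
  show ?case
  proof (cases "card A")
    case 0
    then show ?thesis using less.prems by (simp add: tree_num_def forest_num_def lessThan_0)
  next
    case (Suc n)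
    note IH = less.hyps[unfolded Suc less_Suc_eq_le]
    have t: "tree_sum p q B = tree_num p q (Suc n)" if "finite B" "card B = Suc n" for B
      using sums_card_step(1)[of n p q B] sums_card_step(1)[of n p q "{..<Suc n}"] IH that
      by (simp add: tree_num_def[of _ _ "Suc n"])
    have "forest_sum p q a A = forest_num p q a (Suc n)" for a
      using sums_card_step(2)[of n p q A a] sums_card_step(2)[of n p q "{..<Suc n}" a] IH t
          less.prems Suc
      by (simp add: forest_num_def[of _ _ _ "Suc n"])
    then show ?thesis using t less.prems Suc by simp
  qed
qed

lemma tree_num_rec:
  "tree_num p q (Suc n) = forest_num p q p n +
    (\<Sum>k\<le>n. of_nat (n choose k) * (of_nat k * q * tree_num p q k * forest_num p q p (n - k)))"
  unfolding tree_num_def[of p q "Suc n"] by (rule sums_card_step(1)) (simp_all add: sums_card)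

lemma forest_num_rec:
  "forest_num p q a (Suc n) =
    (\<Sum>k\<le>n. of_nat (n choose k) * (a * tree_num p q (Suc k) * forest_num p q a (n - k)))"
  unfolding forest_num_def[of p q a "Suc n"] by (rule sums_card_step(2)) (simp_all add: sums_card)

lemma tree_num_0 [simp]: "tree_num p q 0 = 0" and forest_num_0 [simp]: "forest_num p q a 0 = 1"
  by (simp_all add: tree_num_def tree_sum_def forest_num_def forest_sum_def forest_on_empty_iff)

section \<open>Exponential generating functions and product formulas\<close>

lemma fps_linear_ode_unique:
  fixes G H K :: "'a::field_char_0 fps"
  assumes "fps_deriv G = K * G" "fps_deriv H = K * H" "G $ 0 = H $ 0"
  shows "G = H"
proof (rule fps_ext)
  fix n show "G $ n = H $ n"
  proof (induction n rule: less_induct)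
    case (less n)
    show ?case
    proof (cases n)
      case (Suc k)
      have "fps_deriv G $ k = fps_deriv H $ k"
        unfolding assms(1,2) fps_mult_nth by (intro sum.cong HOL.refl) (use less Suc in auto)
      then show ?thesis using Suc by (auto simp del: of_nat_Suc)
    qed (use assms in simp)
  qed
qed

context
  fixes p q :: "'a::field_char_0"
begin

definition tree_fps :: "'a fps" where "tree_fps = Abs_fps (\<lambda>n. tree_num p q n / fact n)"
definition forest_fps :: "'a \<Rightarrow> 'a fps" where "forest_fps a = Abs_fps (\<lambda>n. forest_num p q a n /
    fact n)"

lemma fps_deriv_Abs_fact: "fps_deriv (Abs_fps (\<lambda>n. f n / fact n)) $ n = (f (Suc n) / fact n :: 'a)"
  by (simp add: divide_simps del: of_nat_Suc)

lemma forest_fps_deriv: "fps_deriv (forest_fps a) = fps_const a * fps_deriv tree_fps * forest_fps a"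
proof (rule fps_ext)
  fix n
  have "fps_deriv (forest_fps a) $ n = forest_num p q a (Suc n) / fact n"
    unfolding forest_fps_def fps_deriv_Abs_fact ..
  also have "\<dots> = (\<Sum>k\<le>n. a * (tree_num p q (Suc k) / fact k) * (forest_num p q a (n - k) / fact (n
      - k)))"
    unfolding forest_num_rec sum_divide_distrib
    by (intro sum.cong HOL.refl) (simp add: binomial_fact field_simps)
  also have "\<dots> = (fps_const a * fps_deriv tree_fps * forest_fps a) $ n"
    unfolding fps_mult_nth[of "fps_const a * _"] fps_mult_left_const_nth
    unfolding tree_fps_def forest_fps_def fps_deriv_Abs_fact
    by (simp add: atLeast0AtMost)
  finally show "fps_deriv (forest_fps a) $ n = (fps_const a * fps_deriv tree_fps * forest_fps a) $
      n" .
qed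

lemma tree_fps_deriv:
  "fps_deriv tree_fps = forest_fps p + fps_const q * (fps_X * fps_deriv tree_fps) * forest_fps p"
proof (rule fps_ext)
  fix n
  have X: "(fps_X * fps_deriv tree_fps) $ k = of_nat k * tree_num p q k / fact k" for k
    by (cases k) (simp_all add: tree_fps_def)
  have "fps_deriv tree_fps $ n = tree_num p q (Suc n) / fact n"
    unfolding tree_fps_def fps_deriv_Abs_fact ..
  also have "\<dots> = forest_num p q p n / fact n +
      (\<Sum>k\<le>n. q * (of_nat k * tree_num p q k / fact k) * (forest_num p q p (n - k) / fact (n - k)))"
    unfolding tree_num_rec add_divide_distrib sum_divide_distrib
    by (intro arg_cong2[of _ _ _ _ "(+)"] sum.cong HOL.refl) (simp add: binomial_fact field_simps)
  also have "\<dots> = (forest_fps p + fps_const q * (fps_X * fps_deriv tree_fps) * forest_fps p) $ n"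
    unfolding fps_add_nth fps_mult_nth[of "fps_const q * _"] fps_mult_left_const_nth X
    by (simp add: atLeast0AtMost forest_fps_def)
  finally show "fps_deriv tree_fps $ n = \<dots>" .
qed

text \<open>The law \<open>exp (a F) exp (b F) = exp ((a + b) F)\<close>: both sides solve
  \<open>y' = (a + b) F' y\<close> with constant term 1.\<close>

lemma forest_fps_mult: "forest_fps a * forest_fps b = forest_fps (a + b)"
proof (rule fps_linear_ode_unique)
  show "fps_deriv (forest_fps a * forest_fps b) =
      (fps_const (a + b) * fps_deriv tree_fps) * (forest_fps a * forest_fps b)"
    unfolding fps_deriv_mult forest_fps_deriv fps_const_add[symmetric] by (simp only: algebra_simps)
qed (rule forest_fps_deriv, simp add: forest_fps_def)

text \<open>Inserting the equation for \<open>F'\<close> into \<open>E_a' = a F' E_a\<close>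
  produces \<open>E_p E_a = E_(a+p)\<close>. The extra factor \<open>a + p\<close> turns
  \<open>F' E_(a+p)\<close> into \<open>E_(a+p)'\<close>, so that \<open>F\<close>
  disappears.\<close>

lemma forest_num_shift:
  "(a + p) * forest_num p q a (Suc n) = a * (a + p + of_nat n * q) * forest_num p q (a + p) n"
proof -
  have X: "(fps_X * fps_deriv (forest_fps b)) $ n = of_nat n * forest_num p q b n / fact n" for b
    by (cases n) (simp_all add: forest_fps_def)
  have "fps_const (a + p) * fps_deriv (forest_fps a) =
     fps_const a * (fps_const (a + p) * (forest_fps p * forest_fps a) +
     fps_const q * (fps_X * (fps_const (a + p) * fps_deriv tree_fps * (forest_fps p * forest_fps
         a))))"
    unfolding forest_fps_deriv by (subst tree_fps_deriv) (simp add: algebra_simps)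
  also have "\<dots> = fps_const a * (fps_const (a + p) * forest_fps (a + p) +
     fps_const q * (fps_X * fps_deriv (forest_fps (a + p))))"
    unfolding forest_fps_deriv[of "a + p"] forest_fps_mult by (simp add: add.commute)
  finally have "(fps_const (a + p) * fps_deriv (forest_fps a)) $ n = \<dots> $ n" by simp
  then have "(a + p) * (forest_num p q a (Suc n) / fact n) =
     a * ((a + p) * (forest_num p q (a + p) n / fact n) + q * (of_nat n * forest_num p q (a + p) n
         / fact n))"
    unfolding fps_add_nth fps_mult_left_const_nth X
    unfolding forest_fps_def fps_deriv_Abs_fact by simp
  then have "(a + p) * forest_num p q a (Suc n) / fact n =
     a * (a + p + of_nat n * q) * forest_num p q (a + p) n / fact n"
    by (simp add: algebra_simps add_divide_distrib)
  then show ?thesis by simp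
qed

text \<open>Each step replaces \<open>a\<close> by \<open>a + p\<close> and cancels
  \<open>a + p\<close>, so the hypothesis has to cover all later shifts as well. The step
  contributes the factor of the largest \<open>k\<close>, in which \<open>p\<close> has multiplicity
  one.\<close>

lemma forest_num_eq:
  assumes "\<And>j. a + of_nat (Suc j) * p \<noteq> 0"
  shows "forest_num p q a (Suc n) = a * (\<Prod>k=1..n. a + of_nat k * q + of_nat (Suc n - k) * p)"
  using assms
proof (induction n arbitrary: a)
  case 0
  then show ?case using forest_num_shift[of a 0] "0"[of 0] by simp
next
  case (Suc n)
  have ne: "a + p \<noteq> 0" using Suc.prems[of 0] by simp
  have "a + p + of_nat (Suc j) * p \<noteq> 0" for j using Suc.prems[of "Suc j"] by (simp add:
      algebra_simps)
  then have IH: "forest_num p q (a + p) (Suc n) = (a + p) * (\<Prod>k=1..n. a + p + of_nat k * q +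
      of_nat (Suc n - k) * p)"
    by (rule Suc.IH)
  have "(\<Prod>k=1..n. a + p + of_nat k * q + of_nat (Suc n - k) * p) = (\<Prod>k=1..n. a + of_nat k * q +
      of_nat (Suc (Suc n) - k) * p)"
    by (intro prod.cong HOL.refl) (simp add: Suc_diff_le algebra_simps)
  then have "(a + p) * forest_num p q a (Suc (Suc n)) =
    (a + p) * (a * (\<Prod>k=1..Suc n. a + of_nat k * q + of_nat (Suc (Suc n) - k) * p))"
    unfolding forest_num_shift IH by (simp add: algebra_simps)
  then show ?case using ne by simp
qed

text \<open>Since \<open>p F' E_p = E_p'\<close>, trees are expressed by forests with
  \<open>a = p\<close>: the factor \<open>p + n q\<close> is the one for \<open>k = n\<close>, and
  the forest formula supplies the others.\<close>

lemma tree_num_eq: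
  assumes "p \<noteq> 0"
  shows "tree_num p q (Suc n) = (\<Prod>k=1..n. of_nat k * q + of_nat (Suc n - k) * p)"
proof -
  have X: "(fps_X * fps_deriv (forest_fps p)) $ n = of_nat n * forest_num p q p n / fact n"
    by (cases n) (simp_all add: forest_fps_def)
  have "fps_const p * fps_deriv tree_fps = fps_const p * forest_fps p + fps_const q * (fps_X *
      fps_deriv (forest_fps p))"
    unfolding forest_fps_deriv by (subst tree_fps_deriv) (simp add: algebra_simps)
  then have "(fps_const p * fps_deriv tree_fps) $ n = \<dots> $ n" by simp
  then have "p * (tree_num p q (Suc n) / fact n) = p * (forest_num p q p n / fact n) + q * (of_nat
      n * forest_num p q p n / fact n)"
    unfolding fps_add_nth fps_mult_left_const_nth X
    unfolding tree_fps_def forest_fps_def fps_deriv_Abs_fact by simp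
  then have "p * tree_num p q (Suc n) / fact n = (p + of_nat n * q) * forest_num p q p n / fact n"
    by (simp add: algebra_simps add_divide_distrib)
  then have *: "p * tree_num p q (Suc n) = (p + of_nat n * q) * forest_num p q p n" by simp
  show ?thesis
  proof (cases n)
    case 0
    then show ?thesis using * assms by simp
  next
    case (Suc m)
    have "p + of_nat (Suc j) * p \<noteq> 0" for j
    proof -
      have "p + of_nat (Suc j) * p = of_nat (Suc (Suc j)) * p" by (simp add: algebra_simps)
      then show ?thesis using assms by (simp del: of_nat_Suc)
    qed
    then have "forest_num p q p (Suc m) = p * (\<Prod>k=1..m. p + of_nat k * q + of_nat (Suc m - k) * p)"
      by (rule forest_num_eq)
    also have "(\<Prod>k=1..m. p + of_nat k * q + of_nat (Suc m - k) * p) = (\<Prod>k=1..m. of_nat k * q +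
        of_nat (Suc n - k) * p)"
      unfolding Suc by (intro prod.cong HOL.refl) (simp add: Suc_diff_le algebra_simps)
    finally have "p * tree_num p q (Suc n) = p * (\<Prod>k=1..n. of_nat k * q + of_nat (Suc n - k) * p)"
      using * Suc by (simp add: algebra_simps)
    then show ?thesis using assms by simp
  qed
qed

end

section \<open>A spanning set of two compatible brackets\<close>

lift_definition lie2_subst :: "(nat \<Rightarrow> 'k::field_char_0 lie2) \<Rightarrow> 'k lie2 \<Rightarrow> 'k lie2" is
  "\<lambda>\<sigma>. eval \<sigma> lie2_scale lie2_bracket"
proof -
  fix \<sigma> :: "nat \<Rightarrow> 'k lie2" and a b :: "(2, 'k) expr"
  assume "alg_cong lie2_law a b"
  then show "eval \<sigma> lie2_scale lie2_bracket a = eval \<sigma> lie2_scale lie2_bracket b"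
  proof (rule eval_cong)
    fix a b :: "(2, 'k) expr"
    assume "lie2_law a b"
    then show "eval \<sigma> lie2_scale lie2_bracket a = eval \<sigma> lie2_scale lie2_bracket b"
      by (rule eval_compatible_lie_law[where m = lie2_bracket])
        (simp_all add: lie2_skew[symmetric] lie2_jacobi lie2.vector_space_axioms)
  qed (rule lie2.vector_space_axioms bilinear_lie2_bracket)+
qed

lemma lie2_subst_simps:
  "lie2_subst \<sigma> 0 = 0"
  "lie2_subst \<sigma> (lie2_gen i) = \<sigma> i"
  "lie2_subst \<sigma> (u + v) = lie2_subst \<sigma> u + lie2_subst \<sigma> v"
  "lie2_subst \<sigma> (lie2_scale c u) = lie2_scale c (lie2_subst \<sigma> u)"
  "lie2_subst \<sigma> (lie2_bracket j u v) = lie2_bracket j (lie2_subst \<sigma> u) (lie2_subst \<sigma> v)"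
  by (transfer; simp)+

abbreviation lie2_insert :: "nat \<Rightarrow> 'k::field_char_0 lie2 \<Rightarrow> 'k lie2 \<Rightarrow> 'k lie2" where
  "lie2_insert v c \<equiv> lie2_subst (lie2_gen(v := c))"

lemmas lie2_bilinear = bilinear_lie2_bracket[unfolded bilinear_op_def, THEN conjunct1, rule_format]
  bilinear_lie2_bracket[unfolded bilinear_op_def, THEN conjunct2, THEN conjunct1, rule_format]
  bilinear_lie2_bracket[unfolded bilinear_op_def, THEN conjunct2, THEN conjunct2, THEN conjunct1,
      rule_format]
  bilinear_lie2_bracket[unfolded bilinear_op_def, THEN conjunct2, THEN conjunct2, THEN conjunct2,
      rule_format]

lemma lie2_bracket_minus: "lie2_bracket i (- u) v = - lie2_bracket i u v" "lie2_bracket i u (- v)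
    = - lie2_bracket i u v"
  using lie2_bilinear(3)[of i "-1" u v] lie2_bilinear(4)[of i u "-1" v] by simp_all

lemma lie2_bracket_jacobi:
  "lie2_bracket i (lie2_bracket i u v) w = lie2_bracket i u (lie2_bracket i v w) - lie2_bracket i
      v (lie2_bracket i u w)"
proof -
  have "lie2_bracket i u (lie2_bracket i v w) + (lie2_bracket i v (lie2_bracket i w u) +
      lie2_bracket i w (lie2_bracket i u v)) = 0"
    using lie2_jacobi[where c=1 and d=0 and u=u and v=v and w=w] lie2_jacobi[where c=0 and d=1 and
        u=u and v=v and w=w] exhaust_2[of i] by auto
  moreover have "lie2_bracket i v (lie2_bracket i w u) = - lie2_bracket i v (lie2_bracket i u w)"
    by (subst lie2_skew[of i w u]) (rule lie2_bracket_minus)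
  moreover have "lie2_bracket i w (lie2_bracket i u v) = - lie2_bracket i (lie2_bracket i u v) w"
    by (rule lie2_skew)
  ultimately show ?thesis by (simp add: algebra_simps)
qed

text \<open>Polarization: the Jacobi identity of the sum of the brackets minus those of the two
  brackets. On the right, the only term still bracketed to the left has the two indices
  exchanged.\<close>

lemma lie2_bracket_mixed:
  "lie2_bracket 1 (lie2_bracket 2 u v) w =
     lie2_bracket 1 u (lie2_bracket 2 v w) - lie2_bracket 2 v (lie2_bracket 1 u w)
     + lie2_bracket 2 u (lie2_bracket 1 v w) - lie2_bracket 1 v (lie2_bracket 2 u w)
     - lie2_bracket 2 (lie2_bracket 1 u v) w"
proof -
  let ?b = "lie2_bracket"
  have cyc: "?b i u (?b j v w) + (?b i v (?b j w u) + ?b i w (?b j u v)) =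
     ?b i u (?b j v w) - ?b i v (?b j u w) - ?b i (?b j u v) w" for i j
  proof -
    have "?b i v (?b j w u) = - ?b i v (?b j u w)"
      by (subst lie2_skew[of j w u]) (rule lie2_bracket_minus)
    then show ?thesis using lie2_skew[of i w "?b j u v"] by simp
  qed
  have "(?b 1 u (?b 1 v w) + (?b 1 v (?b 1 w u) + ?b 1 w (?b 1 u v)))
      + (?b 2 u (?b 2 v w) + (?b 2 v (?b 2 w u) + ?b 2 w (?b 2 u v)))
      + (?b 1 u (?b 2 v w) + (?b 1 v (?b 2 w u) + ?b 1 w (?b 2 u v)))
      + (?b 2 u (?b 1 v w) + (?b 2 v (?b 1 w u) + ?b 2 w (?b 1 u v))) = 0"
    using lie2_jacobi[where c=1 and d=1 and u=u and v=v and w=w] by (simp add: lie2_bilinear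
        algebra_simps)
  moreover have "?b i u (?b i v w) + (?b i v (?b i w u) + ?b i w (?b i u v)) = 0" for i
    unfolding cyc lie2_bracket_jacobi by simp
  ultimately have "(?b 1 u (?b 2 v w) + (?b 1 v (?b 2 w u) + ?b 1 w (?b 2 u v)))
      + (?b 2 u (?b 1 v w) + (?b 2 v (?b 1 w u) + ?b 2 w (?b 1 u v))) = 0" by simp
  then show ?thesis unfolding cyc by (simp add: algebra_simps)
qed

section \<open>Monomials with their torus weight\<close>

text \<open>\<open>lie2_monomial\<close> does not record how an element was built; the additional
  index counts first brackets minus second brackets, which is the torus weight.\<close>

inductive graded_monomial :: "nat set \<Rightarrow> int \<Rightarrow> 'k::field_char_0 lie2 \<Rightarrow> bool" where
  gen: "graded_monomial {i} 0 (lie2_gen i)"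
| bracket: "graded_monomial A a u \<Longrightarrow> graded_monomial B b v \<Longrightarrow> A \<inter> B = {} \<Longrightarrow>
    graded_monomial (A \<union> B) (a + b + (if i = 1 then 1 else -1)) (lie2_bracket i u v)"

lemma graded_monomialD: "graded_monomial A a u \<Longrightarrow> (A, u) \<in> lie2_monomial"
  by (induction rule: graded_monomial.induct) (auto intro: lie2_monomial.intros)

lemma graded_monomial_act:
  assumes "graded_monomial A a u" "t \<noteq> 0"
  shows "lie2_act (torus t) u = lie2_scale (t powi a) u"
  using assms(1)
proof induction
  case (bracket A a u B b v i)
  have "torus t $ 1 $ 1 = t" "torus t $ 2 $ 1 = 0" "torus t $ 1 $ 2 = 0" "torus t $ 2 $ 2 =
      inverse t"
    by (simp_all add: torus_def)
  then show ?case
    using bracket exhaust_2[of i] assms(2)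
    by (auto simp: lie2_act_simps lie2_rotated_def lie2_bilinear power_int_add power_int_diff
        field_simps)
qed (simp add: lie2_act_simps)

lemma lie2_insert_other:
  "(A, u) \<in> lie2_monomial \<Longrightarrow> v \<notin> A \<Longrightarrow> lie2_insert v c u = u"
  by (induction rule: lie2_monomial.induct) (auto simp: lie2_subst_simps)

text \<open>The generator \<open>v\<close> occurs exactly once in \<open>u\<close>, so the weights
  add. It may reappear in \<open>x\<close>, as it does in a graft.\<close>

lemma graded_monomial_insert:
  assumes "graded_monomial A a u" "v \<in> A" "graded_monomial C c x" "C \<inter> A \<subseteq> {v}"
  shows "graded_monomial (A - {v} \<union> C) (a + c) (lie2_insert v x u)"
  using assms
proof induction
  case (gen i)
  then show ?case by (simp add: lie2_subst_simps)
next
  case (bracket A a u B b w i)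
  let ?e = "if i = 1 then 1 else -1 :: int"
  show ?case
  proof (cases "v \<in> A")
    case True
    then have v: "v \<notin> B" using bracket by auto
    have "graded_monomial ((A - {v} \<union> C) \<union> B) (a + c + b + ?e) (lie2_bracket i (lie2_insert v x u)
        w)"
      using bracket True v by (intro graded_monomial.bracket bracket.IH(1)) auto
    moreover have "(A - {v} \<union> C) \<union> B = A \<union> B - {v} \<union> C" using v by auto
    moreover have "lie2_insert v x w = w"
      using bracket v by (intro lie2_insert_other graded_monomialD)
    moreover have "a + c + b + ?e = a + b + ?e + c" by simp
    ultimately show ?thesis by (simp only: lie2_subst_simps)
  next
    case False
    then have v: "v \<in> B" using bracket by auto
    have "graded_monomial (A \<union> (B - {v} \<union> C)) (a + (b + c) + ?e) (lie2_bracket i u (lie2_insert v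
        x w))"
      using bracket False v by (intro graded_monomial.bracket bracket.IH(2)) auto
    moreover have "A \<union> (B - {v} \<union> C) = A \<union> B - {v} \<union> C" using False by auto
    moreover have "lie2_insert v x u = u"
      using bracket False by (intro lie2_insert_other graded_monomialD)
    moreover have "a + (b + c) + ?e = a + b + ?e + c" by simp
    ultimately show ?thesis by (simp only: lie2_subst_simps)
  qed
qed

primrec tree_elem :: "tree \<Rightarrow> 'k::field_char_0 lie2" where
  "tree_elem (Node m f) = foldr (lie2_bracket 2) (map tree_elem f) (lie2_gen m)"
| "tree_elem (Graft u v m f) =
     lie2_insert v (lie2_bracket 1 (lie2_gen v) (foldr (lie2_bracket 2) (map tree_elem f)
         (lie2_gen m))) (tree_elem u)"

text \<open>Fixing the ground field keeps the polymorphic elements below at a single type inside proofs.\<close>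

context
  fixes field_type :: "'k::field_char_0 itself"
begin

abbreviation (input) el :: "tree \<Rightarrow> 'k lie2" where "el \<equiv> tree_elem"

lemma tree_elem_Graft: "el (Graft u v m f) =
    lie2_insert v (lie2_bracket 1 (lie2_gen v) (el (Node m f))) (el u)"
  by simp

lemma tree_elem_Node_Cons: "el (Node m (t # f)) = lie2_bracket 2 (el t) (el (Node m f))"
  by simp

text \<open>The torus weight of \<open>tree_elem\<close>: each tree of \<open>f\<close> is attached
  by one second bracket, which accounts for the \<open>- 1\<close>.\<close>

primrec tree_degree :: "tree \<Rightarrow> int" where
  "tree_degree (Node m f) = sum_list (map (\<lambda>d. d - 1) (map tree_degree f))"
| "tree_degree (Graft u v m f) = tree_degree u + 1 + sum_list (map (\<lambda>d. d - 1) (map tree_degree f))"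

lemma graded_monomial_tree_elem:
  "tree_on A t \<Longrightarrow> graded_monomial A (tree_degree t) (el t)"
  "forest_on D f \<Longrightarrow> m \<notin> D \<Longrightarrow> graded_monomial (insert m D) (tree_degree (Node m f)) (el (Node m f))"
proof (induction arbitrary: and m rule: tree_on_forest_on.inducts)
  case Nil
  then show ?case using graded_monomial.gen by simp
next
  case (Cons S t D f)
  have "graded_monomial (S \<union> insert m D) (tree_degree t + tree_degree (Node m f) + (if (2::2) = 1
      then 1 else -1))
      (lie2_bracket 2 (el t) (el (Node m f)))"
    using Cons by (intro graded_monomial.bracket) auto
  then show ?case by (simp add: algebra_simps)
next
  case (Node D f m)
  then show ?case by blast
next
  case (Graft S u v D f m)
  let ?b = "lie2_bracket 1 (lie2_gen v) (el (Node m f))"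
  have b: "graded_monomial ({v} \<union> insert m D) (0 + tree_degree (Node m f) + (if (1::2) = 1 then 1
      else -1)) ?b"
    using Graft by (intro graded_monomial.bracket graded_monomial.gen) auto
  have "graded_monomial (S - {v} \<union> ({v} \<union> insert m D)) (tree_degree u + (0 + tree_degree (Node m
      f) + (if (1::2) = 1 then 1 else -1)))
     (lie2_insert v ?b (el u))"
    using Graft by (intro graded_monomial_insert b) auto
  moreover have "S - {v} \<union> ({v} \<union> insert m D) = insert m (S \<union> D)" using Graft by auto
  ultimately show ?case by (simp add: algebra_simps)
qed

declare tree_elem.simps [simp del]

section \<open>Every multilinear element is a combination of trees\<close>

definition "lie2_multilinear A = (lie2_span {u. (A, u) \<in> lie2_monomial} :: 'k lie2 set)"
definition "tree_span A = lie2_span (el ` trees A)"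

lemma tree_elem_multilinear: "tree_on A t \<Longrightarrow> el t \<in> lie2_multilinear A"
  unfolding lie2_multilinear_def
  by (auto intro: lie2.span_base graded_monomialD graded_monomial_tree_elem)

lemma tree_span_base: "tree_on A t \<Longrightarrow> el t \<in> tree_span A"
  unfolding tree_span_def by (auto intro: lie2.span_base)

lemmas tree_span_closed = lie2.span_add[of _ "el ` trees A" for A, folded tree_span_def]
  lie2.span_diff[of _ "el ` trees A" for A, folded tree_span_def]
  lie2.span_neg[of _ "el ` trees A" for A, folded tree_span_def]

lemma lie2_multilinear_bracket:
  assumes "u \<in> lie2_multilinear A" "v \<in> lie2_multilinear B" "A \<inter> B = {}"
  shows "lie2_bracket i u v \<in> lie2_multilinear (A \<union> B)"
  using assms unfolding lie2_multilinear_def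
  by (intro lie2.bilinear_op_span[OF bilinear_lie2_bracket assms(1,2)[unfolded
      lie2_multilinear_def]])
    (auto intro!: lie2.span_base lie2_monomial.bracket)

text \<open>Second brackets act successively on one generator; ordered forests play the part of
  Poincare-Birkhoff-Witt words in this action.\<close>

definition "hang_span m D = lie2_span ((\<lambda>f. el (Node m f)) ` forests D)"

lemma hang_span_base: "forest_on D f \<Longrightarrow> el (Node m f) \<in> hang_span m D"
  unfolding hang_span_def by (rule lie2.span_base) blast

lemma hang_span_bracket_Max:
  assumes "tree_on S t" "S \<inter> D = {}" "\<forall>d\<in>D. d < Max S" "b \<in> hang_span m D"
  shows "lie2_bracket 2 (el t) b \<in> hang_span m (S \<union> D)"
proof -
  have t: "el t \<in> lie2_span {el t}" by (rule lie2.span_base) simp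
  show ?thesis
    unfolding hang_span_def
  proof (rule lie2.bilinear_op_span[OF bilinear_lie2_bracket t assms(4)[unfolded hang_span_def]])
    fix s x assume "s \<in> {el t}" "x \<in> (\<lambda>f. el (Node m f)) ` forests D"
    then obtain f where "s = el t" "forest_on D f" "x = el (Node m f)" by auto
    moreover from this have "forest_on (S \<union> D) (t # f)" using assms by (intro
        tree_on_forest_on.Cons) auto
    ultimately show "lie2_bracket 2 s x \<in> lie2_span ((\<lambda>f. el (Node m f)) ` forests (S \<union> D))"
      using hang_span_base[of "S \<union> D" "t # f" m] by (simp add: hang_span_def tree_elem_Node_Cons)
  qed
qed

text \<open>Straightening as in the Poincare-Birkhoff-Witt theorem: a tree is moved past a larger
  head \<open>t'\<close> at the cost of their commutator. The commutator has larger support but acts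
  on a shorter forest, so the induction is on \<open>card D\<close> with \<open>S\<close>
  arbitrary.\<close>

lemma hang_span_bracket:
  assumes "finite (S \<union> D)" "S \<inter> D = {}" "\<And>B. B \<subseteq> S \<union> D \<Longrightarrow> lie2_multilinear B \<subseteq> tree_span B"
    and "l \<in> lie2_multilinear S" "b \<in> hang_span m D"
  shows "lie2_bracket 2 l b \<in> hang_span m (S \<union> D)"
  using assms
proof (induction "card D" arbitrary: D S l b rule: less_induct)
  case less
  have "l \<in> lie2_span (el ` trees S)"
    using less.prems(3)[of S] less.prems(4) by (auto simp: tree_span_def)
  then show ?case
    unfolding hang_span_def
  proof (rule lie2.bilinear_op_span[OF bilinear_lie2_bracket _ less.prems(5)[unfolded
      hang_span_def]])
    fix s x assume "s \<in> el ` trees S" "x \<in> (\<lambda>f. el (Node m f)) ` forests D"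
    then obtain t f where s: "s = el t" "tree_on S t" and x: "x = el (Node m f)" "forest_on D f"
        by auto
    have S: "finite S" "S \<noteq> {}" using on_supp(1)[OF s(2)] by auto
    have "lie2_bracket 2 s x \<in> hang_span m (S \<union> D)"
    proof (cases "D = {} \<or> Max D < Max S")
      case True
      have "\<forall>d\<in>D. d < Max S" using True less.prems(1) by (auto dest: Max_ge intro: le_less_trans)
      with s x less.prems(2) show ?thesis by (auto intro!: hang_span_bracket_Max hang_span_base)
    next
      case False
      then have "finite D" "D \<noteq> {}" "\<not> Max D < Max S" using less.prems(1) by auto
      moreover from this have "Max S \<noteq> Max D" using S less.prems(2) Max_in by (metis disjoint_iff)
      ultimately have D: "finite D" "D \<noteq> {}" "Max S < Max D" by linarith+
      then obtain t' f' where f: "f = t' # f'" using x(2) by (cases f) (auto simp: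
          forest_on_Nil_iff)
      from x(2)[unfolded f forest_on_Cons_iff] obtain S' where
        S': "S' \<subseteq> D" "tree_on S' t'" "Max D \<in> S'" "forest_on (D - S') f'" by auto
      let ?b = "el (Node m f')"
      have sets: "S \<union> D = S' \<union> (S \<union> (D - S'))" "S \<union> D = (S \<union> S') \<union> (D - S')" using S' by auto
      have card: "card (D - S') < card D" using S' D by (intro psubset_card_mono) auto
      have "Max S' = Max D" by (rule Max_eqI) (use S' D in \<open>auto dest: finite_subset\<close>)
      then have lt: "\<forall>d\<in>S \<union> (D - S'). d < Max S'"
      proof (intro ballI)
        fix d assume "d \<in> S \<union> (D - S')"
        then consider "d \<le> Max S" | "d \<le> Max D" "d \<noteq> Max D"
          using S(1) D(1) S'(3) by (cases "d \<in> S") auto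
        then show "d < Max S'" using D(3) \<open>Max S' = Max D\<close> by cases auto
      qed
      have b: "?b \<in> hang_span m (D - S')" using S' by (intro hang_span_base)
      have 1: "lie2_bracket 2 s ?b \<in> hang_span m (S \<union> (D - S'))"
        unfolding s using less.prems S' s b
        by (intro less.hyps card tree_elem_multilinear) auto
      have 2: "lie2_bracket 2 (el t') (lie2_bracket 2 s ?b) \<in> hang_span m (S \<union> D)"
        unfolding sets(1) using S' less.prems lt by (intro hang_span_bracket_Max 1) auto
      \<comment> \<open>The commutator need not be a tree, which is why the claim admits every
        \<open>l\<close> in \<open>lie2_multilinear S\<close>.\<close>
      have 3: "lie2_bracket 2 (lie2_bracket 2 s (el t')) ?b \<in> hang_span m (S \<union> D)"
        unfolding sets(2) s using less.prems S' s b
        by (intro less.hyps card lie2_multilinear_bracket tree_elem_multilinear) (auto intro: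
            finite_subset)
      have "lie2_bracket 2 s x = lie2_bracket 2 (lie2_bracket 2 s (el t')) ?b + lie2_bracket 2 (el
          t') (lie2_bracket 2 s ?b)"
        unfolding x f tree_elem_Node_Cons lie2_bracket_jacobi by simp
      with 2 3 show ?thesis unfolding hang_span_def by (simp add: lie2.span_add)
    qed
    then show "lie2_bracket 2 s x \<in> lie2_span ((\<lambda>f. el (Node m f)) ` forests (S \<union> D))"
      by (simp add: hang_span_def)
  qed
qed

lemma hang_span_subset:
  assumes "\<forall>d\<in>D. d < m"
  shows "hang_span m D \<subseteq> tree_span (insert m D)"
  unfolding hang_span_def tree_span_def using assms
  by (intro lie2.span_mono) (auto intro: tree_on_forest_on.Node)

lemma lie2_multilinear_insert_other:
  assumes "u \<in> lie2_multilinear A" "v \<notin> A"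
  shows "lie2_insert v c u = u"
  using assms(1) unfolding lie2_multilinear_def
  by (induction rule: lie2.span_induct_alt) (auto simp: lie2_subst_simps lie2_insert_other[OF _
      assms(2)] simp del: fun_upd_apply)

text \<open>Substitution for \<open>v\<close> is an endomorphism fixing \<open>w\<close>, so
  \<open>{w, u[v := c]} = {w, u}[v := c]\<close>. The bracket \<open>{w, u}\<close> is expanded in
  trees by \<open>IH\<close>, and each of them is grafted again at \<open>v\<close>.\<close>

lemma bracket_Graft:
  assumes "w \<in> lie2_multilinear B" "B \<inter> A = {}" "tree_on A (Graft u v m f)" "\<forall>d\<in>B. d < m" "finite B"
    and IH: "\<And>C. C \<subseteq> B \<union> (A - {m}) \<Longrightarrow> lie2_multilinear C \<subseteq> tree_span C"
  shows "lie2_bracket i w (el (Graft u v m f)) \<in> tree_span (B \<union> A)"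
proof -
  obtain S where S: "S \<subseteq> A - {m}" "tree_on S u" "v \<in> S" "forest_on (A - {m} - S) f"
    and A: "finite A" "A \<noteq> {}" "m = Max A"
    using assms(3)[unfolded tree_on_Graft_iff] by auto
  have m: "\<forall>d\<in>B \<union> (A - {m}). d < m"
    using assms(4) A Max_ge[OF A(1)] by (auto simp: order.strict_iff_order)
  let ?c = "lie2_bracket 1 (lie2_gen v) (el (Node m f))"
  have "lie2_bracket i w (el u) \<in> lie2_multilinear (B \<union> S)"
    using assms S by (intro lie2_multilinear_bracket tree_elem_multilinear) auto
  then have "lie2_bracket i w (el u) \<in> tree_span (B \<union> S)" using IH[of "B \<union> S"] S by auto
  then have "lie2_insert v ?c (lie2_bracket i w (el u)) \<in> tree_span (B \<union> A)"
    unfolding tree_span_def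
  proof (induction rule: lie2.span_induct_alt)
    case base
    then show ?case by (simp add: lie2_subst_simps lie2.span_zero)
  next
    case (step k x y)
    then obtain u' where u': "tree_on (B \<union> S) u'" "x = el u'" by auto
    have "tree_on (insert m ((B \<union> S) \<union> (A - {m} - S))) (Graft u' v m f)"
      using u' S m assms(2) by (intro tree_on_forest_on.Graft) auto
    moreover have "m \<in> A" using A Max_in by simp
    then have "insert m ((B \<union> S) \<union> (A - {m} - S)) = B \<union> A" using S(1) by auto
    ultimately have "el (Graft u' v m f) \<in> tree_span (B \<union> A)" by (simp only: tree_span_base)
    then show ?case using step u'
      unfolding lie2_subst_simps tree_elem_Graft tree_span_def
      by (auto intro: lie2.span_add lie2.span_scale simp del: fun_upd_apply)
  qed
  moreover have "lie2_insert v ?c w = w"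
    using assms(1,2) S by (intro lie2_multilinear_insert_other) auto
  ultimately show ?thesis by (simp add: lie2_subst_simps tree_elem_Graft del: fun_upd_apply)
qed

text \<open>A second bracket with a node is straightened, and any bracket with a graft moves into
  the inner tree. What remains is a first bracket with a node, left to the hypothesis
  \<open>node\<close>.\<close>

lemma bracket_tree_span_reduce:
  assumes w: "w \<in> lie2_multilinear S" and x: "x \<in> tree_span (insert m D)"
    and S: "S \<inter> insert m D = {}" and m: "\<forall>d\<in>S \<union> D. d < m" and fin: "finite (S \<union> D)"
    and sub: "\<And>B. B \<subseteq> S \<union> D \<Longrightarrow> lie2_multilinear B \<subseteq> tree_span B"
    and node: "\<And>f. forest_on D f \<Longrightarrow> lie2_bracket 1 w (el (Node m f)) \<in> tree_span (insert m (S \<union> D))"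
  shows "lie2_bracket i w x \<in> tree_span (insert m (S \<union> D))"
  using x unfolding tree_span_def[of "insert m D"]
proof (induction rule: lie2.span_induct_alt)
  case base
  have "lie2_bracket i w 0 = 0" using lie2_bilinear(4)[of i w 0 0] by simp
  then show ?case by (simp add: tree_span_def lie2.span_zero)
next
  case (step k x y)
  then obtain t where t: "tree_on (insert m D) t" "x = el t" by auto
  have fD: "finite D" using fin by auto
  have Max: "Max (insert m D) = m" using m fD by (intro Max_eqI) (auto intro: less_imp_le)
  have D: "insert m D - {m} = D" using m by auto
  have "lie2_bracket i w x \<in> tree_span (insert m (S \<union> D))"
  proof (cases t)
    case (Node k f)
    have "k = m \<and> forest_on (insert m D - {k}) f" using t(1) unfolding Node tree_on_Node_iff Max
        by blast
    then have f: "k = m" "forest_on D f" using D by metis+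
    show ?thesis
    proof (cases "i = 1")
      case True
      then show ?thesis using node f Node t(2) by simp
    next
      case False
      then have i: "i = 2" using exhaust_2[of i] by auto
      have "lie2_bracket 2 w (el (Node m f)) \<in> hang_span m (S \<union> D)"
        using S by (intro hang_span_bracket[OF fin _ sub w hang_span_base[OF f(2)]]) auto
      then show ?thesis using hang_span_subset[OF m] i Node f t(2) by auto
    qed
  next
    case (Graft u v k f)
    have k: "k = m" using t(1) unfolding Graft tree_on_Graft_iff Max by blast
    have "lie2_bracket i w (el (Graft u v m f)) \<in> tree_span (S \<union> insert m D)"
    proof (rule bracket_Graft[OF w S])
      show "tree_on (insert m D) (Graft u v m f)" using t(1) Graft k by simp
      show "lie2_multilinear C \<subseteq> tree_span C" if "C \<subseteq> S \<union> (insert m D - {m})" for C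
        using that unfolding D by (rule sub)
    qed (use m fin in auto)
    then show ?thesis using Graft k t(2) by simp
  qed
  then show ?case using step
    unfolding lie2_bilinear tree_span_def by (auto intro: lie2.span_add lie2.span_scale)
qed

text \<open>The first bracket of a product with a tree rooted at the largest generator is moved inwards
  by the Jacobi identity and the compatibility relation until it meets a single generator.\<close>

lemma bracket_tree_span:
  assumes "(S, w) \<in> lie2_monomial" "x \<in> tree_span (insert m D)" "S \<inter> insert m D = {}"
    and "\<forall>d\<in>S \<union> D. d < m" "finite (S \<union> D)"
    and "\<And>B. B \<subseteq> S \<union> D \<Longrightarrow> lie2_multilinear B \<subseteq> tree_span B"
  shows "lie2_bracket i w x \<in> tree_span (insert m (S \<union> D))"
  using assms
proof (induction arbitrary: i x D)
  case (gen j)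
  show ?case
  proof (rule bracket_tree_span_reduce[OF _ gen.prems])
    show "lie2_gen j \<in> lie2_multilinear {j}"
      unfolding lie2_multilinear_def by (auto intro: lie2.span_base lie2_monomial.gen)
    fix f assume f: "forest_on D f"
    \<comment> \<open>The first bracket of a single generator with a node is itself a graft, onto
      the tree with the one vertex \<open>j\<close>.\<close>
    have j: "tree_on {j} (Node j [])"
      using tree_on_forest_on.Node[OF tree_on_forest_on.Nil, of j] by simp
    have "tree_on (insert m ({j} \<union> D)) (Graft (Node j []) j m f)"
      using gen.prems f by (intro tree_on_forest_on.Graft j) auto
    then have "el (Graft (Node j []) j m f) \<in> tree_span (insert m ({j} \<union> D))"
      by (rule tree_span_base)
    then show "lie2_bracket 1 (lie2_gen j) (el (Node m f)) \<in> tree_span (insert m ({j} \<union> D))"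
      by (simp add: lie2_subst_simps tree_elem.simps)
  qed
next
  case (bracket A u B v j)
  have IH1: "lie2_bracket i u y \<in> tree_span (insert m (A \<union> C))"
    if C: "C \<subseteq> B \<union> D" "C \<inter> A = {}" "y \<in> tree_span (insert m C)" for i y C
  proof (rule bracket.IH(1)[OF C(3)])
    have sets: "A \<union> C \<subseteq> A \<union> B \<union> D" using C by auto
    then show "finite (A \<union> C)" using bracket.prems(4) finite_subset by blast
    show "A \<inter> insert m C = {}" "\<forall>d\<in>A \<union> C. d < m"
      using C(2) sets bracket.prems(2,3) by blast+
    show "lie2_multilinear E \<subseteq> tree_span E" if "E \<subseteq> A \<union> C" for E
      using that sets by (intro bracket.prems(5)) blast
  qed
  have IH2: "lie2_bracket i v y \<in> tree_span (insert m (B \<union> C))"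
    if C: "C \<subseteq> A \<union> D" "C \<inter> B = {}" "y \<in> tree_span (insert m C)" for i y C
  proof (rule bracket.IH(2)[OF C(3)])
    have sets: "B \<union> C \<subseteq> A \<union> B \<union> D" using C by auto
    then show "finite (B \<union> C)" using bracket.prems(4) finite_subset by blast
    show "B \<inter> insert m C = {}" "\<forall>d\<in>B \<union> C. d < m"
      using C(2) sets bracket.prems(2,3) by blast+
    show "lie2_multilinear E \<subseteq> tree_span E" if "E \<subseteq> B \<union> C" for E
      using that sets by (intro bracket.prems(5)) blast
  qed
  \<comment> \<open>Both induction hypotheses are composed; the inner bracket enlarges
    \<open>D\<close>, hence \<open>D\<close> is arbitrary in the induction.\<close>
  have uv: "lie2_bracket i u (lie2_bracket k v y) \<in> tree_span (insert m (A \<union> B \<union> D))"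
    "lie2_bracket i v (lie2_bracket k u y) \<in> tree_span (insert m (A \<union> B \<union> D))"
    if "y \<in> tree_span (insert m D)" for i k y
  proof -
    have v: "lie2_bracket k v y \<in> tree_span (insert m (B \<union> D))"
      using that bracket.hyps(3) bracket.prems(2) by (intro IH2) auto
    have u: "lie2_bracket k u y \<in> tree_span (insert m (A \<union> D))"
      using that bracket.hyps(3) bracket.prems(2) by (intro IH1) auto
    have "lie2_bracket i u (lie2_bracket k v y) \<in> tree_span (insert m (A \<union> (B \<union> D)))"
      using v bracket.hyps(3) bracket.prems(2) by (intro IH1) auto
    moreover have "lie2_bracket i v (lie2_bracket k u y) \<in> tree_span (insert m (B \<union> (A \<union> D)))"
      using u bracket.hyps(3) bracket.prems(2) by (intro IH2) auto
    ultimately show "lie2_bracket i u (lie2_bracket k v y) \<in> tree_span (insert m (A \<union> B \<union> D))"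
      "lie2_bracket i v (lie2_bracket k u y) \<in> tree_span (insert m (A \<union> B \<union> D))"
      by (simp_all add: Un_ac)
  qed
  have u: "u \<in> lie2_multilinear A" and v: "v \<in> lie2_multilinear B"
    using bracket.hyps unfolding lie2_multilinear_def by (auto intro: lie2.span_base)
  show ?case
  proof (rule bracket_tree_span_reduce[OF _ bracket.prems])
    show "lie2_bracket j u v \<in> lie2_multilinear (A \<union> B)"
      using u v bracket.hyps by (intro lie2_multilinear_bracket)
    fix f assume f: "forest_on D f"
    let ?n = "el (Node m f)"
    have n: "?n \<in> tree_span (insert m D)"
      using bracket.prems f by (intro tree_span_base tree_on_forest_on.Node) auto
    show "lie2_bracket 1 (lie2_bracket j u v) ?n \<in> tree_span (insert m (A \<union> B \<union> D))"
    proof (cases "j = 1")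
      case True
      then show ?thesis using uv[OF n] by (simp add: lie2_bracket_jacobi tree_span_closed)
    next
      case False
      then have j: "j = 2" using exhaust_2[of j] by auto
      \<comment> \<open>This is the term of the compatibility relation that is not nested. Its outer
        bracket is the second one, so straightening applies.\<close>
      have "lie2_bracket 2 (lie2_bracket 1 u v) ?n \<in> hang_span m (A \<union> B \<union> D)"
        using u v bracket.prems bracket.hyps f
        by (intro hang_span_bracket hang_span_base lie2_multilinear_bracket) auto
      then have "lie2_bracket 2 (lie2_bracket 1 u v) ?n \<in> tree_span (insert m (A \<union> B \<union> D))"
        using hang_span_subset bracket.prems by blast
      then show ?thesis using uv[OF n] unfolding j lie2_bracket_mixed by (intro tree_span_closed)
    qed
  qed
qed

lemma lie2_monomial_support: "(A, u) \<in> lie2_monomial \<Longrightarrow> finite A \<and> A \<noteq> {}"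
  by (induction rule: lie2_monomial.induct) auto

text \<open>By skew-symmetry the factor with the largest generator may stand on the right, where it
  is a combination of trees by induction. The sets to be re-expanded omit that generator and are
  therefore smaller too.\<close>

lemma lie2_multilinear_subset:
  assumes "finite A" shows "lie2_multilinear A \<subseteq> tree_span A"
  using assms
proof (induction "card A" arbitrary: A rule: less_induct)
  case less
  have "u \<in> tree_span A" if "(A, u) \<in> lie2_monomial" for u
    using that
  proof cases
    case (gen i)
    have "tree_on {i} (Node i [])"
      using tree_on_forest_on.Node[OF tree_on_forest_on.Nil, of i] by simp
    then show ?thesis using tree_span_base[of "{i}" "Node i []"] gen by (simp add: tree_elem.simps)
  next
    case (bracket A1 u1 A2 u2 i)
    have *: "lie2_bracket i v1 v2 \<in> tree_span A"
      if v: "(B1, v1) \<in> lie2_monomial" "(B2, v2) \<in> lie2_monomial" "B1 \<inter> B2 = {}" "A = B1 \<union> B2"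
          "Max A \<in> B2" for B1 B2 v1 v2
    proof -
      define D where "D = B2 - {Max A}"
      have B2: "B2 = insert (Max A) D" using that by (auto simp: D_def)
      have "B1 \<noteq> {}" using lie2_monomial_support[OF v(1)] by simp
      then have "B2 \<subset> A" using that by auto
      then have "lie2_multilinear B2 \<subseteq> tree_span B2"
        using less by (intro less.hyps psubset_card_mono) (auto dest: finite_subset)
      then have v2: "v2 \<in> tree_span (insert (Max A) D)"
        using v(2) unfolding B2[symmetric] lie2_multilinear_def by (auto intro: lie2.span_base)
      have sub: "B1 \<union> D \<subseteq> A - {Max A}" using that by (auto simp: D_def)
      have "lie2_bracket i v1 v2 \<in> tree_span (insert (Max A) (B1 \<union> D))"
      proof (rule bracket_tree_span[OF v(1) v2])
        show "B1 \<inter> insert (Max A) D = {}" using v(3) B2 by simp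
        show "\<forall>d\<in>B1 \<union> D. d < Max A"
          using sub Max_ge[OF less.prems] by (auto simp: order.strict_iff_order)
        show "finite (B1 \<union> D)" using sub less.prems finite_subset by blast
        fix B assume "B \<subseteq> B1 \<union> D"
        moreover have "Max A \<in> A" using that by auto
        ultimately have "B \<subset> A" using sub by auto
        then show "lie2_multilinear B \<subseteq> tree_span B"
          using less by (intro less.hyps psubset_card_mono) (auto dest: finite_subset)
      qed
      moreover have "insert (Max A) (B1 \<union> D) = A" using v(4) B2 by blast
      ultimately show ?thesis by simp
    qed
    have "Max A \<in> A" using lie2_monomial_support[OF that] by simp
    then consider "Max A \<in> A2" | "Max A \<in> A1" using bracket by auto
    then show ?thesis
    proof cases
      case 1
      then show ?thesis using *[of A1 u1 A2 u2] bracket by simp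
    next
      case 2
      then have "- lie2_bracket i u2 u1 \<in> tree_span A"
        using bracket by (intro tree_span_closed *) auto
      then show ?thesis using bracket lie2_skew[of i u1 u2] by simp
    qed
  qed
  then show ?case
    unfolding lie2_multilinear_def tree_span_def
    by (intro lie2.span_minimal) (auto simp: lie2.subspace_span tree_span_def)
qed

lemma lie2_multilinear_eq: "finite A \<Longrightarrow> lie2_multilinear A = tree_span A"
proof (rule antisym)
  show "tree_span A \<subseteq> lie2_multilinear A"
    unfolding tree_span_def lie2_multilinear_def
    by (intro lie2.span_minimal lie2.subspace_span)
      (use tree_elem_multilinear in \<open>auto simp: lie2_multilinear_def\<close>)
qed (rule lie2_multilinear_subset)

end

section \<open>Spanning sets of the bihamiltonian operad\<close>

lift_definition lie2_to_p2 :: "'k::field_char_0 lie2 \<Rightarrow> 'k p2" is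
  "eval p2_gen p2_scale p2_bracket"
proof -
  fix a b :: "(2, 'k) expr"
  assume "alg_cong lie2_law a b"
  then show "eval p2_gen p2_scale p2_bracket a = eval p2_gen p2_scale p2_bracket b"
  proof (rule eval_cong)
    fix a b :: "(2, 'k) expr"
    assume "lie2_law a b"
    then show "eval p2_gen p2_scale p2_bracket a = eval p2_gen p2_scale p2_bracket b"
      by (rule eval_compatible_lie_law[where m = p2_bracket])
        (simp_all add: p2_skew[symmetric] p2_jacobi p2.vector_space_axioms)
  qed (rule p2.vector_space_axioms bilinear_p2_oper)+
qed

lemma lie2_to_p2_simps:
  "lie2_to_p2 0 = 0"
  "lie2_to_p2 (lie2_gen i) = p2_gen i"
  "lie2_to_p2 (u + v) = lie2_to_p2 u + lie2_to_p2 v"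
  "lie2_to_p2 (lie2_scale c u) = p2_scale c (lie2_to_p2 u)"
  "lie2_to_p2 (lie2_bracket j u v) = p2_bracket j (lie2_to_p2 u) (lie2_to_p2 v)"
  by (transfer; simp)+

lemmas p2_bilinear = bilinear_p2_oper[unfolded bilinear_op_def, THEN conjunct1, rule_format]
  bilinear_p2_oper[unfolded bilinear_op_def, THEN conjunct2, THEN conjunct1, rule_format]
  bilinear_p2_oper[unfolded bilinear_op_def, THEN conjunct2, THEN conjunct2, THEN conjunct1,
      rule_format]
  bilinear_p2_oper[unfolded bilinear_op_def, THEN conjunct2, THEN conjunct2, THEN conjunct2,
      rule_format]

lemma p2_oper_zero: "p2_oper h 0 v = 0" "p2_oper h u 0 = 0"
  using p2_bilinear(3)[of h 0 0 v] p2_bilinear(4)[of h u 0 0] by simp_all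

lemma lie2_to_p2_act: "p2_act g (lie2_to_p2 u) = lie2_to_p2 (lie2_act g u)"
  by (induction u rule: lie2_induct)
    (simp_all add: lie2_to_p2_simps p2_act_simps lie2_act_simps lie2_rotated_def)

lemma lie2_to_p2_monomial: "(A, u) \<in> lie2_monomial \<Longrightarrow> (A, lie2_to_p2 u) \<in> p2_monomial"
  by (induction rule: lie2_monomial.induct) (auto simp: lie2_to_p2_simps intro: p2_monomial.intros)

text \<open>The empty product is the junk value \<open>0\<close>, since the free algebra has no unit.\<close>

fun star_prod :: "'k::field_char_0 p2 list \<Rightarrow> 'k p2" where
  "star_prod [] = 0"
| "star_prod [x] = x"
| "star_prod (x # y # xs) = p2_star x (star_prod (y # xs))"

lemma star_prod_Cons: "xs \<noteq> [] \<Longrightarrow> star_prod (x # xs) = p2_star x (star_prod xs)"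
  by (cases xs) auto

definition forest_elem :: "tree list \<Rightarrow> 'k::field_char_0 p2" where
  "forest_elem f = star_prod (map (\<lambda>t. lie2_to_p2 (tree_elem t)) f)"

lemma forest_elem_single [simp]: "forest_elem [t] = lie2_to_p2 (tree_elem t)"
  by (simp add: forest_elem_def)

lemma forest_elem_Cons: "f \<noteq> [] \<Longrightarrow> forest_elem (t # f) = p2_star (lie2_to_p2 (tree_elem t))
    (forest_elem f)"
  by (simp add: forest_elem_def star_prod_Cons)

definition forest_degree :: "tree list \<Rightarrow> int" where
  "forest_degree f = sum_list (map tree_degree f)"

text \<open>Starts at one-tree forests because \<open>star_prod\<close> has no sensible empty value.
  The inclusions in \<open>D\<close> make facts about subsets of \<open>D\<close> available at every
  stage.\<close>

lemma forest_induct [consumes 2, case_names single Cons]: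
  assumes "forest_on D f" "D \<noteq> {}"
    and "\<And>S t. tree_on S t \<Longrightarrow> S \<subseteq> D \<Longrightarrow> P S [t]"
    and "\<And>S t E f. tree_on S t \<Longrightarrow> forest_on E f \<Longrightarrow> S \<inter> E = {} \<Longrightarrow> (\<forall>d\<in>E. d < Max S) \<Longrightarrow> S \<union> E \<subseteq> D \<Longrightarrow>
      E \<noteq> {} \<Longrightarrow> f \<noteq> [] \<Longrightarrow> P E f \<Longrightarrow> P (S \<union> E) (t # f)"
  shows "P D f"
proof -
  have "P E f" if "forest_on E f" "E \<noteq> {}" "E \<subseteq> D" for E
    using that
  proof (induction f arbitrary: E rule: list.induct)
    case Nil
    then show ?case by (simp add: forest_on_Nil_iff)
  next
    case (Cons t f)
    from Cons.prems(1) obtain S E' where E: "E = S \<union> E'" "tree_on S t" "forest_on E' f" "S \<inter> E' =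
        {}" "\<forall>d\<in>E'. d < Max S"
      by cases auto
    show ?case
    proof (cases "f = []")
      case True
      then show ?thesis using E assms(3)[of S t] Cons.prems by (simp add: forest_on_Nil_iff)
    next
      case False
      then have "E' \<noteq> {}" using E forest_on_empty_iff by auto
      with E False Cons.prems have "P (S \<union> E') (t # f)"
        by (intro assms(4) Cons.IH) simp_all
      then show ?thesis using E by simp
    qed
  qed
  then show ?thesis using assms by simp
qed

lemma forest_elem_monomial:
  assumes "forest_on D f" "D \<noteq> {}"
  shows "(D, forest_elem f) \<in> p2_monomial"
  using assms
proof (induction rule: forest_induct)
  case (single S t)
  then show ?case by (auto intro!: lie2_to_p2_monomial graded_monomialD graded_monomial_tree_elem)
next
  case (Cons S t E f)
  then show ?case
    by (auto simp: forest_elem_Cons intro!: p2_monomial.oper lie2_to_p2_monomial graded_monomialD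
        graded_monomial_tree_elem)
qed

lemma forest_elem_act:
  assumes "forest_on D f" "D \<noteq> {}" "t \<noteq> 0"
  shows "p2_act (torus t) (forest_elem f) = p2_scale (t powi forest_degree f) (forest_elem f)"
  using assms(1,2)
proof (induction rule: forest_induct)
  case (single S s)
  then show ?case
    using graded_monomial_act[OF graded_monomial_tree_elem(1) assms(3), of S s]
    by (simp add: lie2_to_p2_act lie2_to_p2_simps forest_degree_def)
next
  case (Cons S s E f)
  then show ?case
    using graded_monomial_act[OF graded_monomial_tree_elem(1) assms(3), of S s]
    by (simp add: lie2_to_p2_act lie2_to_p2_simps forest_degree_def forest_elem_Cons p2_act_simps
      p2_bilinear power_int_add assms(3))
qed

context
  fixes field_type :: "'k::field_char_0 itself"
begin

abbreviation (input) fel :: "tree list \<Rightarrow> 'k p2" where "fel \<equiv> forest_elem"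
abbreviation (input) pel :: "tree \<Rightarrow> 'k p2" where "pel t \<equiv> lie2_to_p2 (tree_elem t)"

definition "forest_span D = p2_span (fel ` forests D)"

lemma forest_span_base: "forest_on D f \<Longrightarrow> fel f \<in> forest_span D"
  unfolding forest_span_def by (auto intro: p2.span_base)

lemma forest_span_closed:
  "0 \<in> forest_span D" "x \<in> forest_span D \<Longrightarrow> y \<in> forest_span D \<Longrightarrow> x + y \<in> forest_span D"
  "x \<in> forest_span D \<Longrightarrow> p2_scale c x \<in> forest_span D" "x \<in> forest_span D \<Longrightarrow> - x \<in> forest_span D"
  unfolding forest_span_def by (simp_all add: p2.span_zero p2.span_add p2.span_scale p2.span_neg)

lemma forest_span_linear:
  assumes "x \<in> forest_span D" "\<And>f. forest_on D f \<Longrightarrow> p2_oper h y (fel f) \<in> forest_span E"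
  shows "p2_oper h y x \<in> forest_span E"
  using assms(1) unfolding forest_span_def[of D]
  by (induction rule: p2.span_induct_alt)
    (auto simp: p2_bilinear p2_oper_zero intro!: forest_span_closed assms(2))

lemma star_Max:
  assumes "tree_on S t" "S \<inter> D = {}" "\<forall>d\<in>D. d < Max S" "x \<in> forest_span D" "D \<noteq> {}"
  shows "p2_star (pel t) x \<in> forest_span (S \<union> D)"
  using assms(4)
proof (rule forest_span_linear)
  fix f assume f: "forest_on D f"
  then have "f \<noteq> []" using assms(5) by (auto simp: forest_on_Nil_iff)
  then show "p2_star (pel t) (fel f) \<in> forest_span (S \<union> D)"
    using forest_span_base[OF tree_on_forest_on.Cons[OF assms(1) f assms(2,3)]]
    by (simp add: forest_elem_Cons)
qed

lemma forest_single: "tree_on S t \<Longrightarrow> forest_on S [t]"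
  using tree_on_forest_on.Cons[OF _ tree_on_forest_on.Nil, of S t] by simp

text \<open>Insertion into a sorted list: by commutativity and associativity the new factor moves
  past the head unless its own maximum is larger.\<close>

lemma star_tree:
  assumes "forest_on D f" "D \<noteq> {}" "tree_on S t" "S \<inter> D = {}"
  shows "p2_star (pel t) (fel f) \<in> forest_span (S \<union> D)"
  using assms
proof (induction rule: forest_induct)
  case (single S' t')
  have fin: "finite S" "finite S'" "S \<noteq> {}" "S' \<noteq> {}" using single on_supp(1) by blast+
  have "Max S \<noteq> Max S'" using fin single.prems Max_in by (metis disjoint_iff)
  then consider "Max S' < Max S" | "Max S < Max S'" by linarith
  then show ?case
  proof cases
    case 1
    then have "\<forall>d\<in>S'. d < Max S" using fin by auto
    then show ?thesis using single fin forest_span_base[OF forest_single]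
      by (intro star_Max) (auto simp flip: forest_elem_single)
  next
    case 2
    then have "\<forall>d\<in>S. d < Max S'" using fin by auto
    then have "p2_star (pel t') (pel t) \<in> forest_span (S' \<union> S)"
      using single fin forest_span_base[OF forest_single]
      by (intro star_Max) (auto simp flip: forest_elem_single)
    then show ?thesis by (simp add: p2_star_commute[of "pel t"] Un_commute)
  qed
next
  case (Cons S' t' D' f')
  have fin: "finite S" "finite S'" "S \<noteq> {}" "S' \<noteq> {}" "finite D'" using Cons on_supp by blast+
  have "Max S \<noteq> Max S'" using fin Cons.prems Max_in by (metis disjoint_iff UnCI)
  then consider "Max S' < Max S" | "Max S < Max S'" by linarith
  then show ?case
  proof cases
    case 1
    then have "\<forall>d\<in>S' \<union> D'. d < Max S"
      using fin Cons.hyps(4) by (metis Un_iff Max_ge le_less_trans less_trans)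
    then show ?thesis using Cons
      by (intro star_Max forest_span_base tree_on_forest_on.Cons) auto
  next
    case 2
    then have lt: "\<forall>d\<in>S \<union> D'. d < Max S'"
      using fin Cons.hyps(4) by (metis Un_iff Max_ge le_less_trans)
    have "p2_star (pel t') (p2_star (pel t) (fel f')) \<in> forest_span (S' \<union> (S \<union> D'))"
    proof (rule star_Max[OF Cons.hyps(1)])
      show "\<forall>d\<in>S \<union> D'. d < Max S'" by (fact lt)
      show "S' \<inter> (S \<union> D') = {}" "S \<union> D' \<noteq> {}" using Cons.hyps(3,6) Cons.prems(2) by auto
      show "p2_star (pel t) (fel f') \<in> forest_span (S \<union> D')" using Cons.prems by (intro Cons.IH)
          auto
    qed
    moreover have "p2_star (pel t') (p2_star (pel t) (fel f')) = p2_star (pel t) (p2_star (pel t')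
        (fel f'))"
      by (metis p2_star_assoc p2_star_commute)
    moreover have "S' \<union> (S \<union> D') = S \<union> (S' \<union> D')" by auto
    ultimately show ?thesis using Cons.hyps by (simp add: forest_elem_Cons)
  qed
qed

lemma star_forest_span:
  assumes "x \<in> forest_span A" "y \<in> forest_span B" "A \<noteq> {}" "B \<noteq> {}" "A \<inter> B = {}"
  shows "p2_star x y \<in> forest_span (A \<union> B)"
proof -
  have "p2_star y x \<in> forest_span (A \<union> B)"
    using assms(1)
  proof (rule forest_span_linear)
    fix f assume "forest_on A f"
    from this assms(3,5) have "p2_star (fel f) y \<in> forest_span (A \<union> B)"
    proof (induction rule: forest_induct)
      case (single S t)
      then show ?case
        by (intro forest_span_linear[OF assms(2)]) (simp add: star_tree assms(4))
    next
      case (Cons S t E f)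
      have "p2_star (pel t) (p2_star (fel f) y) \<in> forest_span (S \<union> (E \<union> B))"
        using Cons by (intro forest_span_linear[OF Cons.IH] star_tree) auto
      then show ?case using Cons.hyps by (simp add: forest_elem_Cons p2_star_assoc Un_ac)
    qed
    then show "p2_star y (fel f) \<in> forest_span (A \<union> B)" by (simp add: p2_star_commute)
  qed
  then show ?thesis by (simp add: p2_star_commute)
qed

lemma lie2_to_p2_forest_span:
  assumes "u \<in> lie2_multilinear A" "finite A"
  shows "(lie2_to_p2 u :: 'k p2) \<in> forest_span A"
proof -
  have "u \<in> lie2_span (tree_elem ` trees A)"
    using assms lie2_multilinear_eq by (auto simp: tree_span_def)
  then show ?thesis
  proof (induction rule: lie2.span_induct_alt)
    case base
    then show ?case by (simp add: lie2_to_p2_simps forest_span_closed)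
  next
    case (step c x y)
    then obtain t where "tree_on A t" "x = tree_elem t" by auto
    then show ?case using step forest_span_base[OF forest_single]
      by (auto simp: lie2_to_p2_simps intro!: forest_span_closed simp flip: forest_elem_single)
  qed
qed

text \<open>Iterated Leibniz rule. Brackets with single factors are left to the hypothesis
  \<open>tree\<close>, so that the lemma serves for both arguments of a bracket in turn.\<close>

lemma bracket_forest_leibniz:
  assumes "forest_on D f" "D \<noteq> {}" "D \<inter> B = {}" "y \<in> forest_span B" "B \<noteq> {}"
    and tree: "\<And>S t. tree_on S t \<Longrightarrow> S \<subseteq> D \<Longrightarrow> p2_bracket i y (pel t) \<in> forest_span (S \<union> B)"
  shows "p2_bracket i y (fel f) \<in> forest_span (D \<union> B)"
  using assms(1-3)
proof (induction rule: forest_induct)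
  case (single S t)
  then show ?case by (simp add: tree)
next
  case (Cons S t E f)
  have S: "S \<noteq> {}" "finite S" using Cons on_supp(1) by blast+
  have 1: "p2_star (p2_bracket i y (pel t)) (fel f) \<in> forest_span ((S \<union> B) \<union> E)"
    using Cons S assms(5) by (intro star_forest_span tree forest_span_base) auto
  have 2: "p2_star (fel [t]) (p2_bracket i y (fel f)) \<in> forest_span (S \<union> (E \<union> B))"
    using Cons S by (intro star_forest_span Cons.IH forest_span_base forest_single) auto
  have "(S \<union> B) \<union> E = S \<union> E \<union> B" "S \<union> (E \<union> B) = S \<union> E \<union> B" by auto
  with 1 2 show ?case using Cons.hyps
    by (simp add: forest_elem_Cons p2_leibniz forest_span_closed)
qed

text \<open>The Leibniz rule in both arguments leaves brackets of two trees, which are Lie elements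
  and hence combinations of trees.\<close>

lemma bracket_forest_span:
  assumes "x \<in> forest_span A" "y \<in> forest_span B" "A \<noteq> {}" "B \<noteq> {}" "A \<inter> B = {}" "finite A"
      "finite B"
  shows "p2_bracket i x y \<in> forest_span (A \<union> B)"
proof -
  have tree: "p2_bracket i y (pel t) \<in> forest_span (S \<union> B)" if "tree_on S t" "S \<subseteq> A" for S t
  proof -
    have "p2_bracket i (pel t) y \<in> forest_span (B \<union> S)"
      using assms(2)
    proof (rule forest_span_linear)
      fix f assume f: "forest_on B f"
      show "p2_bracket i (pel t) (fel f) \<in> forest_span (B \<union> S)"
      proof (rule bracket_forest_leibniz[OF f assms(4)])
        show "B \<inter> S = {}" "S \<noteq> {}" using that assms(5) on_supp(1) by auto
        show "pel t \<in> forest_span S"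
          using forest_span_base[OF forest_single] that by (auto simp flip: forest_elem_single)
        fix S' t' assume t': "tree_on S' t'" "S' \<subseteq> B"
        have "finite (S' \<union> S)" using that t' assms(6,7) by (auto dest: finite_subset)
        moreover have "lie2_bracket i (tree_elem t) (tree_elem t') \<in> lie2_multilinear (S \<union> S')"
          using that t' assms(5) by (intro lie2_multilinear_bracket tree_elem_multilinear) auto
        ultimately have "lie2_to_p2 (lie2_bracket i (tree_elem t) (tree_elem t')) \<in> forest_span
            (S' \<union> S)"
          by (intro lie2_to_p2_forest_span) (simp_all add: Un_commute)
        then show "p2_bracket i (pel t) (pel t') \<in> forest_span (S' \<union> S)" by (simp add:
            lie2_to_p2_simps)
      qed
    qed
    then have "- p2_bracket i (pel t) y \<in> forest_span (S \<union> B)" by (simp add: Un_commute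
        forest_span_closed)
    then show ?thesis using p2_skew[of i y "pel t"] by simp
  qed
  have "p2_bracket i y x \<in> forest_span (A \<union> B)"
    using assms by (intro forest_span_linear[OF assms(1)] bracket_forest_leibniz tree) auto
  then have "- p2_bracket i y x \<in> forest_span (A \<union> B)" by (rule forest_span_closed)
  then show ?thesis using p2_skew[of i x y] by simp
qed

lemma p2_monomial_forest_span: "(A, u) \<in> p2_monomial \<Longrightarrow> u \<in> forest_span A \<and> A \<noteq> {} \<and> finite A"
proof (induction rule: p2_monomial.induct)
  case (gen i)
  have "lie2_to_p2 (lie2_gen i) \<in> forest_span {i}"
    by (rule lie2_to_p2_forest_span) (auto simp: lie2_multilinear_def intro: lie2.span_base
        lie2_monomial.gen)
  then show ?case by (simp add: lie2_to_p2_simps)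
next
  case (oper A u B v h)
  then show ?case by (cases h) (simp_all add: bracket_forest_span star_forest_span)
qed

lemma p2_multilinear_eq:
  assumes "A \<noteq> {}"
  shows "p2_span {u. (A, u) \<in> p2_monomial} = forest_span A"
proof
  show "p2_span {u. (A, u) \<in> p2_monomial} \<subseteq> forest_span A"
    unfolding forest_span_def
    by (intro p2.span_minimal p2.subspace_span) (use p2_monomial_forest_span in \<open>auto simp:
        forest_span_def\<close>)
  show "forest_span A \<subseteq> p2_span {u. (A, u) \<in> p2_monomial}"
    unfolding forest_span_def
    by (intro p2.span_mono) (use assms forest_elem_monomial in auto)
qed

end

section \<open>Evaluation on exponentials\<close>

text \<open>\<open>F A\<close> is the coefficient of the exponential of the sum of the generators in
  \<open>A\<close>, and \<open>\<kappa> S T\<close> the scalar by which the operation multiplies a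
  product of two exponentials. Pairs of exponentials with a common generator contribute nothing,
  which keeps only the multilinear part.\<close>

definition convolution ::
    "(nat set \<Rightarrow> nat set \<Rightarrow> 'k::comm_ring_1) \<Rightarrow> (nat set \<Rightarrow> 'k) \<Rightarrow> (nat set \<Rightarrow> 'k) \<Rightarrow> nat set \<Rightarrow> 'k" where
  "convolution \<kappa> F G A = (\<Sum>S\<in>Pow A. \<kappa> S (A - S) * F S * G (A - S))"

definition triples :: "nat set \<Rightarrow> (nat set \<times> nat set \<times> nat set) set" where
  "triples A = {(S, T, R). S \<union> T \<union> R = A \<and> S \<inter> T = {} \<and> S \<inter> R = {} \<and> T \<inter> R = {}}"

lemma convolution_infinite: "infinite A \<Longrightarrow> convolution \<kappa> F G A = 0"
  unfolding convolution_def by (rule sum.infinite) simp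

lemma convolution_right:
  assumes "finite A"
  shows "convolution \<kappa> F (convolution \<mu> G H) A =
    (\<Sum>(S, T, R)\<in>triples A. \<kappa> S (T \<union> R) * \<mu> T R * F S * G T * H R)"
proof -
  have "convolution \<kappa> F (convolution \<mu> G H) A = (\<Sum>S\<in>Pow A. \<Sum>T\<in>Pow (A - S).
      \<kappa> S (A - S) * \<mu> T (A - S - T) * F S * G T * H (A - S - T))"
    unfolding convolution_def by (intro sum.cong HOL.refl) (simp add: sum_distrib_left mult_ac)
  also have "\<dots> = (\<Sum>(S, T)\<in>Sigma (Pow A) (\<lambda>S. Pow (A - S)).
      \<kappa> S (A - S) * \<mu> T (A - S - T) * F S * G T * H (A - S - T))"
    using assms by (intro sum.Sigma) auto
  also have "\<dots> = (\<Sum>(S, T, R)\<in>triples A. \<kappa> S (T \<union> R) * \<mu> T R * F S * G T * H R)"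
  proof (rule sum.reindex_bij_witness[of _ "\<lambda>(S, T, R). (S, T)" "\<lambda>(S, T). (S, T, A - S - T)"])
    fix x assume "x \<in> Sigma (Pow A) (\<lambda>S. Pow (A - S))"
    then obtain S T where x: "x = (S, T)" "S \<subseteq> A" "T \<subseteq> A - S" by auto
    then have "T \<union> (A - S - T) = A - S" by auto
    then show "(case case x of (S, T) \<Rightarrow> (S, T, A - S - T) of (S, T, R) \<Rightarrow> \<kappa> S (T \<union> R) * \<mu> T R * F S
        * G T * H R) =
      (case x of (S, T) \<Rightarrow> \<kappa> S (A - S) * \<mu> T (A - S - T) * F S * G T * H (A - S - T))"
      by (simp add: x)
  qed (auto simp: triples_def)
  finally show ?thesis .
qed

lemma convolution_left:
  assumes "finite A"
  shows "convolution \<kappa> (convolution \<mu> F G) H A =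
    (\<Sum>(S, T, R)\<in>triples A. \<kappa> (S \<union> T) R * \<mu> S T * F S * G T * H R)"
proof -
  have "convolution \<kappa> (convolution \<mu> F G) H A = (\<Sum>U\<in>Pow A. \<Sum>S\<in>Pow U.
      \<kappa> U (A - U) * \<mu> S (U - S) * F S * G (U - S) * H (A - U))"
    unfolding convolution_def by (intro sum.cong HOL.refl) (simp add: sum_distrib_left
        sum_distrib_right mult_ac)
  also have "\<dots> = (\<Sum>(U, S)\<in>Sigma (Pow A) Pow.
      \<kappa> U (A - U) * \<mu> S (U - S) * F S * G (U - S) * H (A - U))"
    using assms by (intro sum.Sigma) (auto intro: finite_subset)
  also have "\<dots> = (\<Sum>(S, T, R)\<in>triples A. \<kappa> (S \<union> T) R * \<mu> S T * F S * G T * H R)"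
  proof (rule sum.reindex_bij_witness[of _ "\<lambda>(S, T, R). (S \<union> T, S)" "\<lambda>(U, S). (S, U - S, A - U)"])
    fix x assume "x \<in> Sigma (Pow A) Pow"
    then obtain U S where x: "x = (U, S)" "U \<subseteq> A" "S \<subseteq> U" by auto
    then have "S \<union> (U - S) = U" by auto
    then show "(case case x of (U, S) \<Rightarrow> (S, U - S, A - U) of (S, T, R) \<Rightarrow> \<kappa> (S \<union> T) R * \<mu> S T * F S
        * G T * H R) =
      (case x of (U, S) \<Rightarrow> \<kappa> U (A - U) * \<mu> S (U - S) * F S * G (U - S) * H (A - U))"
      by (simp add: x)
  qed (auto simp: triples_def)
  finally show ?thesis .
qed

lemma sum_triples_rotate: "(\<Sum>(S, T, R)\<in>triples A. h S T R) = (\<Sum>(S, T, R)\<in>triples A. h T R S)"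
  by (rule sum.reindex_bij_witness[of _ "\<lambda>(S, T, R). (T, R, S)" "\<lambda>(S, T, R). (R, S, T)"])
    (auto simp: triples_def)

lemma sum_triples_swap: "(\<Sum>(S, T, R)\<in>triples A. h S T R) = (\<Sum>(S, T, R)\<in>triples A. h T S R)"
  by (rule sum.reindex_bij_witness[of _ "\<lambda>(S, T, R). (T, S, R)" "\<lambda>(S, T, R). (T, S, R)"])
    (auto simp: triples_def)

lemma convolution_flip: "convolution \<kappa> F G A = (\<Sum>S\<in>Pow A. \<kappa> (A - S) S * F (A - S) * G S)"
  unfolding convolution_def
  by (rule sum.reindex_bij_witness[of _ "\<lambda>S. A - S" "\<lambda>S. A - S"]) (auto simp: double_diff)

lemma bilinear_convolution: "bilinear_op (\<lambda>c F A. c * F A) (convolution \<kappa>)"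
  unfolding bilinear_op_def convolution_def
  by (auto simp: fun_eq_iff algebra_simps sum.distrib sum_distrib_left)

lemma convolution_skew:
  assumes "\<And>S T. \<kappa> S T = - \<kappa> T S"
  shows "convolution \<kappa> F G = - convolution \<kappa> G F"
proof
  fix A
  have "convolution \<kappa> F G A = (\<Sum>S\<in>Pow A. - (\<kappa> S (A - S) * G S * F (A - S)))"
    unfolding convolution_flip[of \<kappa> F G]
    by (intro sum.cong HOL.refl) (subst assms, simp add: mult_ac)
  then show "convolution \<kappa> F G A = (- convolution \<kappa> G F) A"
    by (simp add: convolution_def sum_negf)
qed

text \<open>Over common ordered triples the three coefficients cancel by additivity and skewness.
  Nothing else about \<open>\<kappa>\<close> is assumed, so linear combinations of such kernels are
  covered as well.\<close>

lemma convolution_jacobi: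
  assumes skew: "\<And>S T. \<kappa> S T = - \<kappa> T S"
    and add: "\<And>S T R. finite T \<Longrightarrow> finite R \<Longrightarrow> T \<inter> R = {} \<Longrightarrow> \<kappa> S (T \<union> R) = \<kappa> S T + \<kappa> S R"
  shows "convolution \<kappa> F (convolution \<kappa> G H) + (convolution \<kappa> G (convolution \<kappa> H F) + convolution
      \<kappa> H (convolution \<kappa> F G)) = 0"
proof
  fix A
  show "(convolution \<kappa> F (convolution \<kappa> G H) + (convolution \<kappa> G (convolution \<kappa> H F) + convolution
      \<kappa> H (convolution \<kappa> F G))) A = (0 :: nat set \<Rightarrow> 'a) A"
  proof (cases "finite A")
    case True
    let ?h = "\<lambda>F G H S T R. \<kappa> S (T \<union> R) * \<kappa> T R * F S * G T * H R"
    have "convolution \<kappa> G (convolution \<kappa> H F) A = (\<Sum>(S, T, R)\<in>triples A. ?h G H F T R S)"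
      unfolding convolution_right[OF True] by (rule sum_triples_rotate)
    moreover have "convolution \<kappa> H (convolution \<kappa> F G) A = (\<Sum>(S, T, R)\<in>triples A. ?h H F G R S T)"
      unfolding convolution_right[OF True] by (subst sum_triples_rotate, subst sum_triples_rotate)
          (rule HOL.refl)
    ultimately have "(convolution \<kappa> F (convolution \<kappa> G H) + (convolution \<kappa> G (convolution \<kappa> H F) +
        convolution \<kappa> H (convolution \<kappa> F G))) A
      = (\<Sum>(S, T, R)\<in>triples A. ?h F G H S T R + (?h G H F T R S + ?h H F G R S T))"
      by (simp add: convolution_right[OF True] sum.distrib case_prod_beta)
    also have "\<dots> = 0"
    proof (rule sum.neutral, clarify)
      fix S T R assume "(S, T, R) \<in> triples A"
      then have fin: "finite S" "finite T" "finite R" "S \<inter> T = {}" "S \<inter> R = {}" "T \<inter> R = {}" "R \<inter>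
          S = {}"
        using True by (auto simp: triples_def)
      have k: "\<kappa> S (T \<union> R) = \<kappa> S T + \<kappa> S R" "\<kappa> T (R \<union> S) = \<kappa> T R - \<kappa> S T" "\<kappa> R (S \<union> T) = - \<kappa> S R -
          \<kappa> T R" "\<kappa> R S = - \<kappa> S R"
        using fin add[of T R S] add[of R S T] add[of S T R] skew[of T S] skew[of R S] skew[of R T]
            by simp_all
      show "?h F G H S T R + (?h G H F T R S + ?h H F G R S T) = 0"
        unfolding k by (simp add: algebra_simps)
    qed
    finally show ?thesis by simp
  qed (simp add: convolution_infinite)
qed

lemma convolution_leibniz:
  assumes add: "\<And>S T R. finite T \<Longrightarrow> finite R \<Longrightarrow> T \<inter> R = {} \<Longrightarrow> \<kappa> S (T \<union> R) = \<kappa> S T + \<kappa> S R"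
  shows "convolution \<kappa> F (convolution (\<lambda>_ _. 1) G H) =
    convolution (\<lambda>_ _. 1) (convolution \<kappa> F G) H + convolution (\<lambda>_ _. 1) G (convolution \<kappa> F H)"
proof
  fix A
  show "convolution \<kappa> F (convolution (\<lambda>_ _. 1) G H) A =
    (convolution (\<lambda>_ _. 1) (convolution \<kappa> F G) H + convolution (\<lambda>_ _. 1) G (convolution \<kappa> F H)) A"
  proof (cases "finite A")
    case True
    have "convolution (\<lambda>_ _. 1) G (convolution \<kappa> F H) A = (\<Sum>(S, T, R)\<in>triples A. \<kappa> S R * G T * F S
        * H R)"
      unfolding convolution_right[OF True] by (subst sum_triples_swap) simp
    then have "(convolution (\<lambda>_ _. 1) (convolution \<kappa> F G) H + convolution (\<lambda>_ _. 1) G (convolution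
        \<kappa> F H)) A
      = (\<Sum>(S, T, R)\<in>triples A. \<kappa> S T * F S * G T * H R + \<kappa> S R * G T * F S * H R)"
      by (simp add: convolution_left[OF True] sum.distrib case_prod_beta)
    also have "\<dots> = (\<Sum>(S, T, R)\<in>triples A. \<kappa> S (T \<union> R) * 1 * F S * G T * H R)"
    proof (intro sum.cong HOL.refl, clarify)
      fix S T R assume "(S, T, R) \<in> triples A"
      then have "finite T" "finite R" "T \<inter> R = {}" using True by (auto simp: triples_def)
      then show "\<kappa> S T * F S * G T * H R + \<kappa> S R * G T * F S * H R = \<kappa> S (T \<union> R) * 1 * F S * G T *
          H R"
        by (simp add: add algebra_simps)
    qed
    finally show ?thesis by (simp add: convolution_right[OF True])
  qed (simp add: convolution_infinite)
qed

lemma convolution_assoc: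
  "convolution (\<lambda>_ _. 1) (convolution (\<lambda>_ _. 1) F G) H = convolution (\<lambda>_ _. 1) F (convolution (\<lambda>_
      _. 1) G H)"
proof
  fix A show "convolution (\<lambda>_ _. 1) (convolution (\<lambda>_ _. 1) F G) H A = convolution (\<lambda>_ _. 1) F
      (convolution (\<lambda>_ _. 1) G H) A"
    by (cases "finite A") (simp_all add: convolution_left convolution_right convolution_infinite)
qed

lemma convolution_commute: "convolution (\<lambda>_ _. 1) F G = convolution (\<lambda>_ _. 1) G F"
proof
  fix A show "convolution (\<lambda>_ _. 1) F G A = convolution (\<lambda>_ _. 1) G F A"
    unfolding convolution_flip[of _ F G] by (simp add: convolution_def mult_ac)
qed

text \<open>The bracket \<open>i\<close> of the constant Poisson structure with matrix \<open>N\<^sub>i - N\<^sub>i\<^sup>T\<close>, evaluated on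
  exponentials of linear forms. A set of generators stands for the
  exponential of their sum.\<close>

definition pairing :: "(2 \<Rightarrow> nat \<Rightarrow> nat \<Rightarrow> 'k::comm_ring_1) \<Rightarrow> 2 \<Rightarrow> nat set \<Rightarrow> nat set \<Rightarrow> 'k" where
  "pairing N i S T = (\<Sum>x\<in>S. \<Sum>y\<in>T. N i x y - N i y x)"

lemma pairing_skew: "pairing N i S T = - pairing N i T S"
proof -
  have "pairing N i S T = (\<Sum>y\<in>T. \<Sum>x\<in>S. N i x y - N i y x)"
    unfolding pairing_def by (rule sum.swap)
  also have "\<dots> = (\<Sum>y\<in>T. \<Sum>x\<in>S. - (N i y x - N i x y))" by simp
  finally show ?thesis unfolding sum_negf pairing_def .
qed

lemma pairing_Un: "finite T \<Longrightarrow> finite R \<Longrightarrow> T \<inter> R = {} \<Longrightarrow> pairing N i S (T \<union> R) = pairing N i S T +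
    pairing N i S R"
  unfolding pairing_def by (simp add: sum.union_disjoint sum.distrib)

primrec op_kernel :: "(2 \<Rightarrow> nat \<Rightarrow> nat \<Rightarrow> 'k::comm_ring_1) \<Rightarrow> p2_op \<Rightarrow> nat set \<Rightarrow> nat set \<Rightarrow> 'k" where
  "op_kernel N (Bracket i) = pairing N i"
| "op_kernel N Star = (\<lambda>_ _. 1)"

definition value_gen :: "nat \<Rightarrow> nat set \<Rightarrow> 'k::field_char_0" where
  "value_gen i A = (if A = {i} then 1 else 0)"

lemma vector_space_fun: "vector_space (\<lambda>(c::'k::field) (F::nat set \<Rightarrow> 'k) A. c * F A)"
  by standard (auto simp: fun_eq_iff algebra_simps)

lemma convolution_pencil:
  "(\<lambda>A. c * convolution \<kappa> F G A) + (\<lambda>A. d * convolution \<mu> F G A) = convolution (\<lambda>S T. c * \<kappa> S T +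
      d * \<mu> S T) F G"
  by (auto simp: fun_eq_iff convolution_def algebra_simps sum.distrib sum_distrib_left)

lift_definition p2_value :: "(2 \<Rightarrow> nat \<Rightarrow> nat \<Rightarrow> 'k::field_char_0) \<Rightarrow> 'k p2 \<Rightarrow> nat set \<Rightarrow> 'k" is
  "\<lambda>N. eval value_gen (\<lambda>c F A. c * F A) (\<lambda>h. convolution (op_kernel N h))"
proof -
  fix N :: "2 \<Rightarrow> nat \<Rightarrow> nat \<Rightarrow> 'k" and a b :: "(p2_op, 'k) expr"
  let ?e = "eval value_gen (\<lambda>c F A. c * F A) (\<lambda>h. convolution (op_kernel N h))"
  assume "alg_cong p2_law a b"
  then show "?e a = ?e b"
  proof (rule eval_cong)
    fix a b :: "(p2_op, 'k) expr"
    assume "p2_law a b"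
    then show "?e a = ?e b"
    proof cases
      case lie2
      then show ?thesis
      proof (rule eval_compatible_lie_law[where m = "\<lambda>i. convolution (pairing N i)"])
        show "convolution (pairing N i) u v = - convolution (pairing N i) v u" for i u v
          by (rule convolution_skew) (rule pairing_skew)
        fix c d u v w
        \<comment> \<open>A combination of two skew additive kernels is again skew and additive;
          this is the compatibility of constant brackets.\<close>
        show "let b = \<lambda>u v. (\<lambda>A. c * convolution (pairing N 1) u v A) + (\<lambda>A. d * convolution
            (pairing N 2) u v A)
          in b u (b v w) + (b v (b w u) + b w (b u v)) = 0"
          unfolding convolution_pencil Let_def
        proof (rule convolution_jacobi)
          show "c * pairing N 1 S T + d * pairing N 2 S T = - (c * pairing N 1 T S + d * pairing N
              2 T S)" for S T
            by (subst (1 2) pairing_skew) simp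
        qed (simp add: pairing_Un algebra_simps)
      qed (simp_all add: vector_space_fun)
    next
      case (leibniz i x y z)
      show ?thesis unfolding leibniz eval.simps op_kernel.simps
        by (rule convolution_leibniz) (rule pairing_Un)
    next
      case (star_commute x y)
      show ?thesis unfolding star_commute eval.simps op_kernel.simps by (rule convolution_commute)
    next
      case (star_assoc x y z)
      show ?thesis unfolding star_assoc eval.simps op_kernel.simps by (rule convolution_assoc)
    qed
  qed (rule vector_space_fun bilinear_convolution)+
qed

lemma p2_value_simps:
  "p2_value N 0 = 0"
  "p2_value N (p2_gen i) = value_gen i"
  "p2_value N (u + v) = p2_value N u + p2_value N v"
  "p2_value N (p2_scale c u) = (\<lambda>A. c * p2_value N u A)"
  "p2_value N (p2_oper h u v) = convolution (op_kernel N h) (p2_value N u) (p2_value N v)"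
  by (transfer; simp)+

section \<open>Values of monomials\<close>

lemma p2_monomial_finite: "(A, u) \<in> p2_monomial \<Longrightarrow> finite A"
  by (induction rule: p2_monomial.induct) auto

lemma convolution_concentrated:
  assumes "\<And>S. S \<noteq> A \<Longrightarrow> F S = 0" "\<And>S. S \<noteq> B \<Longrightarrow> G S = 0" "finite A" "finite B" "A \<inter> B = {}"
  shows "convolution \<kappa> F G C = (if C = A \<union> B then \<kappa> A B * F A * G B else 0)"
proof -
  have *: "\<kappa> S (C - S) * F S * G (C - S) = (if S = A \<and> C = A \<union> B then \<kappa> A B * F A * G B else 0)"
      if "S \<in> Pow C" for S
  proof (cases "S = A \<and> C - S = B")
    case True
    then have "C = A \<union> B" "S = A" "C - A = B" using that by auto
    then show ?thesis by (metis (full_types))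
  next
    case False
    then have "S \<noteq> A \<or> C - S \<noteq> B" by simp
    then have "F S * G (C - S) = 0" using assms(1)[of S] assms(2)[of "C - S"] by (elim disjE)
        simp_all
    moreover have "\<not> (S = A \<and> C = A \<union> B)" using False assms(5) by auto
    ultimately show ?thesis by (auto simp: mult.assoc)
  qed
  have "convolution \<kappa> F G C = (\<Sum>S\<in>Pow C. if S = A \<and> C = A \<union> B then \<kappa> A B * F A * G B else 0)"
    unfolding convolution_def by (intro sum.cong HOL.refl *)
  also have "\<dots> = (if C = A \<union> B then \<kappa> A B * F A * G B else 0)"
    using assms(3,4) by (cases "C = A \<union> B") (auto simp: sum.delta)
  finally show ?thesis .
qed

lemma p2_value_other: "(A, u) \<in> p2_monomial \<Longrightarrow> B \<noteq> A \<Longrightarrow> p2_value N u B = 0"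
proof (induction arbitrary: B rule: p2_monomial.induct)
  case (oper A u C v h)
  then show ?case
    unfolding p2_value_simps
    by (subst convolution_concentrated[of A _ C]) (auto dest: p2_monomial_finite)
qed (simp add: p2_value_simps value_gen_def)

lemma p2_value_oper:
  assumes "(A, u) \<in> p2_monomial" "(B, v) \<in> p2_monomial" "A \<inter> B = {}"
  shows "p2_value N (p2_oper h u v) (A \<union> B) = op_kernel N h A B * p2_value N u A * p2_value N v B"
  unfolding p2_value_simps using assms
  by (subst convolution_concentrated[of A _ B]) (auto simp: p2_value_other p2_monomial_finite)

definition lie2_value :: "(2 \<Rightarrow> nat \<Rightarrow> nat \<Rightarrow> 'k::field_char_0) \<Rightarrow> nat set \<Rightarrow> 'k lie2 \<Rightarrow> 'k" where
  "lie2_value N A u = p2_value N (lie2_to_p2 u) A"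

lemma lie2_value_linear:
  "lie2_value N A 0 = 0"
  "lie2_value N A (u + v) = lie2_value N A u + lie2_value N A v"
  "lie2_value N A (lie2_scale c u) = c * lie2_value N A u"
  by (simp_all add: lie2_value_def lie2_to_p2_simps p2_value_simps)

lemma lie2_value_gen [simp]: "lie2_value N {i} (lie2_gen i) = 1"
  by (simp add: lie2_value_def lie2_to_p2_simps p2_value_simps value_gen_def)

lemma lie2_value_bracket:
  assumes "(A, u) \<in> lie2_monomial" "(B, v) \<in> lie2_monomial" "A \<inter> B = {}"
  shows "lie2_value N (A \<union> B) (lie2_bracket i u v) = pairing N i A B * lie2_value N A u *
      lie2_value N B v"
  using assms by (simp add: lie2_value_def lie2_to_p2_simps p2_value_oper lie2_to_p2_monomial)

lemma pairing_cong:
  assumes "\<And>x y. x \<in> A \<Longrightarrow> y \<in> B \<Longrightarrow> N i x y = N' i x y \<and> N i y x = N' i y x"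
  shows "pairing N i A B = pairing N' i A B"
  unfolding pairing_def using assms by (intro sum.cong HOL.refl) auto

lemma pairing_zero:
  assumes "\<And>x y. x \<in> A \<Longrightarrow> y \<in> B \<Longrightarrow> N i x y = 0 \<and> N i y x = 0"
  shows "pairing N i A B = 0"
  unfolding pairing_def using assms by (intro sum.neutral ballI) auto

text \<open>Brackets join disjoint sets, so only entries off the diagonal enter. The restriction
  \<open>x \<noteq> y\<close> matters, since contraction disturbs the diagonal.\<close>

lemma lie2_value_cong:
  assumes "(A, u) \<in> lie2_monomial"
    and "\<And>i x y. x \<in> A \<Longrightarrow> y \<in> A \<Longrightarrow> x \<noteq> y \<Longrightarrow> N i x y = N' i x y"
  shows "lie2_value N A u = lie2_value N' A u"
  using assms
proof induction
  case (bracket A u B v i)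
  have "pairing N i A B = pairing N' i A B"
    using bracket.hyps(3) bracket.prems by (intro pairing_cong) auto
  then show ?case using bracket by (simp add: lie2_value_bracket)
qed simp

text \<open>Some bracket in the monomial joins a factor with generators in \<open>P\<close> only to
  one with generators in \<open>Q\<close> only, and its pairing vanishes.\<close>

lemma lie2_value_split:
  assumes "(A, u) \<in> lie2_monomial" "A \<subseteq> P \<union> Q" "A \<inter> P \<noteq> {}" "A \<inter> Q \<noteq> {}"
    and "\<And>i x y. x \<in> P \<Longrightarrow> y \<in> Q \<Longrightarrow> N i x y = 0 \<and> N i y x = 0" "P \<inter> Q = {}"
  shows "lie2_value N A u = 0"
  using assms(1-4)
proof induction
  case (gen i)
  then show ?case using assms(6) by auto
next
  case (bracket A u B v i)
  have "lie2_value N A u = 0 \<or> lie2_value N B v = 0 \<or> pairing N i A B = 0"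
  proof (cases "(A \<inter> P \<noteq> {} \<and> A \<inter> Q \<noteq> {}) \<or> (B \<inter> P \<noteq> {} \<and> B \<inter> Q \<noteq> {})")
    case True
    then show ?thesis using bracket.IH bracket.prems by auto
  next
    case False
    then have "(A \<subseteq> P \<and> B \<subseteq> Q) \<or> (A \<subseteq> Q \<and> B \<subseteq> P)" using bracket.prems by blast
    then have "pairing N i A B = 0"
      using assms(5) by (elim disjE; intro pairing_zero) (meson subsetD)+
    then show ?thesis by simp
  qed
  then show ?case using bracket.hyps by (auto simp: lie2_value_bracket)
qed

text \<open>Merges the generators of \<open>C\<close> into \<open>v\<close>: the exponential of
  their sum pairs through the sums of their rows and columns.\<close>

definition contract :: "nat \<Rightarrow> nat set \<Rightarrow> (2 \<Rightarrow> nat \<Rightarrow> nat \<Rightarrow> 'k::comm_ring_1) \<Rightarrow> 2 \<Rightarrow> nat \<Rightarrow> nat \<Rightarrow> 'k"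
    where
  "contract v C N i x y = (\<Sum>a\<in>(if x = v then C else {x}). \<Sum>b\<in>(if y = v then C else {y}). N i a b)"

lemma pairing_contract:
  assumes "finite A" "finite C" "v \<in> A" "v \<notin> B" "C \<inter> A \<subseteq> {v}"
  shows "pairing (contract v C N) i A B = pairing N i (A - {v} \<union> C) B"
proof -
  have v: "(\<Sum>y\<in>B. contract v C N i v y - contract v C N i y v) = (\<Sum>x\<in>C. \<Sum>y\<in>B. N i x y - N i y x)"
  proof -
    have "(\<Sum>y\<in>B. contract v C N i v y - contract v C N i y v) = (\<Sum>y\<in>B. \<Sum>x\<in>C. N i x y - N i y x)"
      using assms(4) by (intro sum.cong HOL.refl) (auto simp: contract_def sum_subtractf)
    then show ?thesis by (subst sum.swap)
  qed
  have "pairing (contract v C N) i A B = (\<Sum>y\<in>B. contract v C N i v y - contract v C N i y v)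
     + (\<Sum>x\<in>A - {v}. \<Sum>y\<in>B. contract v C N i x y - contract v C N i y x)"
    unfolding pairing_def using assms by (simp add: sum.remove)
  also have "(\<Sum>x\<in>A - {v}. \<Sum>y\<in>B. contract v C N i x y - contract v C N i y x) = (\<Sum>x\<in>A - {v}. \<Sum>y\<in>B.
      N i x y - N i y x)"
    using assms(4) by (intro sum.cong HOL.refl) (auto simp: contract_def)
  also have "(\<Sum>y\<in>B. contract v C N i v y - contract v C N i y v) + \<dots> = pairing N i (A - {v} \<union> C) B"
    unfolding pairing_def v using assms by (subst sum.union_disjoint) (auto simp: add.commute)
  finally show ?thesis .
qed

lemma lie2_insert_monomial:
  assumes "(A, u) \<in> lie2_monomial" "v \<in> A" "(C, x) \<in> lie2_monomial" "C \<inter> A \<subseteq> {v}"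
  shows "(A - {v} \<union> C, lie2_insert v x u) \<in> lie2_monomial"
proof -
  have "\<exists>a. graded_monomial A a u" if "(A, u) \<in> lie2_monomial" for A and u :: "'a lie2"
    using that by induction (auto intro: graded_monomial.intros)
  with assms show ?thesis by (meson graded_monomialD graded_monomial_insert)
qed

lemma lie2_value_contract_other:
  assumes "(A, u) \<in> lie2_monomial" "v \<notin> A"
  shows "lie2_value (contract v C N) A u = lie2_value N A u"
  using assms by (intro lie2_value_cong) (auto simp: contract_def)

text \<open>Brackets inside \<open>x\<close> see only \<open>C\<close>, while every other bracket
  sees \<open>C\<close> as a whole, which the contracted matrix records at \<open>v\<close>. Hence
  the value factors.\<close>

lemma lie2_value_insert:
  assumes "(A, u) \<in> lie2_monomial" "v \<in> A" "(C, x) \<in> lie2_monomial" "C \<inter> A \<subseteq> {v}"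
  shows "lie2_value N (A - {v} \<union> C) (lie2_insert v x u) = lie2_value N C x * lie2_value (contract
      v C N) A u"
  using assms
proof induction
  case (gen i)
  then show ?case by (simp add: lie2_subst_simps)
next
  case (bracket A u B w i)
  have fin: "finite A" "finite B" "finite C" using bracket lie2_monomial_support by blast+
  have val: "lie2_value (contract v C N) (A \<union> B) (lie2_bracket i u w) =
     pairing (contract v C N) i A B * lie2_value (contract v C N) A u * lie2_value (contract v C
         N) B w"
    using bracket.hyps by (rule lie2_value_bracket)
  show ?case
  proof (cases "v \<in> A")
    case True
    then have v: "v \<notin> B" using bracket by auto
    have "A \<union> B - {v} \<union> C = (A - {v} \<union> C) \<union> B" using v by auto
    moreover have "lie2_insert v x w = w"
      using bracket v by (intro lie2_insert_other)
    moreover have "lie2_value N ((A - {v} \<union> C) \<union> B) (lie2_bracket i (lie2_insert v x u) w) =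
      pairing N i (A - {v} \<union> C) B * lie2_value N (A - {v} \<union> C) (lie2_insert v x u) * lie2_value N
          B w"
      using bracket True v by (intro lie2_value_bracket lie2_insert_monomial) auto
    moreover have "lie2_value N (A - {v} \<union> C) (lie2_insert v x u) = lie2_value N C x * lie2_value
        (contract v C N) A u"
      using bracket True by (intro bracket.IH) auto
    moreover have "pairing (contract v C N) i A B = pairing N i (A - {v} \<union> C) B"
      using fin True v bracket by (intro pairing_contract) auto
    moreover have "lie2_value (contract v C N) B w = lie2_value N B w"
      using bracket v by (intro lie2_value_contract_other)
    ultimately show ?thesis unfolding val lie2_subst_simps by (simp only: mult_ac)
  next
    case False
    then have v: "v \<in> B" using bracket by auto
    have "A \<union> B - {v} \<union> C = A \<union> (B - {v} \<union> C)" using False by auto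
    moreover have "lie2_insert v x u = u"
      using bracket False by (intro lie2_insert_other)
    moreover have "lie2_value N (A \<union> (B - {v} \<union> C)) (lie2_bracket i u (lie2_insert v x w)) =
      pairing N i A (B - {v} \<union> C) * lie2_value N A u * lie2_value N (B - {v} \<union> C) (lie2_insert v x
          w)"
      using bracket False v by (intro lie2_value_bracket lie2_insert_monomial) auto
    moreover have "lie2_value N (B - {v} \<union> C) (lie2_insert v x w) = lie2_value N C x * lie2_value
        (contract v C N) B w"
      using bracket v by (intro bracket.IH) auto
    moreover have "pairing (contract v C N) i A B = pairing N i A (B - {v} \<union> C)"
    proof -
      have "pairing (contract v C N) i B A = pairing N i (B - {v} \<union> C) A"
        using fin False v bracket.prems(3) by (intro pairing_contract) auto
      then show ?thesis by (simp only: pairing_skew[of _ i A])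
    qed
    moreover have "lie2_value (contract v C N) A u = lie2_value N A u"
      using bracket False by (intro lie2_value_contract_other)
    ultimately show ?thesis unfolding val lie2_subst_simps by (simp only: mult_ac)
  qed
qed

lemma tree_elem_monomial:
  "tree_on A t \<Longrightarrow> (A, tree_elem t) \<in> lie2_monomial"
  "forest_on D f \<Longrightarrow> m \<notin> D \<Longrightarrow> (insert m D, tree_elem (Node m f)) \<in> lie2_monomial"
  using graded_monomial_tree_elem graded_monomialD by blast+

text \<open>One formula for two uses. With \<open>g = of_nat\<close> and \<open>d = 1\<close> it is
  the value of second brackets on a root with unit entries: each tree pairs with the root through
  its size and with the later trees through \<open>N\<close>. With \<open>g = 1\<close> and
  \<open>d = 0\<close> it is the value of a commutative product.\<close>

primrec forest_value ::
    "(nat \<Rightarrow> 'k) \<Rightarrow> 'k \<Rightarrow> (2 \<Rightarrow> nat \<Rightarrow> nat \<Rightarrow> 'k::field_char_0) \<Rightarrow> tree list \<Rightarrow> 'k" where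
  "forest_value g d N [] = 1"
| "forest_value g d N (t # f) =
     (g (card (supp t)) + d * pairing N 2 (supp t) (\<Union>(set (map supp f)))) *
     lie2_value N (supp t) (tree_elem t) * forest_value g d N f"

lemma forest_value_Cons:
  "tree_on S t \<Longrightarrow> forest_on D f \<Longrightarrow> forest_value g d N (t # f) =
     (g (card S) + d * pairing N 2 S D) * lie2_value N S (tree_elem t) * forest_value g d N f"
  using on_supp(1)[of S t] on_supp(2)[of D f] by simp

lemma forest_value_cong:
  assumes "forest_on D f"
    and "\<And>i x y. x \<in> D \<Longrightarrow> y \<in> D \<Longrightarrow> x \<noteq> y \<Longrightarrow> N i x y = N' i x y"
  shows "forest_value g d N f = forest_value g d N' f"
  using assms
proof (induction f arbitrary: D rule: list.induct)
  case (Cons t f)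
  from Cons.prems(1) obtain S E where E: "D = S \<union> E" "tree_on S t" "forest_on E f" "S \<inter> E = {}"
    by cases auto
  have "pairing N 2 S E = pairing N' 2 S E" using E Cons.prems(2) by (intro pairing_cong) auto
  moreover have "lie2_value N S (tree_elem t) = lie2_value N' S (tree_elem t)"
    using E Cons.prems(2) by (intro lie2_value_cong tree_elem_monomial) auto
  moreover have "forest_value g d N f = forest_value g d N' f"
    using E Cons.prems(2) by (intro Cons.IH) auto
  ultimately show ?case using E by (simp add: forest_value_Cons del: forest_value.simps)
qed simp

lemma lie2_value_Node_Cons:
  assumes "tree_on S t" "forest_on D f" "S \<inter> D = {}" "m \<notin> S \<union> D"
  shows "lie2_value N (insert m (S \<union> D)) (tree_elem (Node m (t # f))) =
    pairing N 2 S (insert m D) * lie2_value N S (tree_elem t) * lie2_value N (insert m D)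
        (tree_elem (Node m f))"
  using lie2_value_bracket[OF tree_elem_monomial(1)[OF assms(1)] tree_elem_monomial(2)[OF
      assms(2), of m], of N 2] assms
  by (simp add: tree_elem_Node_Cons)

text \<open>The root is met by second brackets only. First entries at \<open>m\<close> thus stay
  free, and are used later to detect grafts.\<close>

lemma lie2_value_Node_cong:
  assumes "forest_on D f" "m \<notin> D"
    and "\<And>i x y. x \<in> D \<Longrightarrow> y \<in> D \<Longrightarrow> x \<noteq> y \<Longrightarrow> N i x y = N' i x y"
    and "\<And>x. x \<in> D \<Longrightarrow> N 2 x m = N' 2 x m \<and> N 2 m x = N' 2 m x"
  shows "lie2_value N (insert m D) (tree_elem (Node m f)) = lie2_value N' (insert m D) (tree_elem
      (Node m f))"
  using assms
proof (induction f arbitrary: D rule: list.induct)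
  case Nil
  then show ?case by (simp add: forest_on_Nil_iff tree_elem.simps)
next
  case (Cons t f)
  from Cons.prems(1) obtain S E where E: "D = S \<union> E" "tree_on S t" "forest_on E f" "S \<inter> E = {}"
    by cases auto
  have "pairing N 2 S (insert m E) = pairing N' 2 S (insert m E)"
    using E Cons.prems by (intro pairing_cong) auto
  moreover have "lie2_value N S (tree_elem t) = lie2_value N' S (tree_elem t)"
    using E Cons.prems by (intro lie2_value_cong tree_elem_monomial) auto
  moreover have "lie2_value N (insert m E) (tree_elem (Node m f)) = lie2_value N' (insert m E)
      (tree_elem (Node m f))"
    using E Cons.prems by (intro Cons.IH) auto
  ultimately show ?case using E Cons.prems by (simp add: lie2_value_Node_Cons)
qed

lemma lie2_value_Node:
  assumes "forest_on D f" "m \<notin> D" "\<And>x. x \<in> D \<Longrightarrow> N 2 x m - N 2 m x = 1"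
  shows "lie2_value N (insert m D) (tree_elem (Node m f)) = forest_value of_nat 1 N f"
  using assms
proof (induction f arbitrary: D rule: list.induct)
  case Nil
  then show ?case by (simp add: forest_on_Nil_iff tree_elem.simps)
next
  case (Cons t f)
  from Cons.prems(1) obtain S E where E: "D = S \<union> E" "tree_on S t" "forest_on E f" "S \<inter> E = {}"
    by cases auto
  have fin: "finite E" using on_supp E by blast
  have "pairing N 2 S (insert m E) = pairing N 2 S E + pairing N 2 S {m}"
    using pairing_Un[of E "{m}" N 2 S] fin E Cons.prems by simp
  also have "pairing N 2 S {m} = of_nat (card S)"
    using E Cons.prems by (simp add: pairing_def)
  finally have "pairing N 2 S (insert m E) = of_nat (card S) + 1 * pairing N 2 S E" by simp
  moreover have "lie2_value N (insert m E) (tree_elem (Node m f)) = forest_value of_nat 1 N f"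
    using E Cons.prems by (intro Cons.IH) auto
  ultimately show ?case using E Cons.prems
    by (simp add: lie2_value_Node_Cons forest_value_Cons del: forest_value.simps)
qed

text \<open>The factors belong to the grafting bracket, to the node that is grafted, and to the
  inner tree with all that hangs at \<open>v\<close> merged into \<open>v\<close>.\<close>

lemma lie2_value_Graft:
  assumes "tree_on S u" "v \<in> S" "forest_on D f" "S \<inter> D = {}" "m \<notin> S \<union> D"
  shows "lie2_value N (insert m (S \<union> D)) (tree_elem (Graft u v m f)) =
    pairing N 1 {v} (insert m D) * lie2_value N (insert m D) (tree_elem (Node m f)) *
    lie2_value (contract v (insert v (insert m D)) N) S (tree_elem u)"
proof -
  let ?b = "lie2_bracket 1 (lie2_gen v) (tree_elem (Node m f))" and ?C = "{v} \<union> insert m D"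
  have n: "(insert m D, tree_elem (Node m f)) \<in> lie2_monomial"
    using assms by (intro tree_elem_monomial) auto
  have dis: "{v} \<inter> insert m D = {}" using assms by auto
  have b: "(?C, ?b) \<in> lie2_monomial" using n dis by (intro lie2_monomial.intros)
  have C: "?C \<inter> S \<subseteq> {v}" using assms by auto
  have "insert m (S \<union> D) = S - {v} \<union> ?C" using assms by auto
  then have "lie2_value N (insert m (S \<union> D)) (tree_elem (Graft u v m f)) =
      lie2_value N ?C ?b * lie2_value (contract v ?C N) S (tree_elem u)"
    unfolding tree_elem_Graft
    using lie2_value_insert[OF tree_elem_monomial(1)[OF assms(1)] assms(2) b C, of N] by simp
  then show ?thesis
    using lie2_value_bracket[OF lie2_monomial.gen n dis, of N 1] by (simp add: insert_commute)
qed

lemma p2_value_forest: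
  assumes "forest_on D f" "D \<noteq> {}"
  shows "p2_value N (forest_elem f) D = forest_value (\<lambda>_. 1) 0 N f"
  using assms
proof (induction rule: forest_induct)
  case (single S t)
  then show ?case using on_supp(1)[OF single(1)] by (simp add: lie2_value_def)
next
  case (Cons S t E f)
  then show ?case
    by (simp add: forest_elem_Cons p2_value_oper lie2_to_p2_monomial tree_elem_monomial
        forest_elem_monomial
      forest_value_Cons lie2_value_def del: forest_value.simps)
qed

section \<open>Linear independence\<close>

definition block ::
    "nat set \<Rightarrow> (2 \<Rightarrow> nat \<Rightarrow> nat \<Rightarrow> 'k) \<Rightarrow> (2 \<Rightarrow> nat \<Rightarrow> nat \<Rightarrow> 'k) \<Rightarrow> 2 \<Rightarrow> nat \<Rightarrow> nat \<Rightarrow> 'k::zero" where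
  "block S N N' i x y =
     (if x \<in> S \<and> y \<in> S then N i x y else if x \<notin> S \<and> y \<notin> S then N' i x y else 0)"

lemma sum_single:
  assumes "finite I" "a \<in> I" "\<And>i. i \<in> I \<Longrightarrow> i \<noteq> a \<Longrightarrow> h i = 0"
  shows "sum h I = h a"
  using assms by (subst sum.remove[of I a]) (auto intro!: sum.neutral)

context
  fixes field_type :: "'k::field_char_0 itself"
begin

text \<open>Independence is stated for values rather than elements, so that matrices on disjoint
  blocks can be varied separately.\<close>

definition "trees_independent S \<longleftrightarrow>
  (\<forall>c :: tree \<Rightarrow> 'k. (\<forall>N. (\<Sum>t\<in>trees S. c t * lie2_value N S (tree_elem t)) = 0) \<longrightarrow> (\<forall>t\<in>trees S. c t
      = 0))"

definition "forests_independent g d D \<longleftrightarrow>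
  (\<forall>c :: tree list \<Rightarrow> 'k. (\<forall>N. (\<Sum>f\<in>forests D. c f * forest_value g d N f) = 0) \<longrightarrow> (\<forall>f\<in>forests D. c f
      = 0))"

lemma trees_independentD:
  fixes c :: "tree \<Rightarrow> 'k"
  assumes "trees_independent S" "\<And>N. (\<Sum>t\<in>trees S. c t * lie2_value N S (tree_elem t)) = 0"
      "tree_on S t"
  shows "c t = 0"
  using assms unfolding trees_independent_def by blast

lemma forests_independentD:
  fixes c :: "tree list \<Rightarrow> 'k"
  assumes "forests_independent g d D" "\<And>N. (\<Sum>f\<in>forests D. c f * forest_value g d N f) = 0"
      "forest_on D f"
  shows "c f = 0"
  using assms unfolding forests_independent_def by blast

text \<open>A matrix without entries between the support of the head and the rest makes the value
  factor over two blocks, with \<open>g (card S0)\<close> as the remaining factor of the head.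
  Independence of trees and of shorter forests is then applied in turn.\<close>

lemma forests_independent:
  assumes g: "\<And>k. k > 0 \<Longrightarrow> g k \<noteq> (0::'k)"
    and "finite D" "\<And>S. S \<subseteq> D \<Longrightarrow> trees_independent S"
  shows "forests_independent g d D"
  using assms(2,3)
proof (induction "card D" arbitrary: D rule: less_induct)
  case less
  show ?case
    unfolding forests_independent_def
  proof (intro allI impI ballI)
    fix c :: "tree list \<Rightarrow> 'k" and f0
    assume H: "\<forall>N. (\<Sum>f\<in>forests D. c f * forest_value g d N f) = 0" and f0: "f0 \<in> forests D"
    show "c f0 = 0"
    proof (cases "D = {}")
      case True
      with f0 have "f0 = []" by (simp add: forest_on_empty_iff)
      then show ?thesis using H True by simp
    next
      case False
      let ?I = "{S. S \<subseteq> D \<and> Max D \<in> S}"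
      have key: "c (t # f) = 0" if "S \<subseteq> D" "Max D \<in> S" "tree_on S t" "forest_on (D - S) f" for S t f
        using that
      proof (induction "card S" arbitrary: S t f rule: less_induct)
        case (less S0)
        define E where "E = D - S0"
        have fin: "finite S0" "finite E" "S0 \<noteq> {}" using less.prems \<open>finite D\<close> by (auto simp:
            E_def dest: finite_subset)
        have eq: "(\<Sum>t\<in>trees S0. (\<Sum>f\<in>forests E. c (t # f) * g (card S0) * forest_value g d Nb f) *
            lie2_value Na S0 (tree_elem t)) = 0" for Na Nb
        proof -
          define N where "N = block S0 Na Nb"
          have "(\<Sum>(t, f)\<in>trees S \<times> forests (D - S). c (t # f) * forest_value g d N (t # f)) = 0"
            if S: "S \<in> ?I" "S \<noteq> S0" for S
          proof (rule sum.neutral, clarify)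
            fix t f assume t: "tree_on S t" and f: "forest_on (D - S) f"
            show "c (t # f) * forest_value g d N (t # f) = 0"
            \<comment> \<open>All these supports contain \<open>Max D\<close>. Those inside
              \<open>S0\<close> are smaller and settled by induction; the others meet both
              blocks.\<close>
            proof (cases "S \<subseteq> S0")
              case True
              then have "card S < card S0" using S fin by (intro psubset_card_mono) auto
              then have "c (t # f) = 0" using less.hyps[of S t f] S t f by auto
              then show ?thesis by simp
            next
              case False
              have "lie2_value N S (tree_elem t) = 0"
                by (rule lie2_value_split[OF tree_elem_monomial(1)[OF t], of S0 "- S0"])
                  (use S False less.prems in \<open>auto simp: N_def block_def\<close>)
              then show ?thesis using t f by (simp add: forest_value_Cons del: forest_value.simps)
            qed
          qed
          then have "(\<Sum>f\<in>forests D. c f * forest_value g d N f) =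
              (\<Sum>(t, f)\<in>trees S0 \<times> forests E. c (t # f) * forest_value g d N (t # f))"
            unfolding sum_forests[OF \<open>finite D\<close> False] E_def
            by (intro sum_single) (use less.prems \<open>finite D\<close> in auto)
          also have "\<dots> = (\<Sum>(t, f)\<in>trees S0 \<times> forests E. (c (t # f) * g (card S0) * forest_value g
              d Nb f) * lie2_value Na S0 (tree_elem t))"
          proof (intro sum.cong HOL.refl, clarify)
            fix t f assume t: "tree_on S0 t" and f: "forest_on E f"
            have "pairing N 2 S0 E = 0" by (intro pairing_zero) (auto simp: N_def block_def E_def)
            moreover have "lie2_value N S0 (tree_elem t) = lie2_value Na S0 (tree_elem t)"
              using t by (intro lie2_value_cong tree_elem_monomial) (auto simp: N_def block_def)
            moreover have "forest_value g d N f = forest_value g d Nb f"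
              using f by (rule forest_value_cong) (auto simp: N_def block_def E_def)
            ultimately show "c (t # f) * forest_value g d N (t # f) = (c (t # f) * g (card S0) *
                forest_value g d Nb f) * lie2_value Na S0 (tree_elem t)"
              using t f by (simp add: forest_value_Cons del: forest_value.simps)
          qed
          finally show ?thesis using H by (simp add: sum.cartesian_product[symmetric]
              sum_distrib_right)
        qed
        have "c (t # f) * g (card S0) = 0"
        proof (rule forests_independentD[where c = "\<lambda>f. c (t # f) * g (card S0)"])
          have "card E < card D" using fin less.prems \<open>finite D\<close> by (intro psubset_card_mono)
              (auto simp: E_def)
          then show "forests_independent g d E"
            using \<open>finite E\<close> \<open>\<And>S. S \<subseteq> D \<Longrightarrow> trees_independent S\<close>
            by (intro \<open>\<And>Da. card Da < card D \<Longrightarrow> finite Da \<Longrightarrow> (\<And>S. S \<subseteq> Da \<Longrightarrow> trees_independent S) \<Longrightarrow>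
                forests_independent g d Da\<close>) (auto simp: E_def)
          \<comment> \<open>The matrix of the head block varies while that of the rest stays fixed;
            the latter varies in the surrounding rule.\<close>
          show "(\<Sum>f\<in>forests E. c (t # f) * g (card S0) * forest_value g d N f) = 0" for N
            by (rule trees_independentD[of S0 "\<lambda>t. \<Sum>f\<in>forests E. c (t # f) * g (card S0) *
                forest_value g d N f", OF _ eq])
              (use less.prems \<open>\<And>S. S \<subseteq> D \<Longrightarrow> trees_independent S\<close> in auto)
          show "forest_on E f" using less.prems by (simp add: E_def)
        qed
        moreover have "g (card S0) \<noteq> 0" using fin by (intro g) (simp add: card_gt_0_iff)
        ultimately show ?case by simp
      qed
      obtain t f where "f0 = t # f" using f0 False by (cases f0) (auto simp: forest_on_Nil_iff)
      then show ?thesis using f0 key by (auto simp: forest_on_Cons_iff)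
    qed
  qed
qed

text \<open>Grafts are eliminated first, those with the largest inner trees at the beginning, since
  there the fewest generators hang at \<open>v\<close>. Only nodes are then left, and they reduce to
  forests.\<close>

lemma trees_independent:
  assumes "finite A"
  shows "trees_independent A"
  using assms
proof (induction "card A" arbitrary: A rule: less_induct)
  case (less A)
  show ?case
  proof (cases "A = {}")
    case True
    then show ?thesis by (simp add: trees_independent_def)
  next
    case False
    define m where "m = Max A"
    define D where "D = A - {m}"
    have m: "m \<in> A" "finite A" "finite D" "m \<notin> D" "A = insert m D"
      using Max_in[OF less.prems False] less.prems by (auto simp only: m_def D_def insert_Diff
          finite_Diff)
    have IH: "trees_independent S" if "S \<subseteq> D" for S
    proof (rule less.hyps)
      show "card S < card A" using that m by (intro psubset_card_mono) auto
      show "finite S" using that m finite_subset by blast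
    qed
    have FI: "forests_independent of_nat 1 E" if "E \<subseteq> D" for E
      using that m by (intro forests_independent IH) (auto dest: finite_subset)
    show ?thesis
      unfolding trees_independent_def
    proof (intro allI impI ballI)
      fix c :: "tree \<Rightarrow> 'k" and t0
      assume H: "\<forall>N. (\<Sum>t\<in>trees A. c t * lie2_value N A (tree_elem t)) = 0" and t0: "t0 \<in> trees A"
      have split: "(\<Sum>f\<in>forests D. c (Node m f) * lie2_value N A (tree_elem (Node m f))) +
          (\<Sum>S\<in>Pow D. \<Sum>(u, v, f)\<in>trees S \<times> S \<times> forests (D - S).
             c (Graft u v m f) * lie2_value N A (tree_elem (Graft u v m f))) = 0" for N
        using H sum_trees[OF m(2) False, of "\<lambda>t. c t * lie2_value N A (tree_elem t)"]
        by (simp add: m_def[symmetric] D_def[symmetric])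
      have graft: "c (Graft u v m f) = 0" if "S \<subseteq> D" "tree_on S u" "v \<in> S" "forest_on (D - S) f"
          for S u v f
        using that
      proof (induction "card (D - S)" arbitrary: S u v f rule: less_induct)
        case (less S0 u0 v0 f0)
        define E0 where "E0 = D - S0"
        have fin: "finite S0" "finite E0" using m(3) less.prems(1) finite_subset by (auto simp:
            E0_def)
        txt \<open>The only entries joining \<open>S0\<close> to the other generators are the first ones of \<open>v0\<close> and
            \<open>m\<close>.
          This annihilates every tree not known to have coefficient \<open>0\<close> unless \<open>m\<close> is grafted at
              \<open>v0\<close>
          onto a tree on \<open>S0\<close>.\<close>
        have eq: "(\<Sum>u\<in>trees S0. (\<Sum>f\<in>forests E0. c (Graft u v0 m f) * forest_value of_nat 1 Nb f) *
            lie2_value Na S0 (tree_elem u)) = 0" for Na Nb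
        proof -
          \<comment> \<open>In \<open>N0\<close> nothing joins \<open>S0\<close> to
            \<open>insert m E0\<close>; the unit second entries towards \<open>m\<close> are those
            required by \<open>lie2_value_Node\<close>. \<open>N\<close> adds one first entry at
            \<open>m\<close>, which nodes do not see.\<close>
          define N0 where "N0 i x y = (if i = 2 \<and> x \<in> E0 \<and> y = m then 1 else if x = m \<or> y = m then
              0 else block S0 Na Nb i x y)" for i x y
          define N where "N i x y = (if i = 1 \<and> x = v0 \<and> y = m then 1 else N0 i x y)" for i x y
          have node: "lie2_value N (insert m F) (tree_elem (Node m f)) = lie2_value N0 (insert m
              F) (tree_elem (Node m f))"
            if "forest_on F f" "F \<subseteq> D" for F f
            using that m(4) by (intro lie2_value_Node_cong) (auto simp: N_def)
          have node_zero: "lie2_value N (insert m F) (tree_elem (Node m f)) = 0"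
            if f: "forest_on F f" "F \<subseteq> D" "F \<inter> S0 \<noteq> {}" for F f
            unfolding node[OF f(1,2)]
          proof (rule lie2_value_split)
            show "(insert m F, tree_elem (Node m f)) \<in> lie2_monomial"
              using f m(4) by (intro tree_elem_monomial) auto
            show "insert m F \<subseteq> S0 \<union> insert m E0" "insert m F \<inter> S0 \<noteq> {}" "insert m F \<inter> insert m E0
                \<noteq> {}"
              "S0 \<inter> insert m E0 = {}"
              using f m(4) less.prems(1) by (auto simp: E0_def)
            show "N0 i x y = 0 \<and> N0 i y x = 0" if "x \<in> S0" "y \<in> insert m E0" for i x y
              using that m(4) less.prems(1) by (auto simp: N0_def block_def E0_def)
          qed
          have S0: "S0 \<noteq> {}" "S0 \<inter> D = S0" using less.prems by auto
          have "(\<Sum>(u, v, f)\<in>trees S \<times> S \<times> forests (D - S). c (Graft u v m f) * lie2_value N A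
              (tree_elem (Graft u v m f))) = 0"
            if S: "S \<in> Pow D" "S \<noteq> S0" for S
          proof (rule sum.neutral, clarify)
            fix u v f assume u: "tree_on S u" "v \<in> S" "forest_on (D - S) f"
            show "c (Graft u v m f) * lie2_value N A (tree_elem (Graft u v m f)) = 0"
            \<comment> \<open>Either a proper subset of \<open>E0\<close> hangs at the graft, which
              the induction settles, or the grafted node contains \<open>m\<close> and meets
              \<open>S0\<close>, so that its value is zero.\<close>
            proof (cases "(D - S) \<inter> S0 = {}")
              case True
              then have "D - S \<subset> E0" using S less.prems(1) by (auto simp: E0_def)
              then have "card (D - S) < card (D - S0)" using fin unfolding E0_def by (intro
                  psubset_card_mono)
              then have "c (Graft u v m f) = 0" using less.hyps u S by auto
              then show ?thesis by simp
            next
              case False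
              then have "lie2_value N (insert m (D - S)) (tree_elem (Node m f)) = 0"
                using u by (intro node_zero) auto
              moreover have "A = insert m (S \<union> (D - S))" using m S by auto
              ultimately show ?thesis using u m(4) S lie2_value_Graft[of S u v "D - S" f m N] by
                  auto
            qed
          qed
          then have "(\<Sum>S\<in>Pow D. \<Sum>(u, v, f)\<in>trees S \<times> S \<times> forests (D - S).
             c (Graft u v m f) * lie2_value N A (tree_elem (Graft u v m f))) =
             (\<Sum>(u, v, f)\<in>trees S0 \<times> S0 \<times> forests E0. c (Graft u v m f) * lie2_value N A (tree_elem
                 (Graft u v m f)))"
            unfolding E0_def by (intro sum_single) (use less.prems m in auto)
          moreover have "(\<Sum>f\<in>forests D. c (Node m f) * lie2_value N A (tree_elem (Node m f))) = 0"
            using node_zero S0 m(5) by (intro sum.neutral) (auto simp: Int_commute)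
          ultimately have "(\<Sum>(u, v, f)\<in>trees S0 \<times> S0 \<times> forests E0. c (Graft u v m f) * lie2_value
              N A (tree_elem (Graft u v m f))) = 0"
            using split[of N] by simp
          also have "(\<Sum>(u, v, f)\<in>trees S0 \<times> S0 \<times> forests E0. c (Graft u v m f) * lie2_value N A
              (tree_elem (Graft u v m f))) =
            (\<Sum>(u, v, f)\<in>trees S0 \<times> S0 \<times> forests E0. if v = v0 then (c (Graft u v0 m f) *
                forest_value of_nat 1 Nb f) * lie2_value Na S0 (tree_elem u) else 0)"
          proof (intro sum.cong HOL.refl, clarify)
            fix u v f assume u: "tree_on S0 u" "v \<in> S0" "forest_on E0 f"
            have dis: "S0 \<inter> E0 = {}" "m \<notin> S0 \<union> E0" "A = insert m (S0 \<union> E0)"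
              using m less.prems(1) by (auto simp: E0_def)
            have val: "lie2_value N A (tree_elem (Graft u v m f)) = pairing N 1 {v} (insert m E0) *
              lie2_value N (insert m E0) (tree_elem (Node m f)) * lie2_value (contract v (insert v
                  (insert m E0)) N) S0 (tree_elem u)"
              unfolding dis(3) using u dis by (intro lie2_value_Graft)
            have "pairing N 1 {v} (insert m E0) = (\<Sum>y\<in>insert m E0. if v = v0 \<and> y = m then 1 else 0)"
            proof -
              have "N 1 v y - N 1 y v = (if v = v0 \<and> y = m then 1 else 0)" if y: "y \<in> insert m E0"
                  for y
              proof (cases "y = m")
                case True
                have "v \<noteq> m" "m \<noteq> v0" using u(2) dis(2) less.prems(3) by auto
                then show ?thesis using True by (simp add: N_def N0_def)
              next
                case False
                then have "y \<in> E0" "y \<notin> S0" "v \<noteq> m" using y u(2) dis by auto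
                then show ?thesis using False u(2) by (simp add: N_def N0_def block_def)
              qed
              then show ?thesis by (simp add: pairing_def)
            qed
            also have "\<dots> = (if v = v0 then 1 else 0)" using fin by (simp add: sum.delta')
            finally have p: "pairing N 1 {v} (insert m E0) = (if v = v0 then 1 else 0)" .
            have "lie2_value N (insert m E0) (tree_elem (Node m f)) = forest_value of_nat 1 N f"
              using u dis less.prems by (intro lie2_value_Node) (auto simp: N_def N0_def)
            also have "\<dots> = forest_value of_nat 1 Nb f"
              using u(3) by (rule forest_value_cong) (use dis in \<open>auto simp: N_def N0_def
                  block_def\<close>)
            finally have n: "lie2_value N (insert m E0) (tree_elem (Node m f)) = forest_value
                of_nat 1 Nb f" .
            \<comment> \<open>Off the diagonal the contraction adds only zeros: apart from
              \<open>v0\<close>, no element of \<open>S0\<close> has a nonzero entry with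
              \<open>insert m E0\<close>.\<close>
            have con: "lie2_value (contract v (insert v (insert m E0)) N) S0 (tree_elem u) =
                lie2_value Na S0 (tree_elem u)" if "v = v0"
            proof (rule lie2_value_cong[OF tree_elem_monomial(1)[OF u(1)]])
              fix i x y assume xy: "x \<in> S0" "y \<in> S0" "x \<noteq> y"
              have z: "N i a y = 0" "N i y a = 0" if "a \<in> insert m E0" "y \<in> S0" "y \<noteq> v0" for a y
                using that dis by (auto simp: N_def N0_def block_def)
              have NS: "N i x y = Na i x y" if "x \<in> S0" "y \<in> S0" for x y
                using that dis by (auto simp: N_def N0_def block_def)
              have C: "v \<notin> insert m E0" "finite (insert m E0)" using u dis fin by auto
              show "contract v (insert v (insert m E0)) N i x y = Na i x y"
                using xy z NS C \<open>v = v0\<close> u(2) unfolding contract_def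
                by (cases "x = v"; cases "y = v") (simp_all add: sum.neutral)
            qed
            show "c (Graft u v m f) * lie2_value N A (tree_elem (Graft u v m f)) =
              (if v = v0 then (c (Graft u v0 m f) * forest_value of_nat 1 Nb f) * lie2_value Na S0
                  (tree_elem u) else 0)"
              unfolding val p n using con by simp
          qed
          also have "\<dots> = (\<Sum>u\<in>trees S0. \<Sum>v\<in>S0. \<Sum>f\<in>forests E0. if v = v0 then (c (Graft u v0 m f) *
              forest_value of_nat 1 Nb f) * lie2_value Na S0 (tree_elem u) else 0)"
            by (simp add: sum.cartesian_product)
          also have "\<dots> = (\<Sum>u\<in>trees S0. \<Sum>f\<in>forests E0. (c (Graft u v0 m f) * forest_value of_nat 1
              Nb f) * lie2_value Na S0 (tree_elem u))"
          proof (intro sum.cong HOL.refl)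
            fix u
            show "(\<Sum>v\<in>S0. \<Sum>f\<in>forests E0. if v = v0 then (c (Graft u v0 m f) * forest_value of_nat
                1 Nb f) * lie2_value Na S0 (tree_elem u) else 0) =
              (\<Sum>f\<in>forests E0. (c (Graft u v0 m f) * forest_value of_nat 1 Nb f) * lie2_value Na S0
                  (tree_elem u))"
              by (subst sum_single[of S0 v0]) (use fin less.prems in auto)
          qed
          finally show ?thesis by (simp add: sum_distrib_right)
        qed
        show ?case
        proof (rule forests_independentD[where c = "\<lambda>f. c (Graft u0 v0 m f)"])
          show "forests_independent of_nat 1 E0" by (rule FI) (auto simp: E0_def)
          show "(\<Sum>f\<in>forests E0. c (Graft u0 v0 m f) * forest_value of_nat 1 N f) = 0" for N
            by (rule trees_independentD[of S0 "\<lambda>u. \<Sum>f\<in>forests E0. c (Graft u v0 m f) *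
                forest_value of_nat 1 N f", OF _ eq])
              (use less.prems IH in auto)
          show "forest_on E0 f0" using less.prems by (simp add: E0_def)
        qed
      qed
      have node: "c (Node m f) = 0" if "forest_on D f" for f
      proof (rule forests_independentD[OF FI _ that, where c = "\<lambda>f. c (Node m f)"])
        fix Nb
        \<comment> \<open>Unit second entries towards the root turn the values of nodes into
          \<open>forest_value\<close>, while the entries within \<open>D\<close> remain
          free.\<close>
        define N where "N i x y = (if i = 2 \<and> x \<in> D \<and> y = m then 1 else if x = m \<or> y = m then 0
            else Nb i x y :: 'k)" for i :: 2 and x y
        have "lie2_value N A (tree_elem (Node m f)) = forest_value of_nat 1 Nb f" if f: "forest_on
            D f" for f
        proof -
          have "lie2_value N A (tree_elem (Node m f)) = forest_value of_nat 1 N f"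
            unfolding m(5) using f m(4) by (intro lie2_value_Node) (auto simp: N_def)
          also have "\<dots> = forest_value of_nat 1 Nb f"
            using f by (rule forest_value_cong) (use m(4) in \<open>auto simp: N_def\<close>)
          finally show ?thesis .
        qed
        moreover have "(\<Sum>S\<in>Pow D. \<Sum>(u, v, f)\<in>trees S \<times> S \<times> forests (D - S).
             c (Graft u v m f) * lie2_value N A (tree_elem (Graft u v m f))) = 0"
          by (intro sum.neutral ballI) (auto simp: graft)
        ultimately show "(\<Sum>f\<in>forests D. c (Node m f) * forest_value of_nat 1 Nb f) = 0"
          using split[of N] by simp
      qed simp
      show "c t0 = 0"
        using t0 node graft unfolding trees_eq[OF m(2) False] m_def[symmetric] D_def[symmetric] by
            auto
    qed
  qed
qed

end

section \<open>Dimensions of weight spaces\<close>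

text \<open>In characteristic zero 2 is not a root of unity, so the torus element with
  \<open>t = 2\<close> alone separates all weights.\<close>

lemma power_int_2_inject:
  assumes "(2 :: 'k::field_char_0) powi a = 2 powi b"
  shows "a = b"
proof -
  have *: "c = d" if "(2 :: 'k) powi c = 2 powi d" "c \<le> d" for c d
  proof -
    have "(2 :: 'k) powi (d - c) = 1" using that by (simp add: power_int_diff)
    then have "of_nat (2 ^ nat (d - c)) = (of_nat 1 :: 'k)" using that(2) by (simp add:
        power_int_def)
    then have "(2::nat) ^ nat (d - c) = 1" by (simp only: of_nat_eq_iff)
    then show ?thesis using that(2) by simp
  qed
  show ?thesis using *[of a b] *[of b a] assms by (cases "a \<le> b") auto
qed

text \<open>Independence is required of the family, which makes \<open>e\<close> injective on
  \<open>I\<close>; only then do cardinalities of index sets give dimensions.\<close>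

lemma (in vector_space) dim_span_family:
  assumes "finite I" and indep: "\<And>c. (\<Sum>i\<in>I. scale (c i) (e i)) = 0 \<Longrightarrow> \<forall>i\<in>I. c i = 0" and "J \<subseteq> I"
  shows "dim (span (e ` J)) = card J"
proof -
  have inj: "inj_on e I"
  proof (rule inj_onI, rule ccontr)
    fix i j assume ij: "i \<in> I" "j \<in> I" "e i = e j" "i \<noteq> j"
    let ?c = "\<lambda>k. if k = i then 1 else if k = j then -1 else 0"
    have "(\<Sum>k\<in>I. scale (?c k) (e k)) = (\<Sum>k\<in>{i, j}. scale (?c k) (e k))"
      using ij assms(1) by (intro sum.mono_neutral_right) auto
    also have "\<dots> = 0" using ij by simp
    finally show False using indep[of ?c] ij by auto
  qed
  have "independent (e ` I)"
  proof
    assume "dependent (e ` I)"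
    then obtain u where u: "\<exists>v\<in>e ` I. u v \<noteq> 0" "(\<Sum>v\<in>e ` I. scale (u v) v) = 0"
      using assms(1) by (auto simp: dependent_finite)
    have "(\<Sum>i\<in>I. scale (u (e i)) (e i)) = 0"
      using u(2) by (simp add: sum.reindex[OF inj])
    then show False using indep[of "\<lambda>i. u (e i)"] u(1) by auto
  qed
  then have "independent (e ` J)" using independent_mono assms(3) by blast
  then have "dim (span (e ` J)) = card (e ` J)" by (rule dim_span_eq_card_independent)
  also have "\<dots> = card J" using inj assms(3) by (intro card_image) (rule inj_on_subset)
  finally show ?thesis .
qed

lemma (in vector_space) span_family:
  assumes "finite I" "u \<in> span (e ` I)"
  obtains c where "u = (\<Sum>i\<in>I. scale (c i) (e i))"
proof -
  have "\<exists>c. u = (\<Sum>i\<in>I. scale (c i) (e i))"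
    using assms(2)
  proof (induction rule: span_induct_alt)
    case base
    show ?case by (rule exI[of _ "\<lambda>_. 0"]) simp
  next
    case (step k x y)
    then obtain i c where i: "i \<in> I" "x = e i" "y = (\<Sum>i\<in>I. scale (c i) (e i))" by auto
    have "scale k x + y = (\<Sum>j\<in>I. scale ((if j = i then k else 0) + c j) (e j))"
      unfolding scale_left_distrib sum.distrib using i assms(1)
      by (simp add: if_distrib[of "\<lambda>z. scale z _"] sum.delta cong: if_cong)
    then show ?case by (rule exI[where x = "\<lambda>j. (if j = i then k else 0) + c j"])
  qed
  then show ?thesis using that by blast
qed

text \<open>Expanding in eigenvectors and comparing at \<open>t = 2\<close> gives a relation with
  coefficients \<open>c i * (2 powi wt i - 2 powi j)\<close>; by independence only indices of weight
  \<open>j\<close> survive.\<close>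

lemma weight_space_eq:
  fixes scl :: "'k::field_char_0 \<Rightarrow> 'v::ab_group_add \<Rightarrow> 'v" and act :: "'k \<Rightarrow> 'v \<Rightarrow> 'v" and wt :: "'i
      \<Rightarrow> int"
  assumes "vector_space scl" and fin: "finite I"
    and indep: "\<And>c. (\<Sum>i\<in>I. scl (c i) (e i)) = 0 \<Longrightarrow> \<forall>i\<in>I. c i = 0"
    and act: "\<And>t. act t 0 = 0" "\<And>t u v. act t (u + v) = act t u + act t v" "\<And>t c u. act t (scl c
        u) = scl c (act t u)"
    and eig: "\<And>t i. t \<noteq> 0 \<Longrightarrow> i \<in> I \<Longrightarrow> act t (e i) = scl (t powi wt i) (e i)"
  shows "{u \<in> module.span scl (e ` I). \<forall>t. t \<noteq> 0 \<longrightarrow> act t u = scl (t powi j) u} =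
    module.span scl (e ` {i \<in> I. wt i = j})"
proof -
  interpret vector_space scl by fact
  have act_sum: "act t (\<Sum>i\<in>K. h i) = (\<Sum>i\<in>K. act t (h i))" for t K and h :: "'i \<Rightarrow> 'v"
    by (induction K rule: infinite_finite_induct) (simp_all add: act)
  show ?thesis
  proof (intro set_eqI iffI)
    fix u assume u: "u \<in> {u \<in> span (e ` I). \<forall>t. t \<noteq> 0 \<longrightarrow> act t u = scl (t powi j) u}"
    then obtain c where c: "u = (\<Sum>i\<in>I. scl (c i) (e i))" using span_family[OF fin] by blast
    have "(\<Sum>i\<in>I. scl (c i * (2 powi wt i - 2 powi j)) (e i)) = act 2 u - scl (2 powi j) u"
      unfolding c act_sum scale_sum_right sum_subtractf[symmetric]
      by (intro sum.cong HOL.refl) (simp add: act eig algebra_simps)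
    also have "\<dots> = 0" using u by simp
    finally have "\<forall>i\<in>I. c i * (2 powi wt i - 2 powi j) = 0" by (rule indep)
    then have "c i = 0" if "i \<in> I" "wt i \<noteq> j" for i using that power_int_2_inject by force
    then have "u = (\<Sum>i\<in>{i \<in> I. wt i = j}. scl (c i) (e i))"
      unfolding c by (intro sum.mono_neutral_right) (use fin in auto)
    also have "\<dots> \<in> span (e ` {i \<in> I. wt i = j})" by (intro span_sum span_scale span_base) auto
    finally show "u \<in> span (e ` {i \<in> I. wt i = j})" .
  next
    fix u assume u: "u \<in> span (e ` {i \<in> I. wt i = j})"
    have "act t u = scl (t powi j) u" if "t \<noteq> 0" for t
      using u by (induction rule: span_induct_alt) (auto simp: act eig that algebra_simps)
    moreover have "u \<in> span (e ` I)" using u span_mono[of "e ` {i \<in> I. wt i = j}" "e ` I"] by blast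
    ultimately show "u \<in> {u \<in> span (e ` I). \<forall>t. t \<noteq> 0 \<longrightarrow> act t u = scl (t powi j) u}" by simp
  qed
qed

lemma character_card:
  assumes "finite I"
  shows "character (\<lambda>j. card {i \<in> I. wt i = j}) = (\<Sum>i\<in>I. fls_X powi wt i)"
proof -
  have "{j. card {i \<in> I. wt i = j} \<noteq> 0} = wt ` I" using assms by (auto simp: card_eq_0_iff)
  then have "character (\<lambda>j. card {i \<in> I. wt i = j}) = (\<Sum>j\<in>wt ` I. of_nat (card {i \<in> I. wt i = j})
      * fls_X powi j)"
    by (simp add: character_def)
  also have "\<dots> = (\<Sum>j\<in>wt ` I. \<Sum>i\<in>{i \<in> I. wt i = j}. fls_X powi wt i)"
    by (intro sum.cong HOL.refl) simp
  also have "\<dots> = (\<Sum>i\<in>I. fls_X powi wt i)" by (rule sum.image_gen[OF assms, symmetric])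
  finally show ?thesis .
qed

section \<open>Characters and dimensions from the tree enumeration\<close>

lemma prod_list_power_int:
  fixes x :: "'a::field"
  assumes "x \<noteq> 0" "\<And>t. t \<in> set f \<Longrightarrow> w t = x powi d t"
  shows "prod_list (map (\<lambda>y. inverse x * y) (map w f)) = x powi sum_list (map (\<lambda>k. k - 1) (map d
      f))"
    and "prod_list (map (\<lambda>y. 1 * y) (map w f)) = x powi sum_list (map d f)"
  using assms by (induction f) (simp_all add: power_int_add power_int_diff field_simps)

lemma tree_weight_powi:
  fixes x :: "'a::field"
  assumes "x \<noteq> 0"
  shows "tree_weight (inverse x) x t = x powi tree_degree t"
proof (induction t)
  case (Node m f)
  then show ?case unfolding tree_weight.simps tree_degree.simps by (intro prod_list_power_int assms)
next
  case (Graft u v m f)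
  then show ?case unfolding tree_weight.simps tree_degree.simps
    by (subst prod_list_power_int(1)[OF assms]) (simp_all add: power_int_add assms)
qed

lemma forest_weight_powi:
  fixes x :: "'a::field"
  assumes "x \<noteq> 0"
  shows "forest_weight (inverse x) x 1 f = x powi forest_degree f"
  unfolding forest_weight_def forest_degree_def
  by (rule prod_list_power_int(2)[OF assms]) (rule tree_weight_powi[OF assms])

text \<open>The element \<open>x\<close> is kept general: \<open>x = 1\<close> counts trees for the
  dimension, and \<open>x = fls_X\<close> gives the character.\<close>

lemma sum_tree_degree:
  fixes x :: "'a::field_char_0"
  assumes "x \<noteq> 0" "n \<ge> 1"
  shows "(\<Sum>t\<in>trees {1..n}. x powi tree_degree t) = (\<Prod>k=1..n-1. of_nat k * x + of_nat (n - k) *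
      inverse x)"
proof -
  have "(\<Sum>t\<in>trees {1..n}. x powi tree_degree t) = tree_num (inverse x) x n"
    using sums_card[of "{1..n}" "inverse x" x] by (simp add: tree_sum_def tree_weight_powi assms)
  then show ?thesis using tree_num_eq[of "inverse x" x "n - 1"] assms by simp
qed

text \<open>Divided by \<open>x\<close>, the third hypothesis is the nonvanishing required by the
  product formula for \<open>a = 1\<close> and \<open>p = inverse x\<close>.\<close>

lemma sum_forest_degree:
  fixes x :: "'a::field_char_0"
  assumes "x \<noteq> 0" "n \<ge> 1" "\<And>j. x + of_nat (Suc j) \<noteq> 0"
  shows "(\<Sum>f\<in>forests {1..n}. x powi forest_degree f) = (\<Prod>k=1..n-1. of_nat k * x + 1 + of_nat (n -
      k) * inverse x)"
proof -
  have "forest_sum (inverse x) x 1 {1..n} = forest_num (inverse x) x 1 n"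
    using sums_card[of "{1..n}" "inverse x" x] by simp
  then have "(\<Sum>f\<in>forests {1..n}. x powi forest_degree f) = forest_num (inverse x) x 1 n"
    by (simp add: forest_sum_def forest_weight_powi assms)
  moreover have "1 + of_nat (Suc j) * inverse x \<noteq> 0" for j
  proof
    assume "1 + of_nat (Suc j) * inverse x = 0"
    then have "x * (1 + of_nat (Suc j) * inverse x) = 0" by simp
    moreover have "x * (1 + of_nat (Suc j) * inverse x) = x + of_nat (Suc j)"
      using assms(1) by (simp add: distrib_left mult.left_commute del: of_nat_Suc)
    ultimately show False using assms(3)[of j] by metis
  qed
  ultimately show ?thesis using forest_num_eq[of 1 "inverse x" x "n - 1"] assms(2) by (simp add:
      add_ac)
qed

lemma fls_X_plus_of_nat_nonzero: "fls_X + of_nat n \<noteq> (0 :: rat fls)"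
proof
  assume "fls_X + of_nat n = (0 :: rat fls)"
  then have "fls_nth (fls_X + of_nat n :: rat fls) 1 = 0" by simp
  then show False by (simp add: fls_of_nat)
qed

lemma card_trees:
  assumes "n \<ge> 1" shows "card (trees {1..n}) = n ^ (n - 1)"
proof -
  have "of_nat (card (trees {1..n})) = (\<Prod>k=1..n-1. of_nat k + of_nat (n - k) :: rat)"
    using sum_tree_degree[of "1::rat" n] assms by simp
  also have "\<dots> = (\<Prod>k=1..n-1. of_nat n)"
    using assms by (intro prod.cong HOL.refl) (auto simp flip: of_nat_add)
  finally have "of_nat (card (trees {1..n})) = (of_nat (n ^ (n - 1)) :: rat)" by simp
  then show ?thesis by (simp only: of_nat_eq_iff)
qed

lemma card_forests:
  assumes "n \<ge> 1" shows "card (forests {1..n}) = (n + 1) ^ (n - 1)"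
proof -
  have "of_nat (card (forests {1..n})) = (\<Prod>k=1..n-1. of_nat k + 1 + of_nat (n - k) :: rat)"
    using sum_forest_degree[of "1::rat" n] assms by (simp add: add_eq_0_iff)
  also have "\<dots> = (\<Prod>k=1..n-1. of_nat (n + 1))"
    using assms by (intro prod.cong HOL.refl) (auto simp: of_nat_diff)
  finally have "of_nat (card (forests {1..n})) = (of_nat ((n + 1) ^ (n - 1)) :: rat)" by simp
  then show ?thesis by (simp only: of_nat_eq_iff)
qed

lemma lie2_value_sum: "lie2_value N A (\<Sum>i\<in>I. lie2_scale (c i) (h i)) = (\<Sum>i\<in>I. c i * lie2_value N A
    (h i))"
  by (induction I rule: infinite_finite_induct) (simp_all add: lie2_value_linear)

lemma p2_value_sum: "p2_value N (\<Sum>i\<in>I. p2_scale (c i) (h i)) A = (\<Sum>i\<in>I. c i * p2_value N (h i) A)"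
  by (induction I rule: infinite_finite_induct) (simp_all add: p2_value_simps)

lemma tree_elem_independent:
  fixes c :: "tree \<Rightarrow> 'k::field_char_0"
  assumes "finite A" "(\<Sum>t\<in>trees A. lie2_scale (c t) (tree_elem t)) = 0"
  shows "\<forall>t\<in>trees A. c t = 0"
proof -
  have "(\<Sum>t\<in>trees A. c t * lie2_value N A (tree_elem t)) = 0" for N
    unfolding lie2_value_sum[symmetric] assms(2) by (rule lie2_value_linear)
  then show ?thesis using trees_independentD[OF trees_independent[OF assms(1)]] by blast
qed

lemma forest_elem_independent:
  fixes c :: "tree list \<Rightarrow> 'k::field_char_0"
  assumes "finite A" "A \<noteq> {}" "(\<Sum>f\<in>forests A. p2_scale (c f) (forest_elem f)) = 0"
  shows "\<forall>f\<in>forests A. c f = 0"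
proof -
  have "forests_independent (\<lambda>_. 1 :: 'k) 0 A"
    using assms(1) by (intro forests_independent trees_independent) (auto dest: finite_subset)
  moreover have "(\<Sum>f\<in>forests A. c f * forest_value (\<lambda>_. 1) 0 N f) = 0" for N
  proof -
    have "(\<Sum>f\<in>forests A. c f * forest_value (\<lambda>_. 1) 0 N f) = (\<Sum>f\<in>forests A. c f * p2_value N
        (forest_elem f) A)"
      using assms(2) by (intro sum.cong HOL.refl) (simp add: p2_value_forest)
    also have "\<dots> = 0" unfolding p2_value_sum[symmetric] assms(3) by (simp add: p2_value_simps)
    finally show ?thesis .
  qed
  ultimately show ?thesis using forests_independentD by blast
qed

lemma lie2_component_eq: "lie2_component n = lie2_span (tree_elem ` trees {1..n})"
  using lie2_multilinear_eq[of "{1..n}"]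
  by (simp add: lie2_component_def lie2_multilinear_def tree_span_def)

lemma p2_component_eq: "n \<ge> 1 \<Longrightarrow> p2_component n = p2_span (forest_elem ` forests {1..n})"
  using p2_multilinear_eq[of "{1..n}"]
  by (simp add: p2_component_def forest_span_def)

lemma lie2_dims:
  shows "lie2_dim (lie2_component n :: 'k::field_char_0 lie2 set) = card (trees {1..n})"
    and "lie2_dim (lie2_weight_space n j :: 'k lie2 set) = card {t \<in> trees {1..n}. tree_degree t =
        j}"
proof -
  let ?e = "tree_elem :: tree \<Rightarrow> 'k lie2"
  have fin: "finite (trees {1..n})" using finite_trees_forests by simp
  have indep: "\<forall>t\<in>trees {1..n}. c t = 0" if "(\<Sum>t\<in>trees {1..n}. lie2_scale (c t) (?e t)) = 0" for c
    using that by (intro tree_elem_independent) simp_all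
  note dim = lie2.dim_span_family[OF fin indep]
  show "lie2_dim (lie2_component n :: 'k lie2 set) = card (trees {1..n})"
    unfolding lie2_component_eq by (rule dim) auto
  have "lie2_weight_space n j = lie2_span (?e ` {t \<in> trees {1..n}. tree_degree t = j})"
    unfolding lie2_weight_space_def lie2_component_eq lie2_span_def
    by (rule weight_space_eq[OF lie2.vector_space_axioms fin indep])
      (auto simp: lie2_act_simps intro: graded_monomial_act graded_monomial_tree_elem)
  then show "lie2_dim (lie2_weight_space n j :: 'k lie2 set) = card {t \<in> trees {1..n}. tree_degree
      t = j}"
    using dim[where J = "{t \<in> trees {1..n}. tree_degree t = j}"] by auto
qed

lemma p2_dims:
  assumes "n \<ge> 1"
  shows "p2_dim (p2_component n :: 'k::field_char_0 p2 set) = card (forests {1..n})"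
    and "p2_dim (p2_weight_space n j :: 'k p2 set) = card {f \<in> forests {1..n}. forest_degree f = j}"
proof -
  let ?e = "forest_elem :: tree list \<Rightarrow> 'k p2"
  have fin: "finite (forests {1..n})" using finite_trees_forests by simp
  have indep: "\<forall>f\<in>forests {1..n}. c f = 0" if "(\<Sum>f\<in>forests {1..n}. p2_scale (c f) (?e f)) = 0" for c
    using that assms by (intro forest_elem_independent) simp_all
  note dim = p2.dim_span_family[OF fin indep]
  show "p2_dim (p2_component n :: 'k p2 set) = card (forests {1..n})"
    unfolding p2_component_eq[OF assms] by (rule dim) auto
  have "p2_weight_space n j = p2_span (?e ` {f \<in> forests {1..n}. forest_degree f = j})"
    unfolding p2_weight_space_def p2_component_eq[OF assms] p2_span_def
    by (rule weight_space_eq[OF p2.vector_space_axioms fin indep])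
      (use assms in \<open>auto simp: p2_act_simps intro: forest_elem_act\<close>)
  then show "p2_dim (p2_weight_space n j :: 'k p2 set) = card {f \<in> forests {1..n}. forest_degree f
      = j}"
    using dim[where J = "{f \<in> forests {1..n}. forest_degree f = j}"] by auto
qed

text \<open>\<open>egf\<close> sets the constant term to zero, so coefficients are compared only for
  nonempty sets of generators.\<close>

lemma egf_cong: "(\<And>n. n \<ge> 1 \<Longrightarrow> a n = b n) \<Longrightarrow> egf a = egf b"
  unfolding egf_def by (rule arg_cong[of _ _ Abs_fps]) (auto simp: fun_eq_iff Suc_le_eq)

theorem corollary2:
  shows
    "egf (\<lambda>n. of_nat (lie2_dim (lie2_component n :: 'k::field_char_0 lie2 set))) =
       (egf (\<lambda>n. of_nat (n ^ (n - 1))) :: rat fps) \<and>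
     egf (\<lambda>n. of_nat (p2_dim (p2_component n :: 'k p2 set))) =
       (egf (\<lambda>n. of_nat ((n + 1) ^ (n - 1))) :: rat fps) \<and>
     egf (lie2_character TYPE('k)) =
       egf (\<lambda>n. \<Prod>k=1..n-1. of_nat k * fls_X + of_nat (n - k) * inverse fls_X) \<and>
     egf (p2_character TYPE('k)) =
       egf (\<lambda>n. \<Prod>k=1..n-1. of_nat k * fls_X + 1 + of_nat (n - k) * inverse fls_X)"
proof (intro conjI)
  show "egf (\<lambda>n. of_nat (lie2_dim (lie2_component n :: 'k lie2 set))) =
      (egf (\<lambda>n. of_nat (n ^ (n - 1))) :: rat fps)"
    by (rule egf_cong) (simp add: lie2_dims card_trees del: One_nat_def)
  show "egf (\<lambda>n. of_nat (p2_dim (p2_component n :: 'k p2 set))) =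
      (egf (\<lambda>n. of_nat ((n + 1) ^ (n - 1))) :: rat fps)"
    by (rule egf_cong) (simp add: p2_dims card_forests del: One_nat_def)
  show "egf (lie2_character TYPE('k)) =
      egf (\<lambda>n. \<Prod>k=1..n-1. of_nat k * fls_X + of_nat (n - k) * inverse fls_X)"
  proof (rule egf_cong)
    fix n :: nat assume n: "n \<ge> 1"
    have "lie2_character TYPE('k) n = (\<Sum>t\<in>trees {1..n}. fls_X powi tree_degree t)"
      unfolding lie2_character_def lie2_dims by (rule character_card) (simp add: finite_trees_forests)
    also have "\<dots> = (\<Prod>k=1..n-1. of_nat k * fls_X + of_nat (n - k) * inverse fls_X)"
      using n by (intro sum_tree_degree) simp_all
    finally show "lie2_character TYPE('k) n = \<dots>" .
  qed
  show "egf (p2_character TYPE('k)) =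
      egf (\<lambda>n. \<Prod>k=1..n-1. of_nat k * fls_X + 1 + of_nat (n - k) * inverse fls_X)"
  proof (rule egf_cong)
    fix n :: nat assume n: "n \<ge> 1"
    have "p2_character TYPE('k) n = (\<Sum>f\<in>forests {1..n}. fls_X powi forest_degree f)"
      unfolding p2_character_def p2_dims[OF n] by (rule character_card) (simp add: finite_trees_forests)
    also have "\<dots> = (\<Prod>k=1..n-1. of_nat k * fls_X + 1 + of_nat (n - k) * inverse fls_X)"
      using n by (intro sum_forest_degree fls_X_plus_of_nat_nonzero) simp_all
    finally show "p2_character TYPE('k) n = \<dots>" .
  qed
qed

end
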